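(* Let $\Omega\subset\mathbb{R}^N$ be a bounded Lipschitz domain, let $\alpha_1>\alpha_0\ge 0$ be constants and let $t\in[0,1]$. Let $(\mathbf{U},\mathbf{V})\in\mathbb{R}^N\times\mathbb{R}^N$ be a pair of constant vectors, regarded as constant fields on $\Omega$. Suppose that $(\mathbf{U},\mathbf{V})$ is the weak limit in $L^2(\Omega;\mathbb{R}^N\times\mathbb{R}^N)$ of a sequence of pairs of fields $(\mathbf{U}_j,\mathbf{V}_j)$ for which there are measurable functions $\chi_j:\Omega\to\{0,1\}$ such that, for every $j$, (1) $\operatorname{curl}\mathbf{U}_j=0$ and $\operatorname{div}\mathbf{V}_j=0$ in $\Omega$; (2) $\mathbf{V}_j=(\chi_j\alpha_1+(1-\chi_j)\alpha_0)\,|\mathbf{U}_j|^2\,\mathbf{U}_j$ in $\Omega$; (3) $|\{\mathbf{x}\in\Omega:\chi_j(\mathbf{x})=1\}|=t|\Omega|$. Then $$\gamma\,|\mathbf{U}|^4\le \mathbf{V}\cdot\mathbf{U},\qquad\text{where}\qquad \gamma=\frac{\alpha_1\alpha_0}{\big((1-t)\alpha_1^{1/3}+t\,\alpha_0^{1/3}\big)^3}.$$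
   Context: The conditions $\operatorname{curl}\mathbf{U}_j=0$ (i.e. $\partial_k U_j^{(l)}=\partial_l U_j^{(k)}$ for all $k,l$) and $\operatorname{div}\mathbf{V}_j=0$ are understood in the sense of distributions in $\Omega$. $|\cdot|$ denotes the Euclidean norm of a vector, or the Lebesgue measure of a set. *)

theory Defs
  imports "HOL-Analysis.Analysis"
begin

text \<open>
  Near each boundary point the set lies on one side of the graph of a Lipschitz function.
  The rotated coordinate system is described by the unit vector \<open>e\<close> of its last axis:
  \<open>y \<bullet> e\<close> is the last coordinate of \<open>y\<close>, and \<open>y - (y \<bullet> e) *\<^sub>R e\<close>, which lies in the
  hyperplane orthogonal to \<open>e\<close>, collects the other coordinates.
\<close>

definition bounded_lipschitz_domain :: "'a::euclidean_space set \<Rightarrow> bool" where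
  "bounded_lipschitz_domain \<Omega> \<longleftrightarrow>
     open \<Omega> \<and> connected \<Omega> \<and> \<Omega> \<noteq> {} \<and> bounded \<Omega> \<and>
     (\<forall>x\<in>frontier \<Omega>. \<exists>r>0. \<exists>e L \<psi>.
        norm e = 1 \<and> L-lipschitz_on {z. z \<bullet> e = 0} (\<psi> :: 'a \<Rightarrow> real) \<and>
        \<Omega> \<inter> ball x r = {y \<in> ball x r. y \<bullet> e > \<psi> (y - (y \<bullet> e) *\<^sub>R e)})"

definition partial_deriv :: "'n \<Rightarrow> (real^'n::finite \<Rightarrow> real) \<Rightarrow> real^'n \<Rightarrow> real" where
  "partial_deriv k f x = frechet_derivative f (at x) (axis k 1)"

text \<open>
  Since differentiability of every iterated partial derivative implies continuity of all of
  them, this is the usual \<open>C\<^sup>\<infinity>\<close> on the whole space.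
\<close>

definition smooth :: "(real^'n::finite \<Rightarrow> real) \<Rightarrow> bool" where
  "smooth f \<longleftrightarrow> (\<forall>ks x. foldr partial_deriv ks f differentiable at x)"

definition test_function :: "(real^'n::finite) set \<Rightarrow> (real^'n \<Rightarrow> real) \<Rightarrow> bool" where
  "test_function \<Omega> \<phi> \<longleftrightarrow>
     smooth \<phi> \<and> compact (closure {x. \<phi> x \<noteq> 0}) \<and> closure {x. \<phi> x \<noteq> 0} \<subseteq> \<Omega>"

text \<open>The distribution \<open>\<partial>\<^sub>k u\<close>, for locally integrable \<open>u\<close>, evaluated at a test function.\<close>

definition distr_partial ::
    "(real^'n::finite) set \<Rightarrow> 'n \<Rightarrow> (real^'n \<Rightarrow> real) \<Rightarrow> (real^'n \<Rightarrow> real) \<Rightarrow> real" where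
  "distr_partial \<Omega> k u \<phi> = - (LINT x|lebesgue_on \<Omega>. u x * partial_deriv k \<phi> x)"

definition curl_free :: "(real^'n::finite) set \<Rightarrow> (real^'n \<Rightarrow> real^'n) \<Rightarrow> bool" where
  "curl_free \<Omega> U \<longleftrightarrow>
     (\<forall>k l \<phi>. test_function \<Omega> \<phi> \<longrightarrow>
        distr_partial \<Omega> k (\<lambda>x. U x $ l) \<phi> = distr_partial \<Omega> l (\<lambda>x. U x $ k) \<phi>)"

definition div_free :: "(real^'n::finite) set \<Rightarrow> (real^'n \<Rightarrow> real^'n) \<Rightarrow> bool" where
  "div_free \<Omega> V \<longleftrightarrow>
     (\<forall>\<phi>. test_function \<Omega> \<phi> \<longrightarrow> (\<Sum>k\<in>UNIV. distr_partial \<Omega> k (\<lambda>x. V x $ k) \<phi>) = 0)"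

definition in_L2 :: "'a::euclidean_space set \<Rightarrow> ('a \<Rightarrow> 'b::euclidean_space) \<Rightarrow> bool" where
  "in_L2 \<Omega> f \<longleftrightarrow>
     f \<in> borel_measurable (lebesgue_on \<Omega>) \<and> integrable (lebesgue_on \<Omega>) (\<lambda>x. (norm (f x))\<^sup>2)"

text \<open>Continuous functionals on \<open>L\<^sup>2\<close> are represented by \<open>L\<^sup>2\<close> functions.\<close>

definition weakly_tendsto_L2 ::
    "'a::euclidean_space set \<Rightarrow> (nat \<Rightarrow> 'a \<Rightarrow> 'b::euclidean_space) \<Rightarrow> ('a \<Rightarrow> 'b) \<Rightarrow> bool" where
  "weakly_tendsto_L2 \<Omega> F f \<longleftrightarrow>
     (\<forall>j. in_L2 \<Omega> (F j)) \<and> in_L2 \<Omega> f \<and>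
     (\<forall>g. in_L2 \<Omega> g \<longrightarrow>
        (\<lambda>j. LINT x|lebesgue_on \<Omega>. F j x \<bullet> g x) \<longlonglongrightarrow> (LINT x|lebesgue_on \<Omega>. f x \<bullet> g x))"

end

theory Submission
  imports Defs
begin

text \<open>
  The theorem combines compensated compactness with a convexity bound.

  Compactness enters through the div-curl lemma (\<open>div_curl_lemma\<close>): if \<open>U\<^sub>j\<close> is curl-free, \<open>V\<^sub>j\<close> is divergence-free
  and both converge weakly in \<open>L\<^sup>2\<close>, then \<open>\<integral> \<phi> (U\<^sub>j \<bullet> V\<^sub>j)\<close> converges to \<open>\<integral> \<phi> (U \<bullet> V)\<close> for every test function \<open>\<phi>\<close>.
  The constitutive relation gives \<open>U\<^sub>j \<bullet> V\<^sub>j = a\<^sub>j |U\<^sub>j|\<^sup>4\<close>, where \<open>a\<^sub>j\<close> takes the values \<open>\<alpha>\<^sub>0\<close> and \<open>\<alpha>\<^sub>1\<close>, and convexity of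
  the fourth power bounds this from below by an expression that is affine in \<open>U\<^sub>j\<close> (\<open>quartic_tangent_bound\<close>):
  \<open>a\<^sub>j |U\<^sub>j|\<^sup>4 \<ge> 4 c\<^sup>3 |U|\<^sup>2 (U\<^sub>j \<bullet> U) - 3 c\<^sup>4 |U|\<^sup>4 b\<^sub>j\<close> with \<open>b\<^sub>j = a\<^sub>j\<close> to the power \<open>-1/3\<close>.  The point of tangency is
  chosen in each phase so that the linear term does not see the phase.  The linear term therefore passes to the weak limit,
  and the integral of \<open>b\<^sub>j\<close> over \<open>\<Omega>\<close> is known from the volume fraction \<open>t\<close>.  With \<open>c\<close> the reciprocal of the mean of
  \<open>b\<^sub>j\<close>, one has \<open>c\<^sup>3 = \<gamma>\<close>, and letting \<open>\<phi>\<close> increase to \<open>1\<close> on \<open>\<Omega>\<close> gives \<open>V \<bullet> U \<ge> (4 c\<^sup>3 - 3 c\<^sup>3) |U|\<^sup>4\<close>.  If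
  \<open>\<alpha>\<^sub>0 = 0\<close>, the same argument runs with \<open>c = 0\<close>.

  The div-curl lemma is proved without potentials, Rellich's theorem or Fourier analysis.  For a curl-free field \<open>u\<close>
  and \<open>w = \<phi> v\<close> with \<open>v\<close> divergence-free, the correlation \<open>y \<mapsto> \<integral> u(x) \<bullet> w(x + y) dx\<close> is Lipschitz near \<open>0\<close>
  with a constant \<open>L2_norm u * L2_norm (v \<bullet> \<nabla>\<phi>)\<close> (\<open>correlation_lipschitz\<close>): its directional derivative can be
  rearranged so that only the curl of \<open>u\<close> and the divergence of \<open>w\<close> occur.  Averaging against a mollifier \<open>\<rho>\<close> of
  radius \<open>\<epsilon>\<close> shows that replacing \<open>u\<close> by \<open>\<rho> * u\<close> changes \<open>\<integral> \<phi> (u \<bullet> v)\<close> by \<open>O(\<epsilon>)\<close>, uniformly over bounded sets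
  of fields.  For fixed \<open>\<rho>\<close> the mollified fields converge pointwise and boundedly, hence strongly, so the products
  converge.  Boundedness of weakly convergent sequences is the uniform boundedness principle (\<open>L2_uniform_boundedness\<close>),
  and the test functions needed are translates and products of explicit bumps.
\<close>

section \<open>Smooth functions and test functions\<close>

text \<open>
  Smoothness speaks of all iterated partial derivatives, so it is proved by exhibiting a class of
  differentiable functions that is closed under partial derivatives.
\<close>

lemma smooth_coinduct:
  assumes "P f" "\<And>g x. P g \<Longrightarrow> g differentiable at x" "\<And>g k. P g \<Longrightarrow> P (partial_deriv k g)"
  shows "smooth f"
proof -
  have "P (foldr partial_deriv ks f)" for ks
    by (induction ks) (use assms in auto)
  then show ?thesis using assms(2) unfolding smooth_def by blast
qed

lemma smooth_imp_differentiable: "smooth f \<Longrightarrow> f differentiable at x"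
  unfolding smooth_def by (metis foldr_Nil id_apply)

lemma smooth_partial_deriv: "smooth f \<Longrightarrow> smooth (partial_deriv k f)"
  unfolding smooth_def
proof (intro allI)
  fix ks x
  assume "\<forall>ks x. foldr partial_deriv ks f differentiable at x"
  then have "foldr partial_deriv (ks @ [k]) f differentiable at x" by blast
  then show "foldr partial_deriv ks (partial_deriv k f) differentiable at x" by simp
qed

lemma smooth_imp_continuous_on: "smooth f \<Longrightarrow> continuous_on S f"
  by (meson continuous_at_imp_continuous_on differentiable_imp_continuous_within smooth_imp_differentiable)

lemma borel_measurable_smooth [measurable]: "smooth f \<Longrightarrow> f \<in> borel_measurable borel"
  by (simp add: borel_measurable_continuous_onI smooth_imp_continuous_on)

lemma partial_deriv_eq:
  "(f has_derivative f') (at x) \<Longrightarrow> partial_deriv k f x = f' (axis k 1)"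
  unfolding partial_deriv_def by (metis frechet_derivative_at)

lemma has_derivative_partial_derivs:
  assumes "f differentiable at x"
  shows "(f has_derivative (\<lambda>h. \<Sum>k\<in>UNIV. h $ k * partial_deriv k f x)) (at x)"
proof -
  obtain f' where f': "(f has_derivative f') (at x)"
    using assms unfolding differentiable_def by blast
  interpret linear f' using f' by (rule has_derivative_linear)
  have "f' h = (\<Sum>k\<in>UNIV. h $ k * partial_deriv k f x)" for h
  proof -
    have "f' h = f' (\<Sum>k\<in>UNIV. h $ k *\<^sub>R axis k 1)"
      by (simp add: basis_expansion flip: scalar_mult_eq_scaleR)
    then show ?thesis by (simp add: sum scale partial_deriv_eq[OF f'])
  qed
  then have "f' = (\<lambda>h. \<Sum>k\<in>UNIV. h $ k * partial_deriv k f x)" by blast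
  with f' show ?thesis by simp
qed

lemma partial_deriv_add:
  assumes "f differentiable at x" "g differentiable at x"
  shows "partial_deriv k (\<lambda>x. f x + g x) x = partial_deriv k f x + partial_deriv k g x"
proof -
  obtain f' g' where d: "(f has_derivative f') (at x)" "(g has_derivative g') (at x)"
    using assms unfolding differentiable_def by blast
  show ?thesis
    using partial_deriv_eq[OF has_derivative_add[OF d]] d by (simp add: partial_deriv_eq)
qed

lemma partial_deriv_mult:
  assumes "f differentiable at x" "g differentiable at x"
  shows "partial_deriv k (\<lambda>x. f x * g x) x = partial_deriv k f x * g x + f x * partial_deriv k g x"
proof -
  obtain f' g' where d: "(f has_derivative f') (at x)" "(g has_derivative g') (at x)"
    using assms unfolding differentiable_def by blast
  show ?thesis
    using partial_deriv_eq[OF has_derivative_mult[OF d]] d by (simp add: partial_deriv_eq)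
qed

lemma smooth_const [simp]: "smooth (\<lambda>x. c)"
proof (rule smooth_coinduct[where P = "\<lambda>f. \<exists>c. f = (\<lambda>x. c)"])
  fix g :: "real^'n \<Rightarrow> real" and k assume "\<exists>c. g = (\<lambda>x. c)"
  then have "partial_deriv k g = (\<lambda>x. 0)" unfolding partial_deriv_def by auto
  then show "\<exists>c. partial_deriv k g = (\<lambda>x. c)" by blast
qed auto

lemma smooth_add:
  assumes "smooth f" "smooth g" shows "smooth (\<lambda>x. f x + g x)"
proof (rule smooth_coinduct[where P = "\<lambda>h. \<exists>f g. smooth f \<and> smooth g \<and> h = (\<lambda>x. f x + g x)"])
  fix h :: "real^'n \<Rightarrow> real" and k
  assume "\<exists>f g. smooth f \<and> smooth g \<and> h = (\<lambda>x. f x + g x)"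
  then obtain f g where fg: "smooth f" "smooth g" "h = (\<lambda>x. f x + g x)" by blast
  show "h differentiable at x" for x
    unfolding fg(3) using fg(1,2) by (simp add: differentiable_add smooth_imp_differentiable)
  from fg have "partial_deriv k h = (\<lambda>x. partial_deriv k f x + partial_deriv k g x)"
    by (auto simp: partial_deriv_add smooth_imp_differentiable)
  with fg show "\<exists>f g. smooth f \<and> smooth g \<and> partial_deriv k h = (\<lambda>x. f x + g x)"
    using smooth_partial_deriv by blast
qed (use assms in blast)

text \<open>
  Differentiating a product of smooth functions leaves the class of products, but not the
  class of finite sums of products; smoothness of products is proved for that larger class.
\<close>

inductive product_sum :: "(real^'n::finite \<Rightarrow> real) \<Rightarrow> bool" where
  "smooth f \<Longrightarrow> smooth g \<Longrightarrow> product_sum (\<lambda>x. f x * g x)"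
| "product_sum f \<Longrightarrow> product_sum g \<Longrightarrow> product_sum (\<lambda>x. f x + g x)"

lemma smooth_mult:
  assumes "smooth f" "smooth g" shows "smooth (\<lambda>x. f x * g x)"
proof (rule smooth_coinduct[where P = product_sum])
  have diff: "\<forall>x. h differentiable at x" if "product_sum h" for h :: "real^'n \<Rightarrow> real"
    using that by induction (simp_all add: differentiable_mult smooth_imp_differentiable)
  then show "h differentiable at x" if "product_sum h" for h :: "real^'n \<Rightarrow> real" and x
    using that by blast
  fix h :: "real^'n \<Rightarrow> real" and k assume "product_sum h"
  then show "product_sum (partial_deriv k h)"
  proof induction
    case (1 f g)
    then have "partial_deriv k (\<lambda>x. f x * g x) =
        (\<lambda>x. partial_deriv k f x * g x + f x * partial_deriv k g x)"
      by (auto simp: partial_deriv_mult smooth_imp_differentiable)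
    with 1 show ?case by (auto intro!: product_sum.intros smooth_partial_deriv)
  next
    case (2 f g)
    then have "partial_deriv k (\<lambda>x. f x + g x) = (\<lambda>x. partial_deriv k f x + partial_deriv k g x)"
      using diff by (intro ext partial_deriv_add) blast+
    with 2 show ?case by (auto intro!: product_sum.intros)
  qed
qed (use assms in \<open>auto intro: product_sum.intros\<close>)

lemma smooth_diff:
  assumes "smooth f" "smooth g" shows "smooth (\<lambda>x. f x - g x)"
  using smooth_add[OF assms(1) smooth_mult[OF smooth_const[of "-1"] assms(2)]] by simp

lemma smooth_prod: "finite A \<Longrightarrow> (\<And>i. i \<in> A \<Longrightarrow> smooth (f i)) \<Longrightarrow> smooth (\<lambda>x. \<Prod>i\<in>A. f i x)"
  by (induction A rule: finite_induct) (auto intro: smooth_mult)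

lemma smooth_power: "smooth f \<Longrightarrow> smooth (\<lambda>x. f x ^ n)"
  using smooth_prod[of "{..<n}" "\<lambda>_. f"] by simp

lemma partial_deriv_affine:
  fixes f :: "real^'n::finite \<Rightarrow> real"
  assumes "smooth f"
  shows "partial_deriv k (\<lambda>x. f (c *\<^sub>R x + z)) x = c * partial_deriv k f (c *\<^sub>R x + z)"
proof -
  obtain f' where f': "(f has_derivative f') (at (c *\<^sub>R x + z))"
    using smooth_imp_differentiable[OF assms] unfolding differentiable_def by blast
  have "((\<lambda>x. c *\<^sub>R x + z) has_derivative (\<lambda>h. c *\<^sub>R h)) (at x)"
    by (auto intro!: derivative_eq_intros)
  from has_derivative_compose[OF this f'] have "((\<lambda>x. f (c *\<^sub>R x + z)) has_derivative (\<lambda>h. f' (c *\<^sub>R h))) (at x)" .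
  moreover have "f' (c *\<^sub>R h) = c * f' h" for h
    using has_derivative_linear[OF f'] by (simp add: linear_cmul)
  ultimately show ?thesis by (simp add: partial_deriv_eq[OF f'] partial_deriv_eq)
qed

lemma smooth_affine:
  fixes f :: "real^'n::finite \<Rightarrow> real"
  assumes "smooth f" shows "smooth (\<lambda>x. f (c *\<^sub>R x + z))"
proof (rule smooth_coinduct[where P = "\<lambda>h. \<exists>a f. smooth f \<and> h = (\<lambda>x. a * f (c *\<^sub>R x + z))"])
  fix h :: "real^'n \<Rightarrow> real" assume "\<exists>a f. smooth f \<and> h = (\<lambda>x. a * f (c *\<^sub>R x + z))"
  then obtain a f where af: "smooth f" "h = (\<lambda>x. a * f (c *\<^sub>R x + z))" by blast
  have d: "(\<lambda>x. f (c *\<^sub>R x + z)) differentiable at x" for x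
    using differentiable_chain_at[of "\<lambda>x. c *\<^sub>R x + z" x f] smooth_imp_differentiable[OF af(1)]
    by (simp add: o_def)
  show "h differentiable at x" for x unfolding af(2) by (intro differentiable_mult d) simp
  have "partial_deriv k h = (\<lambda>x. (a * c) * partial_deriv k f (c *\<^sub>R x + z))" for k
    unfolding af(2) using partial_deriv_mult[OF _ d, of "\<lambda>_. a"] partial_deriv_affine[OF af(1)]
    by (auto simp: partial_deriv_def)
  then show "\<exists>a f. smooth f \<and> partial_deriv k h = (\<lambda>x. a * f (c *\<^sub>R x + z))" for k
    using smooth_partial_deriv[OF af(1)] by blast
next
  show "\<exists>a fa. smooth fa \<and> (\<lambda>x. f (c *\<^sub>R x + z)) = (\<lambda>x. a * fa (c *\<^sub>R x + z))"
    using assms by (intro exI[of _ 1] exI[of _ f]) auto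
qed

text \<open>
  The polynomial factor makes this a class closed under differentiation; \<open>flat 1\<close> is the standard function
  \<open>exp (-1/t)\<close> that vanishes to infinite order at \<open>0\<close>.
\<close>

definition flat :: "real poly \<Rightarrow> real \<Rightarrow> real" where
  "flat p t = (if t > 0 then poly p (1 / t) * exp (- (1 / t)) else 0)"

lemma poly_exp_tendsto_0: "((\<lambda>s. poly p s * exp (- s)) \<longlongrightarrow> (0::real)) at_top"
proof -
  have "((\<lambda>s. \<Sum>i\<le>degree p. coeff p i * (s ^ i / exp s)) \<longlongrightarrow> (\<Sum>i\<le>degree p. coeff p i * 0)) at_top"
    by (intro tendsto_sum tendsto_mult tendsto_const tendsto_power_div_exp_0)
  moreover have "(\<lambda>s. \<Sum>i\<le>degree p. coeff p i * (s ^ i / exp s)) = (\<lambda>s. poly p s * exp (- s))"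
    by (simp add: poly_altdef sum_distrib_right exp_minus divide_inverse mult.assoc)
  ultimately show ?thesis by simp
qed

lemma flat_has_derivative:
  "(flat p has_real_derivative flat ([:0, 0, 1:] * (p - pderiv p)) t) (at t)"
proof -
  consider "t > 0" | "t < 0" | "t = 0" by linarith
  then show ?thesis
  proof cases
    case 1
    have "((\<lambda>t. poly p (1/t) * exp (- (1/t))) has_real_derivative
        flat ([:0, 0, 1:] * (p - pderiv p)) t) (at t)"
      using 1 by (auto intro!: derivative_eq_intros DERIV_chain2[OF poly_DERIV]
          simp: flat_def field_simps power2_eq_square)
    then show ?thesis
      by (rule has_field_derivative_transform_within_open[where S = "{0<..}"])
        (use 1 in \<open>auto simp: flat_def\<close>)
  next
    case 2
    have "((\<lambda>t. 0) has_real_derivative flat ([:0, 0, 1:] * (p - pderiv p)) t) (at t)"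
      using 2 by (simp add: flat_def)
    then show ?thesis
      by (rule has_field_derivative_transform_within_open[where S = "{..<0}"])
        (use 2 in \<open>auto simp: flat_def\<close>)
  next
    case 3
    \<comment> \<open>The difference quotient at \<open>0\<close> has the same form, with the polynomial multiplied by its variable.\<close>
    have "((\<lambda>h. poly (pCons 0 p) (1/h) * exp (- (1/h))) \<longlongrightarrow> 0) (at_right 0)"
      by (rule filterlim_compose[OF poly_exp_tendsto_0])
        (simp add: filterlim_inverse_at_top_right flip: inverse_eq_divide)
    then have "((\<lambda>h. flat p h / h) \<longlongrightarrow> 0) (at_right 0)"
      by (rule Lim_transform_eventually)
        (auto simp: eventually_at_filter flat_def field_simps)
    moreover have "((\<lambda>h. flat p h / h) \<longlongrightarrow> 0) (at_left 0)"
      by (rule Lim_transform_eventually[OF tendsto_const])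
        (auto simp: eventually_at_filter flat_def)
    ultimately have "((\<lambda>h. flat p h / h) \<longlongrightarrow> 0) (at 0)"
      by (simp add: filterlim_at_split)
    then show ?thesis using 3 by (simp add: DERIV_def flat_def)
  qed
qed

lemma smooth_flat:
  fixes i :: "'n::finite"
  shows "smooth (\<lambda>x. flat p (x $ i))"
proof (rule smooth_coinduct[where P = "\<lambda>f. \<exists>p. f = (\<lambda>x. flat p (x $ i))"])
  fix f :: "real^'n \<Rightarrow> real" assume "\<exists>p. f = (\<lambda>x. flat p (x $ i))"
  then obtain p where f: "f = (\<lambda>x. flat p (x $ i))" by blast
  have d: "(f has_derivative (\<lambda>h. flat ([:0, 0, 1:] * (p - pderiv p)) (x $ i) * h $ i)) (at x)" for x
  proof -
    have "((\<lambda>x. x $ i) has_derivative (\<lambda>h. h $ i)) (at x)"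
      by (rule bounded_linear_imp_has_derivative) (rule bounded_linear_vec_nth)
    from has_derivative_compose[OF this has_field_derivative_imp_has_derivative[OF flat_has_derivative]]
    show ?thesis unfolding f .
  qed
  show "f differentiable at x" for x using d unfolding differentiable_def by blast
  have "partial_deriv k f = (\<lambda>x. flat (if k = i then [:0, 0, 1:] * (p - pderiv p) else 0) (x $ i))" for k
    using partial_deriv_eq[OF d] by (auto simp: axis_def flat_def)
  then show "\<exists>p. partial_deriv k f = (\<lambda>x. flat p (x $ i))" for k by blast
qed blast

lemma flat_1_bounds: "0 \<le> flat 1 t" "flat 1 t \<le> 1" "flat 1 t > 0 \<longleftrightarrow> t > 0" "flat 1 t = 0 \<longleftrightarrow> t \<le> 0"
  by (auto simp: flat_def)

definition bump :: "real^'n::finite \<Rightarrow> real^'n \<Rightarrow> real^'n \<Rightarrow> real" where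
  "bump a b x = (\<Prod>i\<in>UNIV. flat 1 (x $ i - a $ i) * flat 1 (b $ i - x $ i))"

lemma smooth_bump: "smooth (bump a b)"
proof -
  have "smooth (\<lambda>x. flat 1 (x $ i - a $ i))" "smooth (\<lambda>x. flat 1 (b $ i - x $ i))" for i
    using smooth_affine[OF smooth_flat[of 1 i], of 1 "- a"]
      smooth_affine[OF smooth_flat[of 1 i], of "-1" b] by simp_all
  then have "smooth (\<lambda>x. bump a b x)" unfolding bump_def by (intro smooth_prod smooth_mult) auto
  then show ?thesis .
qed

lemma bump_nonneg: "0 \<le> bump a b x"
  unfolding bump_def by (intro prod_nonneg) (auto simp: flat_1_bounds)

lemma bump_le_1: "bump a b x \<le> 1"
  unfolding bump_def by (intro prod_le_1) (auto simp: flat_1_bounds mult_le_one)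

lemma bump_eq_0_iff: "bump a b x = 0 \<longleftrightarrow> x \<notin> box a b"
  unfolding bump_def by (auto simp: flat_1_bounds mem_box_cart not_less)

lemma test_functionI:
  assumes "smooth f" "compact K" "K \<subseteq> \<Omega>" "\<And>x. x \<notin> K \<Longrightarrow> f x = 0"
  shows "test_function \<Omega> f"
proof -
  have "closure {x. f x \<noteq> 0} \<subseteq> K"
    using assms by (intro closure_minimal) (auto simp: compact_imp_closed)
  then show ?thesis
    unfolding test_function_def using assms by (meson closed_closure compact_closure bounded_closure
        bounded_subset closure_subset compact_imp_bounded subset_trans)
qed

lemma test_function_support:
  assumes "test_function \<Omega> f"
  obtains K where "compact K" "K \<subseteq> \<Omega>" "\<And>x. x \<notin> K \<Longrightarrow> f x = 0"
    "\<And>x k. x \<notin> K \<Longrightarrow> partial_deriv k f x = 0"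
proof
  let ?K = "closure {x. f x \<noteq> 0}"
  show "compact ?K" "?K \<subseteq> \<Omega>" using assms by (auto simp: test_function_def)
  show z: "f x = 0" if "x \<notin> ?K" for x using that closure_subset[of "{x. f x \<noteq> 0}"] by blast
  fix x k assume x: "x \<notin> ?K"
  have "((\<lambda>x. 0) has_derivative (\<lambda>h. 0)) (at x)" by simp
  then have "(f has_derivative (\<lambda>h. 0)) (at x)"
  proof (rule has_derivative_transform_within_open[where s = "- ?K"])
    fix y assume "y \<in> - ?K"
    then show "0 = f y" using z[of y] by simp
  qed (use x in auto)
  then show "partial_deriv k f x = 0" by (simp add: partial_deriv_eq)
qed

lemma compact_support_bounded:
  fixes f :: "'a::metric_space \<Rightarrow> real"
  assumes "continuous_on UNIV f" "compact K" "\<And>x. x \<notin> K \<Longrightarrow> f x = 0"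
  obtains C where "\<And>x. \<bar>f x\<bar> \<le> C" "C \<ge> 0"
proof -
  have "compact (f ` K)" using assms compact_continuous_image continuous_on_subset by blast
  then obtain C where C: "\<forall>y\<in>f ` K. norm y \<le> C" using compact_imp_bounded bounded_iff by metis
  have "\<bar>f x\<bar> \<le> max C 0" for x using C assms(3)[of x] by (cases "x \<in> K") auto
  then show ?thesis using that[of "max C 0"] by simp
qed

lemma test_function_bounded:
  assumes "test_function \<Omega> f"
  obtains C where "\<And>x. \<bar>f x\<bar> \<le> C" "\<And>x k. \<bar>partial_deriv k f x\<bar> \<le> C" "C \<ge> 0"
proof -
  have s: "smooth f" using assms by (simp add: test_function_def)
  obtain K where K: "compact K" "\<And>x. x \<notin> K \<Longrightarrow> f x = 0"
    "\<And>x k. x \<notin> K \<Longrightarrow> partial_deriv k f x = 0"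
    using test_function_support[OF assms] by metis
  obtain C where C: "\<And>x. \<bar>f x\<bar> \<le> C" "C \<ge> 0"
    using compact_support_bounded[OF smooth_imp_continuous_on[OF s] K(1,2)] by metis
  have "\<exists>D\<ge>0. \<forall>x. \<bar>partial_deriv k f x\<bar> \<le> D" for k
    using compact_support_bounded[OF smooth_imp_continuous_on[OF smooth_partial_deriv[OF s, of k]] K(1,3)]
    by metis
  then obtain D where D: "\<And>k. D k \<ge> 0" "\<And>k x. \<bar>partial_deriv k f x\<bar> \<le> D k" by metis
  have "D k \<le> (\<Sum>k\<in>UNIV. D k)" for k using D(1) by (intro member_le_sum) auto
  then have "\<bar>partial_deriv k f x\<bar> \<le> C + (\<Sum>k\<in>UNIV. D k)" for k x
    using D(2)[of k x] C(2) by (smt (verit))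
  moreover have "\<bar>f x\<bar> \<le> C + (\<Sum>k\<in>UNIV. D k)" for x
    using C(1)[of x] sum_nonneg[of UNIV D] D(1) by (smt (verit))
  ultimately show ?thesis using that C(2) sum_nonneg[of UNIV D] D(1) by (metis add_nonneg_nonneg)
qed

text \<open>
  An open set is a countable union of open boxes with closures inside it.  With \<open>\<beta>\<^sub>i\<close> the bump of the \<open>i\<close>-th box,
  the cut-offs \<open>1 - (\<Prod>i<m. (1 - \<beta>\<^sub>i)^m)\<close> do what is wanted: the \<open>m\<close>-th power pushes the factor of any box
  that contains \<open>x\<close> to \<open>0\<close>, although \<open>\<beta>\<^sub>i\<close> itself stays below \<open>1\<close>.
\<close>

lemma test_functions_exhaust:
  fixes \<Omega> :: "(real^'n::finite) set"
  assumes "open \<Omega>"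
  obtains \<phi> where "\<And>m. test_function \<Omega> (\<phi> m)" "\<And>m x. 0 \<le> \<phi> m x" "\<And>m x. \<phi> m x \<le> 1"
    "\<And>x. x \<in> \<Omega> \<Longrightarrow> (\<lambda>m::nat. \<phi> m x) \<longlonglongrightarrow> 1"
proof (cases "\<Omega> = {}")
  case True
  show ?thesis by (rule that[of "\<lambda>m x. 0"]) (auto simp: True test_function_def)
next
  case False
  define \<F> where "\<F> = {box a b |a b. cbox a b \<subseteq> \<Omega>}"
  obtain \<F>' where F': "\<F>' \<subseteq> \<F>" "countable \<F>'" "\<Union>\<F>' = \<Union>\<F>"
    by (rule Lindelof[of \<F>]) (auto simp: \<F>_def)
  have "x \<in> \<Union>\<F>" if x: "x \<in> \<Omega>" for x
  proof -
    obtain a b where "x \<in> box a b" "cbox a b \<subseteq> \<Omega>"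
      by (rule open_contains_cbox[OF assms x])
    then show ?thesis unfolding \<F>_def by blast
  qed
  moreover have "\<Union>\<F> \<subseteq> \<Omega>" unfolding \<F>_def using box_subset_cbox by blast
  ultimately have cover: "\<Union>\<F>' = \<Omega>" using F'(3) by blast
  then have ne: "\<F>' \<noteq> {}" using False by blast
  have "from_nat_into \<F>' i \<in> \<F>" for i using from_nat_into[OF ne] F'(1) by blast
  then obtain a b where ab: "\<And>i. from_nat_into \<F>' i = box (a i) (b i)" "\<And>i. cbox (a i) (b i) \<subseteq> \<Omega>"
    unfolding \<F>_def mem_Collect_eq by metis
  define \<phi> where "\<phi> m x = 1 - (\<Prod>i<m. (1 - bump (a i) (b i) x) ^ m)" for m x
  show ?thesis
  proof
    have P01: "0 \<le> (\<Prod>i<m. (1 - bump (a i) (b i) x) ^ m)" "(\<Prod>i<m. (1 - bump (a i) (b i) x) ^ m) \<le> 1" for m x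
      by (auto intro!: prod_nonneg prod_le_1 power_le_one simp: bump_nonneg bump_le_1)
    show "0 \<le> \<phi> m x" "\<phi> m x \<le> 1" for m x using P01[where m = m and x = x] by (auto simp: \<phi>_def)
    show "test_function \<Omega> (\<phi> m)" for m
    proof (rule test_functionI)
      show "smooth (\<phi> m)" unfolding \<phi>_def
        by (intro smooth_diff smooth_const smooth_prod smooth_power) (auto intro: smooth_bump)
      show "compact (\<Union>i<m. cbox (a i) (b i))" "(\<Union>i<m. cbox (a i) (b i)) \<subseteq> \<Omega>"
        using ab(2) by (auto intro!: compact_UN)
      fix x assume "x \<notin> (\<Union>i<m. cbox (a i) (b i))"
      then have "bump (a i) (b i) x = 0" if "i < m" for i
        using that box_subset_cbox by (fastforce simp: bump_eq_0_iff)
      then show "\<phi> m x = 0" by (simp add: \<phi>_def)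
    qed
    fix x assume "x \<in> \<Omega>"
    then obtain X where "X \<in> \<F>'" "x \<in> X" using cover by blast
    then obtain k where "x \<in> from_nat_into \<F>' k" using F'(2) from_nat_into_surj by metis
    then have pos: "bump (a k) (b k) x > 0"
      using bump_eq_0_iff[of "a k" "b k" x] bump_nonneg[of "a k" "b k" x] ab(1) by fastforce
    have lim: "(\<lambda>m. (1 - bump (a k) (b k) x) ^ m) \<longlonglongrightarrow> 0"
      using pos bump_le_1[of "a k" "b k" x] by (intro LIMSEQ_realpow_zero) auto
    have ev: "\<forall>\<^sub>F m in sequentially. (\<Prod>i<m. (1 - bump (a i) (b i) x) ^ m) \<le> (1 - bump (a k) (b k) x) ^ m"
    proof (rule eventually_sequentiallyI[of "Suc k"])
      fix m assume "Suc k \<le> m"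
      then have "(\<Prod>i<m. (1 - bump (a i) (b i) x) ^ m) =
          (1 - bump (a k) (b k) x) ^ m * (\<Prod>i\<in>{..<m} - {k}. (1 - bump (a i) (b i) x) ^ m)"
        by (intro prod.remove) auto
      also have "\<dots> \<le> (1 - bump (a k) (b k) x) ^ m * 1"
        by (intro mult_left_mono prod_le_1) (auto intro!: power_le_one simp: bump_nonneg bump_le_1)
      finally show "(\<Prod>i<m. (1 - bump (a i) (b i) x) ^ m) \<le> (1 - bump (a k) (b k) x) ^ m" by simp
    qed
    have "(\<lambda>m. \<Prod>i<m. (1 - bump (a i) (b i) x) ^ m) \<longlonglongrightarrow> 0"
      by (rule tendsto_sandwich[OF _ ev tendsto_const lim]) (simp add: P01(1))
    from tendsto_diff[OF tendsto_const this, of 1] show "(\<lambda>m. \<phi> m x) \<longlonglongrightarrow> 1" by (simp add: \<phi>_def)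
  qed
qed

lemma integrable_indicator_bounded:
  fixes A :: "'a::euclidean_space set"
  shows "bounded A \<Longrightarrow> A \<in> sets borel \<Longrightarrow> integrable lborel (\<lambda>x. indicator A x :: real)"
  using emeasure_bounded_finite[of A] by (intro integrable_real_indicator) auto

definition mollifier :: "real \<Rightarrow> (real^'n::finite \<Rightarrow> real) \<Rightarrow> bool" where
  "mollifier \<delta> \<rho> \<longleftrightarrow> smooth \<rho> \<and> (\<forall>x. 0 \<le> \<rho> x) \<and> (\<forall>x. norm x > \<delta> \<longrightarrow> \<rho> x = 0) \<and>
     integrable lborel \<rho> \<and> (LINT x|lborel. \<rho> x) = 1"

lemma mollifier_exists:
  assumes "\<delta> > 0"
  obtains \<rho> :: "real^'n::finite \<Rightarrow> real" where "mollifier \<delta> \<rho>"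
proof -
  obtain a b :: "real^'n" where ab: "0 \<in> box a b" "cbox a b \<subseteq> ball 0 \<delta>"
    by (rule open_contains_cbox[of "ball (0::real^'n) \<delta>" 0]) (use assms in auto)
  define I where "I = (LINT x|lborel. bump a b x)"
  have cont: "continuous_on UNIV (bump a b)" by (rule smooth_imp_continuous_on[OF smooth_bump])
  have out: "bump a b x = 0" if "x \<notin> cbox a b" for x
    using that box_subset_cbox[of a b] by (auto simp: bump_eq_0_iff)
  have int: "integrable lborel (bump a b)"
  proof (rule Bochner_Integration.integrable_bound)
    show "integrable lborel (\<lambda>x. indicator (cbox a b) x :: real)"
      by (rule integrable_indicator_bounded) auto
    show "AE x in lborel. norm (bump a b x) \<le> norm (indicator (cbox a b) x :: real)"
      by (intro AE_I2) (simp add: indicator_def bump_nonneg bump_le_1 out)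
  qed (use cont borel_measurable_continuous_onI in auto)
  have "I \<noteq> 0"
  proof
    assume "I = 0"
    then have "AE x in lborel. bump a b x = 0"
      unfolding I_def using integral_nonneg_eq_0_iff_AE[OF int] bump_nonneg by auto
    then have "AE x in lborel. x \<notin> box a b" by (simp add: bump_eq_0_iff)
    then have "box a b \<in> null_sets lborel" by (subst (asm) AE_iff_null_sets[symmetric]) auto
    then have "negligible (box a b)" by (simp add: negligible_iff_null_sets null_sets_completionI)
    then show False using open_not_negligible[of "box a b"] ab(1) by auto
  qed
  moreover have "I \<ge> 0" unfolding I_def by (simp add: bump_nonneg)
  ultimately have I: "I > 0" by simp
  show ?thesis
  proof
    show "mollifier \<delta> (\<lambda>x. (1 / I) * bump a b x)"
      unfolding mollifier_def
    proof (intro conjI allI impI)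
      show "smooth (\<lambda>x. (1 / I) * bump a b x)" by (intro smooth_mult smooth_const) (rule smooth_bump)
      fix x :: "real^'n" assume "\<delta> < norm x"
      then have "x \<notin> cbox a b" using ab(2) by (auto simp: subset_eq)
      then show "(1 / I) * bump a b x = 0" using out by simp
    next
      show "(LINT x|lborel. (1 / I) * bump a b x) = 1"
        using I by (simp flip: I_def)
    qed (use I int in \<open>auto simp: bump_nonneg\<close>)
  qed
qed

section \<open>Square integrable functions\<close>

definition square_integrable :: "'a measure \<Rightarrow> ('a \<Rightarrow> 'b::euclidean_space) \<Rightarrow> bool" where
  "square_integrable M f \<longleftrightarrow> f \<in> borel_measurable M \<and> integrable M (\<lambda>x. (norm (f x))\<^sup>2)"

definition L2_norm :: "'a measure \<Rightarrow> ('a \<Rightarrow> 'b::euclidean_space) \<Rightarrow> real" where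
  "L2_norm M f = sqrt (LINT x|M. (norm (f x))\<^sup>2)"

lemma square_integrable_measurable: "square_integrable M f \<Longrightarrow> f \<in> borel_measurable M"
  and square_integrable_integrable: "square_integrable M f \<Longrightarrow> integrable M (\<lambda>x. (norm (f x))\<^sup>2)"
  by (auto simp: square_integrable_def)

lemma L2_norm_nonneg [simp]: "L2_norm M f \<ge> 0"
  by (simp add: L2_norm_def)

lemma L2_norm_power2: "(L2_norm M f)\<^sup>2 = (LINT x|M. (norm (f x))\<^sup>2)"
  by (simp add: L2_norm_def)

lemma L2_norm_le_iff: "c \<ge> 0 \<Longrightarrow> L2_norm M f \<le> c \<longleftrightarrow> (LINT x|M. (norm (f x))\<^sup>2) \<le> c\<^sup>2"
  unfolding L2_norm_def by (metis real_sqrt_le_iff real_sqrt_abs abs_of_nonneg)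

lemma square_integrable_bound:
  assumes "square_integrable M f" "g \<in> borel_measurable M" "\<And>x. norm (g x) \<le> C * norm (f x)"
  shows "square_integrable M g"
proof -
  have "integrable M (\<lambda>x. (norm (g x))\<^sup>2)"
  proof (rule Bochner_Integration.integrable_bound)
    show "integrable M (\<lambda>x. C\<^sup>2 * (norm (f x))\<^sup>2)"
      using assms(1) by (simp add: square_integrable_def)
    show "AE x in M. norm ((norm (g x))\<^sup>2) \<le> norm (C\<^sup>2 * (norm (f x))\<^sup>2)"
      using power_mono[OF assms(3) norm_ge_zero, of _ 2] by (simp add: power_mult_distrib)
  qed (use assms(2) in measurable)
  then show ?thesis using assms(2) by (simp add: square_integrable_def)
qed

lemma square_integrable_norm:
  assumes "square_integrable M f" shows "square_integrable M (\<lambda>x. norm (f x))"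
proof (rule square_integrable_bound[OF assms, where C = 1])
  show "(\<lambda>x. norm (f x)) \<in> borel_measurable M"
    by (rule measurable_compose[OF square_integrable_measurable[OF assms] borel_measurable_norm])
qed simp

lemma square_integrable_scaleR:
  assumes "square_integrable M f" shows "square_integrable M (\<lambda>x. c *\<^sub>R f x)"
proof (rule square_integrable_bound[OF assms, where C = "\<bar>c\<bar>"])
  show "(\<lambda>x. c *\<^sub>R f x) \<in> borel_measurable M"
    by (rule borel_measurable_scaleR[OF borel_measurable_const square_integrable_measurable[OF assms]])
qed simp

lemma square_integrable_add:
  assumes "square_integrable M f" "square_integrable M g"
  shows "square_integrable M (\<lambda>x. f x + g x)"
proof -
  have m [measurable]: "f \<in> borel_measurable M" "g \<in> borel_measurable M"
    using assms by (simp_all add: square_integrable_measurable)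
  have "integrable M (\<lambda>x. (norm (f x + g x))\<^sup>2)"
  proof (rule Bochner_Integration.integrable_bound)
    show "integrable M (\<lambda>x. 2 * (norm (f x))\<^sup>2 + 2 * (norm (g x))\<^sup>2)"
      using assms by (simp add: square_integrable_def)
    have "(norm (f x + g x))\<^sup>2 \<le> 2 * (norm (f x))\<^sup>2 + 2 * (norm (g x))\<^sup>2" for x
    proof -
      have "(norm (f x + g x))\<^sup>2 \<le> (norm (f x) + norm (g x))\<^sup>2"
        by (intro power_mono norm_triangle_ineq) simp
      also have "\<dots> \<le> 2 * (norm (f x))\<^sup>2 + 2 * (norm (g x))\<^sup>2"
        using zero_le_power2[of "norm (f x) - norm (g x)"] by (simp add: power2_eq_square algebra_simps)
      finally show ?thesis .
    qed
    then show "AE x in M. norm ((norm (f x + g x))\<^sup>2) \<le> norm (2 * (norm (f x))\<^sup>2 + 2 * (norm (g x))\<^sup>2)"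
      by simp
  qed measurable
  then show ?thesis by (simp add: square_integrable_def)
qed

lemma square_integrable_diff:
  assumes "square_integrable M f" "square_integrable M g"
  shows "square_integrable M (\<lambda>x. f x - g x)"
  using square_integrable_add[OF assms(1) square_integrable_scaleR[OF assms(2), of "-1"]] by simp

lemma integrable_mult_square_integrable:
  fixes f g :: "'a \<Rightarrow> real"
  assumes "square_integrable M f" "square_integrable M g"
  shows "integrable M (\<lambda>x. f x * g x)"
proof (rule Bochner_Integration.integrable_bound)
  show "integrable M (\<lambda>x. (norm (f x))\<^sup>2 + (norm (g x))\<^sup>2)"
    using assms by (simp add: square_integrable_def)
  have "\<bar>f x * g x\<bar> \<le> (f x)\<^sup>2 + (g x)\<^sup>2" for x
  proof -
    have "2 * (\<bar>f x\<bar> * \<bar>g x\<bar>) \<le> (f x)\<^sup>2 + (g x)\<^sup>2"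
      using sum_squares_bound[of "\<bar>f x\<bar>" "\<bar>g x\<bar>"] by (simp add: mult.assoc)
    moreover have "0 \<le> \<bar>f x\<bar> * \<bar>g x\<bar>" by simp
    ultimately show ?thesis unfolding abs_mult by linarith
  qed
  then show "AE x in M. norm (f x * g x) \<le> norm ((norm (f x))\<^sup>2 + (norm (g x))\<^sup>2)" by simp
qed (use assms in \<open>simp add: square_integrable_measurable borel_measurable_times\<close>)

lemma integrable_inner_square_integrable:
  assumes "square_integrable M f" "square_integrable M g"
  shows "integrable M (\<lambda>x. f x \<bullet> g x)"
proof (rule Bochner_Integration.integrable_bound)
  show "integrable M (\<lambda>x. norm (f x) * norm (g x))"
    using assms by (intro integrable_mult_square_integrable square_integrable_norm)
  show "AE x in M. norm (f x \<bullet> g x) \<le> norm (norm (f x) * norm (g x))"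
    by (simp add: Cauchy_Schwarz_ineq2)
qed (use assms in \<open>simp add: square_integrable_measurable borel_measurable_inner\<close>)

lemma Cauchy_Schwarz_L2_norm:
  assumes "square_integrable M f" "square_integrable M g"
  shows "(LINT x|M. norm (f x) * norm (g x)) \<le> L2_norm M f * L2_norm M g"
proof -
  define A where "A = (LINT x|M. (norm (f x))\<^sup>2)"
  define B where "B = (LINT x|M. norm (f x) * norm (g x))"
  define C where "C = (LINT x|M. (norm (g x))\<^sup>2)"
  have fg: "integrable M (\<lambda>x. norm (f x) * norm (g x))"
    using assms by (intro integrable_mult_square_integrable square_integrable_norm)
  note int = square_integrable_integrable[OF assms(1)] square_integrable_integrable[OF assms(2)] fg
  have quad: "2 * s * B \<le> s\<^sup>2 * A + C" for s
  proof -
    have "0 \<le> (LINT x|M. (s * norm (f x) - norm (g x))\<^sup>2)" by simp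
    also have "\<dots> = (LINT x|M. s\<^sup>2 * (norm (f x))\<^sup>2 - 2 * s * (norm (f x) * norm (g x)) + (norm (g x))\<^sup>2)"
      by (intro Bochner_Integration.integral_cong) (auto simp: power2_eq_square algebra_simps)
    also have "\<dots> = s\<^sup>2 * A - 2 * s * B + C"
      unfolding A_def B_def C_def using int by simp
    finally show ?thesis by simp
  qed
  have nn: "A \<ge> 0" "B \<ge> 0" "C \<ge> 0" by (auto simp: A_def B_def C_def)
  have "B\<^sup>2 \<le> A * C"
  proof (cases "A = 0")
    case True
    then have "B = 0"
      using quad[of "(C + 1) / (2 * B)"] nn by (cases "B = 0") (auto simp: field_simps)
    then show ?thesis using nn by simp
  next
    case False
    then have "2 * (B / A) * B \<le> (B / A)\<^sup>2 * A + C" using quad by blast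
    then show ?thesis using False nn by (simp add: field_simps power2_eq_square)
  qed
  then have "B \<le> sqrt (A * C)" using nn by (simp add: real_le_rsqrt)
  then show ?thesis by (simp add: A_def B_def C_def L2_norm_def real_sqrt_mult)
qed

lemma abs_integral_inner_le:
  assumes "square_integrable M f" "square_integrable M g"
  shows "\<bar>LINT x|M. f x \<bullet> g x\<bar> \<le> L2_norm M f * L2_norm M g"
proof -
  have "\<bar>LINT x|M. f x \<bullet> g x\<bar> \<le> (LINT x|M. norm (f x) * norm (g x))"
    using assms by (intro integral_abs_bound[THEN order_trans] integral_mono)
      (auto intro!: integrable_mult_square_integrable square_integrable_norm
        integrable_inner_square_integrable simp: Cauchy_Schwarz_ineq2)
  then show ?thesis using Cauchy_Schwarz_L2_norm[OF assms] by linarith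
qed

lemma L2_norm_triangle:
  assumes "square_integrable M f" "square_integrable M g"
  shows "L2_norm M (\<lambda>x. f x + g x) \<le> L2_norm M f + L2_norm M g"
proof -
  have fg: "integrable M (\<lambda>x. norm (f x) * norm (g x))"
    using assms by (intro integrable_mult_square_integrable square_integrable_norm)
  note int = square_integrable_integrable[OF assms(1)] square_integrable_integrable[OF assms(2)] fg
  have "(LINT x|M. (norm (f x + g x))\<^sup>2)
      \<le> (LINT x|M. (norm (f x))\<^sup>2 + 2 * (norm (f x) * norm (g x)) + (norm (g x))\<^sup>2)"
  proof (rule integral_mono)
    show "integrable M (\<lambda>x. (norm (f x + g x))\<^sup>2)"
      using square_integrable_add[OF assms] by (rule square_integrable_integrable)
    fix x
    have "(norm (f x + g x))\<^sup>2 \<le> (norm (f x) + norm (g x))\<^sup>2"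
      by (intro power_mono norm_triangle_ineq) simp
    then show "(norm (f x + g x))\<^sup>2 \<le> (norm (f x))\<^sup>2 + 2 * (norm (f x) * norm (g x)) + (norm (g x))\<^sup>2"
      by (simp add: power2_sum)
  qed (use int in simp)
  also have "\<dots> = (L2_norm M f)\<^sup>2 + 2 * (LINT x|M. norm (f x) * norm (g x)) + (L2_norm M g)\<^sup>2"
    using int by (simp add: L2_norm_power2)
  also have "\<dots> \<le> (L2_norm M f + L2_norm M g)\<^sup>2"
    using Cauchy_Schwarz_L2_norm[OF assms] by (simp add: power2_sum)
  finally show ?thesis by (simp add: L2_norm_le_iff)
qed

lemma square_integrable_zero [simp]: "square_integrable M (\<lambda>x. 0)" "L2_norm M (\<lambda>x. 0) = 0"
  by (auto simp: square_integrable_def L2_norm_def)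

lemma L2_norm_scaleR: "L2_norm M (\<lambda>x. c *\<^sub>R f x) = \<bar>c\<bar> * L2_norm M f"
  by (simp add: L2_norm_def power_mult_distrib real_sqrt_mult)

lemma L2_norm_sum_norm:
  fixes d :: "nat \<Rightarrow> 'a \<Rightarrow> 'b::euclidean_space"
  assumes "\<And>m. square_integrable M (d m)"
  shows "square_integrable M (\<lambda>x. \<Sum>m<N. norm (d m x)) \<and>
    L2_norm M (\<lambda>x. \<Sum>m<N. norm (d m x)) \<le> (\<Sum>m<N. L2_norm M (d m))"
proof (induction N)
  case (Suc N)
  have d: "square_integrable M (\<lambda>x. norm (d N x))" by (rule square_integrable_norm) (rule assms)
  have "L2_norm M (\<lambda>x. norm (d N x)) = L2_norm M (d N)" by (simp add: L2_norm_def)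
  then show ?case
    using Suc square_integrable_add[OF conjunct1[OF Suc] d] L2_norm_triangle[OF conjunct1[OF Suc] d]
    by (auto simp: add.commute)
qed simp

text \<open>The part of the completeness of \<open>L\<^sup>2\<close> needed here: absolutely convergent series converge.\<close>

lemma square_integrable_suminf:
  fixes d :: "nat \<Rightarrow> 'a \<Rightarrow> 'b::euclidean_space"
  assumes d: "\<And>m. square_integrable M (d m)" and E: "\<And>N. (\<Sum>m<N. L2_norm M (d m)) \<le> E"
  shows "AE x in M. summable (\<lambda>m. norm (d m x))"
    and "square_integrable M (\<lambda>x. \<Sum>m. d m x)"
    and "L2_norm M (\<lambda>x. \<Sum>m. d m x) \<le> E"
proof -
  have [measurable]: "d m \<in> borel_measurable M" for m using d by (rule square_integrable_measurable)
  have E0: "E \<ge> 0" using E[of 0] by simp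
  define q where "q N x = ennreal ((\<Sum>m<N. norm (d m x))\<^sup>2)" for N x
  have inc: "incseq q"
    unfolding q_def incseq_def le_fun_def
    by (intro allI impI ennreal_leI power_mono sum_mono2) (auto intro: sum_nonneg)
  have [measurable]: "q N \<in> borel_measurable M" for N unfolding q_def by measurable
  have "(\<integral>\<^sup>+x. q N x \<partial>M) \<le> ennreal (E\<^sup>2)" for N
  proof -
    let ?s = "\<lambda>x. \<Sum>m<N. norm (d m x)"
    have s: "square_integrable M ?s" "L2_norm M ?s \<le> E"
      using L2_norm_sum_norm[of M d N, OF d] E[of N] by auto
    have "(\<integral>\<^sup>+x. q N x \<partial>M) = ennreal (LINT x|M. (norm (?s x))\<^sup>2)"
      using square_integrable_integrable[OF s(1)] unfolding q_def
      by (subst nn_integral_eq_integral) auto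
    then show ?thesis using s(2) E0 by (simp add: L2_norm_le_iff ennreal_leI)
  qed
  then have sup: "(\<integral>\<^sup>+x. (SUP N. q N x) \<partial>M) \<le> ennreal (E\<^sup>2)"
    by (subst nn_integral_monotone_convergence_SUP[OF inc]) (auto intro: SUP_least)
  then have "(\<integral>\<^sup>+x. (SUP N. q N x) \<partial>M) \<noteq> \<infinity>" by (auto simp: top_unique)
  then have fin: "AE x in M. (SUP N. q N x) \<noteq> \<infinity>" by (intro nn_integral_PInf_AE) auto
  have pt: "summable (\<lambda>m. norm (d m x)) \<and> ennreal ((norm (\<Sum>m. d m x))\<^sup>2) \<le> (SUP N. q N x)"
    if "(SUP N. q N x) \<noteq> \<infinity>" for x
  proof -
    obtain r where r: "r \<ge> 0" "(SUP N. q N x) = ennreal r"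
      using \<open>(SUP N. q N x) \<noteq> \<infinity>\<close> by (cases "SUP N. q N x") auto
    have "q N x \<le> ennreal r" for N unfolding r(2)[symmetric] by (intro SUP_upper) auto
    then have "(\<Sum>m<N. norm (d m x))\<^sup>2 \<le> r" for N using r(1) by (simp add: q_def)
    then have le: "(\<Sum>m<N. norm (d m x)) \<le> sqrt r" for N by (rule real_le_rsqrt)
    have sm: "summable (\<lambda>m. norm (d m x))"
      by (rule bounded_imp_summable[OF _ le[of "Suc _", unfolded lessThan_Suc_atMost]]) auto
    have "norm (\<Sum>m. d m x) \<le> (\<Sum>m. norm (d m x))" by (rule summable_norm[OF sm])
    also have "\<dots> \<le> sqrt r" by (rule suminf_le_const[OF sm le])
    finally have "(norm (\<Sum>m. d m x))\<^sup>2 \<le> r" using r(1) by (metis norm_ge_zero power_mono real_sqrt_pow2)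
    then show ?thesis using sm r by (simp add: ennreal_leI)
  qed
  show "AE x in M. summable (\<lambda>m. norm (d m x))" using fin pt by auto
  have [measurable]: "(\<lambda>x. \<Sum>m. d m x) \<in> borel_measurable M" by measurable
  have nn: "(\<integral>\<^sup>+x. ennreal ((norm (\<Sum>m. d m x))\<^sup>2) \<partial>M) \<le> ennreal (E\<^sup>2)"
    by (rule order_trans[OF nn_integral_mono_AE sup]) (use fin pt in auto)
  have int: "integrable M (\<lambda>x. (norm (\<Sum>m. d m x))\<^sup>2)"
  proof (rule integrableI_bounded)
    show "(\<integral>\<^sup>+x. ennreal (norm ((norm (\<Sum>m. d m x))\<^sup>2)) \<partial>M) < \<infinity>"
      using nn by (auto intro: le_less_trans)
  qed measurable
  then show "square_integrable M (\<lambda>x. \<Sum>m. d m x)" by (simp add: square_integrable_def)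
  have "ennreal (LINT x|M. (norm (\<Sum>m. d m x))\<^sup>2) \<le> ennreal (E\<^sup>2)"
    using nn by (subst (asm) nn_integral_eq_integral[OF int]) auto
  then show "L2_norm M (\<lambda>x. \<Sum>m. d m x) \<le> E" using E0 by (simp add: L2_norm_le_iff)
qed

text \<open>
  Weak convergence bounds the norms through this instance of the uniform boundedness principle.  The proof is a gliding
  hump: if the norms were unbounded, members \<open>F (j m)\<close> with norms \<open>n\<^sub>m > 6^m\<close> would give, with suitable signs, a
  series with terms \<open>\<plusminus> F (j m) / (3^m n\<^sub>m)\<close> on which the functionals are unbounded.  The sign is chosen to make the
  partial sum that includes the \<open>m\<close>-th term pair with \<open>F (j m)\<close> to at least \<open>n\<^sub>m / 3^m\<close> in absolute value, and the
  later terms can take away only half of that, which leaves more than \<open>2^m / 2\<close>.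
\<close>

lemma L2_uniform_boundedness:
  fixes F :: "nat \<Rightarrow> 'a \<Rightarrow> 'b::euclidean_space"
  assumes F: "\<And>j. square_integrable M (F j)"
    and bdd: "\<And>g. square_integrable M g \<Longrightarrow> \<exists>B. \<forall>j. \<bar>LINT x|M. F j x \<bullet> g x\<bar> \<le> B"
  shows "\<exists>B. \<forall>j. L2_norm M (F j) \<le> B"
proof (rule ccontr)
  assume "\<not> ?thesis"
  then have "\<forall>m::nat. \<exists>j. L2_norm M (F j) > 6 ^ m" by (meson not_le)
  then obtain j where j: "\<And>m. L2_norm M (F (j m)) > 6 ^ m" by metis
  have Fpos: "L2_norm M (F (j m)) > 0" for m using j[of m] zero_less_power[of "6::real" m] by linarith
  define T where "T m g = (LINT x|M. F (j m) x \<bullet> g x)" for m g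
  define c where "c m g = (if T m g \<ge> 0 then 1 else -1) * (1/3) ^ m / L2_norm M (F (j m))" for m g
  define S where "S = rec_nat (\<lambda>x. 0) (\<lambda>m g x. g x + c m g *\<^sub>R F (j m) x)"
  have S0: "S 0 = (\<lambda>x. 0)" and SSuc: "S (Suc m) = (\<lambda>x. S m x + c m (S m) *\<^sub>R F (j m) x)" for m
    by (auto simp: S_def)
  define d where "d m x = c m (S m) *\<^sub>R F (j m) x" for m x
  have d: "square_integrable M (d m)" for m unfolding d_def by (rule square_integrable_scaleR) (rule F)
  have nd: "L2_norm M (d m) = (1/3) ^ m" for m
    unfolding d_def L2_norm_scaleR using Fpos[of m] by (auto simp: c_def abs_mult)
  have S: "square_integrable M (S m)" for m
  proof (induction m)
    case (Suc m)
    then show ?case using square_integrable_add[OF Suc d[of m]] by (simp add: SSuc d_def)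
  qed (simp add: S0)
  have Ssum: "S m x = (\<Sum>i<m. d i x)" for m x by (induction m) (auto simp: S0 SSuc d_def)
  have geo: "(\<Sum>i<N. L2_norm M (d (i + m))) \<le> (1/3) ^ m * (3/2)" for N m
  proof -
    have "(\<Sum>i<N. L2_norm M (d (i + m))) = (1/3) ^ m * (\<Sum>i<N. (1/3) ^ i)"
      by (simp add: nd power_add sum_distrib_left mult.commute)
    also have "(\<Sum>i<N. (1/3::real) ^ i) = (3 - 3 * (1/3) ^ N) / 2"
      by (subst geometric_sum) (simp_all add: field_simps)
    also have "(3 - 3 * (1/3) ^ N) / 2 \<le> (3 / 2 :: real)" by simp
    finally show ?thesis by simp
  qed
  define g where "g x = (\<Sum>i. d i x)" for x
  have geo0: "(\<Sum>i<N. L2_norm M (d i)) \<le> 3/2" for N using geo[where N = N and m = 0] by simp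
  have g: "square_integrable M g" "AE x in M. summable (\<lambda>m. norm (d m x))"
    using square_integrable_suminf[of M d, OF d geo0] unfolding g_def by auto
  define R where "R m x = (\<Sum>i. d (i + Suc m) x)" for m x
  have R: "square_integrable M (R m)" "L2_norm M (R m) \<le> (1/3) ^ Suc m * (3/2)" for m
    unfolding R_def using square_integrable_suminf(2,3)[of M "\<lambda>i. d (i + Suc m)", OF d geo] by auto
  have FF: "T m (F (j m)) = (L2_norm M (F (j m)))\<^sup>2" for m
    by (simp add: T_def L2_norm_power2 power2_norm_eq_inner)
  have key: "\<bar>T m g\<bar> \<ge> 2 ^ m / 2" for m
  proof -
    let ?n = "L2_norm M (F (j m))"
    have TS: "T m (S (Suc m)) = T m (S m) + c m (S m) * ?n\<^sup>2"
      unfolding FF[symmetric] unfolding T_def SSuc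
      using integrable_inner_square_integrable[OF F S] integrable_inner_square_integrable[OF F F]
      by (simp add: inner_add_right)
    have "c m (S m) * ?n\<^sup>2 = (if T m (S m) \<ge> 0 then 1 else -1) * ((1/3) ^ m * ?n)"
      using Fpos[of m] by (simp add: c_def power2_eq_square)
    moreover have "(1/3) ^ m * ?n \<ge> 0" by simp
    ultimately have 1: "\<bar>T m (S (Suc m))\<bar> \<ge> (1/3) ^ m * ?n" unfolding TS by (auto split: if_splits)
    have "T m g = (LINT x|M. F (j m) x \<bullet> (S (Suc m) x + R m x))"
      unfolding T_def
    proof (rule integral_cong_AE)
      show "AE x in M. F (j m) x \<bullet> g x = F (j m) x \<bullet> (S (Suc m) x + R m x)"
        using g(2)
      proof eventually_elim
        case (elim x)
        then have "summable (\<lambda>m. d m x)" by (rule summable_norm_cancel)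
        from suminf_split_initial_segment[OF this, of "Suc m"]
        show ?case by (simp only: g_def R_def Ssum add.commute)
      qed
    qed (simp_all add: square_integrable_measurable F g S R borel_measurable_inner borel_measurable_add)
    also have "\<dots> = T m (S (Suc m)) + T m (R m)"
      unfolding T_def
      using integrable_inner_square_integrable[OF F S] integrable_inner_square_integrable[OF F R(1)]
      by (simp add: inner_add_right)
    finally have 2: "T m g = T m (S (Suc m)) + T m (R m)" .
    have "\<bar>T m (R m)\<bar> \<le> ?n * L2_norm M (R m)"
      unfolding T_def by (rule abs_integral_inner_le[OF F R(1)])
    also have "\<dots> \<le> ?n * ((1/3) ^ Suc m * (3/2))" by (intro mult_left_mono R) simp
    finally have "\<bar>T m (R m)\<bar> \<le> (1/3) ^ m * ?n / 2" by (simp add: field_simps)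
    with 1 2 have "\<bar>T m g\<bar> \<ge> (1/3) ^ m * ?n / 2" by linarith
    moreover have "(1/3) ^ m * ?n \<ge> (1/3) ^ m * 6 ^ m" using j[of m] by (intro mult_left_mono) auto
    moreover have "(1/3) ^ m * 6 ^ m = (2::real) ^ m" by (simp flip: power_mult_distrib)
    ultimately show ?thesis by simp
  qed
  obtain B where "\<bar>LINT x|M. F j x \<bullet> g x\<bar> \<le> B" for j using bdd[OF g(1)] by blast
  then have "\<bar>T m g\<bar> \<le> B" for m by (simp add: T_def)
  moreover obtain m where "(2::real) ^ m > 2 * B" using real_arch_pow[of 2 "2 * B"] by auto
  ultimately show False using key[of m] by (smt (verit) field_sum_of_halves)
qed

section \<open>Correlations of square integrable functions\<close>

lemma lborel_distr_isometry:
  fixes t :: "'a::euclidean_space"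
  assumes "\<bar>c\<bar> = 1"
  shows "distr lborel borel (\<lambda>x. t + c *\<^sub>R x) = (lborel :: 'a measure)"
  using lborel_affine[of c t] assms by (simp add: density_1)

lemma
  fixes f :: "'a::euclidean_space \<Rightarrow> 'b::{banach,second_countable_topology}" and t :: 'a
  assumes "f \<in> borel_measurable borel" "\<bar>c\<bar> = 1"
  shows integrable_lborel_isometry: "integrable lborel (\<lambda>x. f (t + c *\<^sub>R x)) \<longleftrightarrow> integrable lborel f"
    and integral_lborel_isometry: "(LINT x|lborel. f (t + c *\<^sub>R x)) = (LINT x|lborel. f x)"
  using integrable_distr_eq[of "\<lambda>x. t + c *\<^sub>R x" lborel borel f]
    integral_distr[of "\<lambda>x. t + c *\<^sub>R x" lborel borel f] assms
  by (simp_all add: lborel_distr_isometry)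

lemma
  fixes f :: "'a::euclidean_space \<Rightarrow> 'b::euclidean_space"
  assumes f: "square_integrable lborel f"
  shows square_integrable_translate: "square_integrable lborel (\<lambda>x. f (x + t))"
    and L2_norm_translate: "L2_norm lborel (\<lambda>x. f (x + t)) = L2_norm lborel f"
proof -
  have [measurable]: "f \<in> borel_measurable borel"
    using square_integrable_measurable[OF f] by simp
  have m: "(\<lambda>x. (norm (f x))\<^sup>2) \<in> borel_measurable borel" by measurable
  show "square_integrable lborel (\<lambda>x. f (x + t))"
    using f integrable_lborel_isometry[OF m, of 1 t] by (simp add: square_integrable_def add.commute)
  show "L2_norm lborel (\<lambda>x. f (x + t)) = L2_norm lborel f"
    using integral_lborel_isometry[OF m, of 1 t] by (simp add: L2_norm_def add.commute)
qed

lemma square_integrable_imp_integrable: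
  fixes f :: "'a::euclidean_space \<Rightarrow> 'b::euclidean_space"
  assumes f: "square_integrable lborel f" and R: "\<And>x. norm x > R \<Longrightarrow> f x = 0"
  shows "integrable lborel f"
proof (rule Bochner_Integration.integrable_bound)
  show "integrable lborel (\<lambda>x. indicator (cball 0 R) x + (norm (f x))\<^sup>2 :: real)"
    using square_integrable_integrable[OF f] integrable_indicator_bounded[of "cball 0 R :: 'a set"] by simp
  have "norm (f x) \<le> indicator (cball 0 R) x + (norm (f x))\<^sup>2" for x
  proof (cases "norm x > R")
    case False
    have "2 * norm (f x) \<le> 1 + (norm (f x))\<^sup>2"
      using sum_squares_bound[of 1 "norm (f x)"] by simp
    then have "norm (f x) \<le> 1 + (norm (f x))\<^sup>2" using norm_ge_zero[of "f x"] by linarith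
    with False show ?thesis by (simp add: indicator_def)
  qed (simp add: R)
  then show "AE x in lborel. norm (f x) \<le> norm (indicator (cball 0 R) x + (norm (f x))\<^sup>2 :: real)"
    by (auto intro!: AE_I2)
qed (use f square_integrable_measurable in blast)

text \<open>
  A measurable function is an almost everywhere limit of continuous functions.  Truncating \<open>f\<close> at a height \<open>M\<close>
  first lets these approximants be clamped to \<open>[-M, M]\<close> and cut off outside a ball, and then dominated
  convergence gives convergence in \<open>L\<^sup>2\<close>.
\<close>

lemma L2_approx_continuous:
  fixes f :: "'a::euclidean_space \<Rightarrow> real"
  assumes f: "square_integrable lborel f" and R: "\<And>x. norm x > R \<Longrightarrow> f x = 0" and "e > 0"
  obtains g where "continuous_on UNIV g" "\<And>x. norm x > R + 1 \<Longrightarrow> g x = 0"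
    "square_integrable lborel (\<lambda>x. f x - g x)" "L2_norm lborel (\<lambda>x. f x - g x) < e"
proof -
  have [measurable]: "f \<in> borel_measurable borel"
    using square_integrable_measurable[OF f] by simp
  define cl where "cl M s = max (- real M) (min (real M) s)" for M s
  have cl0: "cl M 0 = 0" for M by (simp add: cl_def)
  have cl_cont: "continuous_on UNIV (cl M)" for M unfolding cl_def by (intro continuous_intros)
  have [measurable]: "cl M \<in> borel_measurable borel" for M
    by (intro borel_measurable_continuous_onI cl_cont)
  have "(\<lambda>M. LINT x|lborel. (f x - cl M (f x))\<^sup>2) \<longlonglongrightarrow> (LINT x::'a|lborel. (0::real))"
  proof (rule integral_dominated_convergence[where w = "\<lambda>x. (norm (f x))\<^sup>2"])
    show "AE x in lborel. (\<lambda>M. (f x - cl M (f x))\<^sup>2) \<longlonglongrightarrow> 0"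
    proof (rule AE_I2)
      fix x
      obtain N where N: "real N \<ge> \<bar>f x\<bar>" using real_arch_simple by blast
      have "\<forall>\<^sub>F M in sequentially. (f x - cl M (f x))\<^sup>2 = 0"
        using N by (intro eventually_sequentiallyI[of N]) (auto simp: cl_def)
      then show "(\<lambda>M. (f x - cl M (f x))\<^sup>2) \<longlonglongrightarrow> 0"
        by (simp add: tendsto_eventually)
    qed
    fix M
    have "\<bar>f x - cl M (f x)\<bar> \<le> \<bar>f x\<bar>" for x by (auto simp: cl_def)
    then show "AE x in lborel. norm ((f x - cl M (f x))\<^sup>2) \<le> (norm (f x))\<^sup>2"
      by (intro AE_I2) (simp add: abs_le_square_iff)
  qed (use square_integrable_integrable[OF f] in simp_all)
  then have "\<forall>\<^sub>F M in sequentially. (LINT x|lborel. (f x - cl M (f x))\<^sup>2) < (e/2)\<^sup>2"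
    using \<open>e > 0\<close> by (intro order_tendstoD) auto
  then obtain M where M: "(LINT x|lborel. (f x - cl M (f x))\<^sup>2) < (e/2)\<^sup>2"
    by (auto simp: eventually_sequentially)
  have "f \<in> borel_measurable lebesgue" by (simp add: measurable_completion)
  then have "f measurable_on UNIV"
    by (intro lebesgue_measurable_imp_measurable_on) auto
  then obtain N g where N: "negligible N" and g: "\<And>k. continuous_on UNIV (g k)"
    and lim: "\<And>x. x \<notin> N \<Longrightarrow> (\<lambda>k. g k x) \<longlonglongrightarrow> f x"
    unfolding measurable_on_def by auto
  \<comment> \<open>\<open>\<kappa>\<close> equals \<open>1\<close> on the support of \<open>f\<close>, so multiplying by it does not disturb the limit.\<close>
  define \<kappa> where "\<kappa> x = max 0 (min 1 (R + 1 - norm x))" for x :: 'a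
  have \<kappa>: "0 \<le> \<kappa> x" "\<kappa> x \<le> 1" "norm x > R + 1 \<Longrightarrow> \<kappa> x = 0" "norm x \<le> R \<Longrightarrow> \<kappa> x = 1" for x
    by (auto simp: \<kappa>_def)
  define h where "h k x = \<kappa> x * cl M (g k x)" for k x
  have h_cont: "continuous_on UNIV (h k)" for k
    unfolding h_def \<kappa>_def
    by (intro continuous_intros continuous_on_compose2[OF cl_cont g]) auto
  have [measurable]: "h k \<in> borel_measurable borel" for k
    by (intro borel_measurable_continuous_onI h_cont)
  have clf: "cl M (f x) = \<kappa> x * cl M (f x)" for x
    using \<kappa>(4)[of x] R[of x] by (cases "norm x \<le> R") (auto simp: cl0)
  have bd: "\<bar>cl M (f x) - h k x\<bar> \<le> 2 * real M * indicator (cball 0 (R + 1)) x" for k x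
  proof -
    have "\<bar>cl M (f x) - h k x\<bar> = \<kappa> x * \<bar>cl M (f x) - cl M (g k x)\<bar>"
      unfolding h_def by (subst clf) (use \<kappa>(1)[of x] in \<open>simp add: abs_mult flip: right_diff_distrib\<close>)
    also have "\<dots> \<le> \<kappa> x * (2 * real M)"
      using \<kappa>(1)[of x] by (intro mult_left_mono) (auto simp: cl_def)
    also have "\<dots> \<le> 2 * real M * indicator (cball 0 (R + 1)) x"
      using \<kappa>(1-3)[of x] by (auto simp: indicator_def mult_left_le_one_le)
    finally show ?thesis .
  qed
  have bd2: "(cl M (f x) - h k x)\<^sup>2 \<le> (2 * real M)\<^sup>2 * indicator (cball 0 (R + 1)) x" for k x
    using power_mono[OF bd abs_ge_zero, of x k 2] by (auto simp: indicator_def split: if_splits)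
  have indint: "integrable lborel (\<lambda>x::'a. (2 * real M)\<^sup>2 * indicator (cball 0 (R + 1)) x :: real)"
    using integrable_indicator_bounded[of "cball 0 (R + 1) :: 'a set"] by simp
  have aeN: "AE x in lborel. x \<notin> N"
    using N AE_not_in[of N lebesgue] by (simp add: negligible_iff_null_sets AE_completion_iff)
  have "(\<lambda>k. LINT x|lborel. (cl M (f x) - h k x)\<^sup>2) \<longlonglongrightarrow> (LINT x::'a|lborel. (0::real))"
  proof (rule integral_dominated_convergence[where w = "\<lambda>x. (2 * real M)\<^sup>2 * indicator (cball 0 (R + 1)) x"])
    show "AE x in lborel. (\<lambda>k. (cl M (f x) - h k x)\<^sup>2) \<longlonglongrightarrow> 0"
      using aeN
    proof eventually_elim
      case (elim x)
      have "(\<lambda>k. cl M (g k x)) \<longlonglongrightarrow> cl M (f x)"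
        using continuous_on_tendsto_compose[OF cl_cont lim[OF elim]] by simp
      then have "(\<lambda>k. (cl M (f x) - h k x)\<^sup>2) \<longlonglongrightarrow> (cl M (f x) - \<kappa> x * cl M (f x))\<^sup>2"
        unfolding h_def by (intro tendsto_intros)
      then show ?case using clf[of x] by simp
    qed
    show "AE x in lborel. norm ((cl M (f x) - h k x)\<^sup>2) \<le> (2 * real M)\<^sup>2 * indicator (cball 0 (R + 1)) x" for k
      using bd2 by simp
  qed (use indint in auto)
  then have "\<forall>\<^sub>F k in sequentially. (LINT x|lborel. (cl M (f x) - h k x)\<^sup>2) < (e/2)\<^sup>2"
    using \<open>e > 0\<close> by (intro order_tendstoD) auto
  then obtain k where k: "(LINT x|lborel. (cl M (f x) - h k x)\<^sup>2) < (e/2)\<^sup>2"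
    by (auto simp: eventually_sequentially)
  have s1: "square_integrable lborel (\<lambda>x. f x - cl M (f x))"
    by (rule square_integrable_bound[OF f, where C = 1]) (auto simp: cl_def)
  have s2: "square_integrable lborel (\<lambda>x. cl M (f x) - h k x)"
    unfolding square_integrable_def
  proof
    show "integrable lborel (\<lambda>x. (norm (cl M (f x) - h k x))\<^sup>2)"
      by (rule Bochner_Integration.integrable_bound[OF indint]) (use bd2 in \<open>auto intro!: AE_I2\<close>)
  qed measurable
  have n1: "L2_norm lborel (\<lambda>x. f x - cl M (f x)) < e/2" "L2_norm lborel (\<lambda>x. cl M (f x) - h k x) < e/2"
    using real_less_lsqrt[OF _ M] real_less_lsqrt[OF _ k] \<open>e > 0\<close> unfolding L2_norm_def real_norm_def power2_abs
    by linarith+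
  show ?thesis
  proof
    show "square_integrable lborel (\<lambda>x. f x - h k x)"
      using square_integrable_add[OF s1 s2] by simp
    show "L2_norm lborel (\<lambda>x. f x - h k x) < e"
      using L2_norm_triangle[OF s1 s2] n1 by simp
  qed (use h_cont \<kappa>(3) in \<open>auto simp: h_def\<close>)
qed

text \<open>
  When \<open>u\<close> is continuous with compact support, this is dominated convergence after moving the translation onto \<open>u\<close>.
  By the Cauchy-Schwarz inequality the general correlation is a uniform limit of such ones.
\<close>

lemma continuous_on_correlation_real:
  fixes u w :: "'a::euclidean_space \<Rightarrow> real"
  assumes u: "square_integrable lborel u" and w: "square_integrable lborel w"
    and Ru: "\<And>x. norm x > R \<Longrightarrow> u x = 0" and Rw: "\<And>x. norm x > R \<Longrightarrow> w x = 0"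
  shows "continuous_on UNIV (\<lambda>y. LINT x|lborel. u x * w (x + y))"
proof -
  have [measurable]: "u \<in> borel_measurable borel" "w \<in> borel_measurable borel"
    using u w by (auto intro: square_integrable_measurable[where M = lborel, simplified])
  have "\<exists>g. continuous_on UNIV g \<and> (\<forall>x. norm x > R + 1 \<longrightarrow> g x = 0) \<and>
      square_integrable lborel (\<lambda>x. u x - g x) \<and> L2_norm lborel (\<lambda>x. u x - g x) < 1 / real (Suc n)" for n
    by (rule L2_approx_continuous[OF u Ru, where e = "1 / real (Suc n)"]) auto
  then obtain g where g: "\<And>n. continuous_on UNIV (g n)" "\<And>n x. norm x > R + 1 \<Longrightarrow> g n x = 0"
      "\<And>n. square_integrable lborel (\<lambda>x. u x - g n x)"
      "\<And>n. L2_norm lborel (\<lambda>x. u x - g n x) < 1 / real (Suc n)"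
    by metis
  have [measurable]: "g n \<in> borel_measurable borel" for n
    by (intro borel_measurable_continuous_onI g)
  have wint: "integrable lborel w" by (rule square_integrable_imp_integrable[OF w Rw])
  have gsq: "square_integrable lborel (g n)" for n
    using square_integrable_diff[OF u g(3)[of n]] by simp
  define c where "c n y = (LINT x|lborel. g n x * w (x + y))" for n y
  have cont: "continuous_on UNIV (c n)" for n
  proof -
    obtain C where C: "\<And>x. \<bar>g n x\<bar> \<le> C"
      using compact_support_bounded[OF g(1)[of n] compact_cball[of 0 "R + 1"]] g(2)[of _ n]
      by (metis dist_0_norm mem_cball not_le)
    have c: "c n y = (LINT z|lborel. g n (z - y) * w z)" for y
      unfolding c_def
      using integral_lborel_isometry[of "\<lambda>x. g n x * w (x + y)" 1 "- y"] by simp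
    show ?thesis
      unfolding continuous_on_sequentially
    proof (intro ballI allI impI)
      fix y and z :: "nat \<Rightarrow> 'a" assume "(\<forall>i. z i \<in> UNIV) \<and> z \<longlonglongrightarrow> y"
      then have z: "z \<longlonglongrightarrow> y" by simp
      show "(c n \<circ> z) \<longlonglongrightarrow> c n y"
        unfolding c o_def
      proof (rule integral_dominated_convergence[where w = "\<lambda>x. C * \<bar>w x\<bar>"])
        show "AE x in lborel. (\<lambda>i. g n (x - z i) * w x) \<longlonglongrightarrow> g n (x - y) * w x"
          by (intro AE_I2 tendsto_mult tendsto_const continuous_on_tendsto_compose[OF g(1)] tendsto_diff z) auto
        show "AE x in lborel. norm (g n (x - z i) * w x) \<le> C * \<bar>w x\<bar>" for i
          using C by (auto simp: abs_mult intro!: AE_I2 mult_right_mono)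
      qed (use wint in auto)
    qed
  qed
  have "uniform_limit UNIV c (\<lambda>y. LINT x|lborel. u x * w (x + y)) sequentially"
    unfolding uniform_limit_iff
  proof (intro allI impI)
    fix e :: real assume "e > 0"
    let ?K = "L2_norm lborel w"
    have "(\<lambda>n. 1 / real (Suc n) * ?K) \<longlonglongrightarrow> 0 * ?K"
      by (intro tendsto_intros LIMSEQ_inverse_real_of_nat[unfolded inverse_eq_divide])
    then have "\<forall>\<^sub>F n in sequentially. 1 / real (Suc n) * ?K < e"
      using \<open>e > 0\<close> by (intro order_tendstoD) auto
    then show "\<forall>\<^sub>F n in sequentially. \<forall>y\<in>UNIV. dist (c n y) (LINT x|lborel. u x * w (x + y)) < e"
    proof eventually_elim
      case (elim n)
      have "dist (c n y) (LINT x|lborel. u x * w (x + y)) < e" for y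
      proof -
        have wy: "square_integrable lborel (\<lambda>x. w (x + y))" by (rule square_integrable_translate[OF w])
        have "dist (c n y) (LINT x|lborel. u x * w (x + y))
            = \<bar>(LINT x|lborel. u x * w (x + y)) - c n y\<bar>" by (simp add: dist_real_def abs_minus_commute)
        also have "\<dots> = \<bar>LINT x|lborel. (u x - g n x) \<bullet> w (x + y)\<bar>"
          unfolding c_def
          using integrable_mult_square_integrable[OF u wy] integrable_mult_square_integrable[OF gsq wy]
          by (simp add: left_diff_distrib)
        also have "\<dots> \<le> L2_norm lborel (\<lambda>x. u x - g n x) * L2_norm lborel (\<lambda>x. w (x + y))"
          by (rule abs_integral_inner_le[OF g(3) wy])
        also have "\<dots> \<le> 1 / real (Suc n) * ?K"
          unfolding L2_norm_translate[OF w] using g(4)[of n] by (intro mult_right_mono) auto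
        finally show ?thesis using elim by linarith
      qed
      then show ?case by blast
    qed
  qed
  then show ?thesis
    by (rule uniform_limit_theorem[rotated]) (auto simp: cont)
qed

definition correlation :: "('a::euclidean_space \<Rightarrow> 'b::euclidean_space) \<Rightarrow> ('a \<Rightarrow> 'b) \<Rightarrow> 'a \<Rightarrow> real" where
  "correlation u w y = (LINT x|lborel. u x \<bullet> w (x + y))"

lemma square_integrable_inner_const:
  assumes "square_integrable M f" shows "square_integrable M (\<lambda>x. f x \<bullet> b)"
proof (rule square_integrable_bound[OF assms, where C = "norm b"])
  show "(\<lambda>x. f x \<bullet> b) \<in> borel_measurable M"
    by (rule borel_measurable_inner[OF square_integrable_measurable[OF assms] borel_measurable_const])
qed (simp add: Cauchy_Schwarz_ineq2 mult.commute[of "norm b"])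

lemma square_integrable_nth:
  fixes f :: "'a \<Rightarrow> real^'n::finite"
  assumes "square_integrable M f" shows "square_integrable M (\<lambda>x. f x $ k)"
  using square_integrable_inner_const[OF assms, of "axis k 1"] by (simp add: inner_axis)

lemma correlation_components:
  fixes u w :: "'a::euclidean_space \<Rightarrow> real^'n::finite"
  assumes "square_integrable lborel u" "square_integrable lborel w"
  shows "correlation u w y = (\<Sum>k\<in>UNIV. LINT x|lborel. u x $ k * w (x + y) $ k)"
  unfolding correlation_def inner_vec_def inner_real_def
  by (rule Bochner_Integration.integral_sum)
    (intro integrable_mult_square_integrable square_integrable_nth square_integrable_translate assms)

lemma continuous_on_correlation:
  fixes u w :: "'a::euclidean_space \<Rightarrow> real^'n::finite"
  assumes "square_integrable lborel u" "square_integrable lborel w"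
    "\<And>x. norm x > R \<Longrightarrow> u x = 0" "\<And>x. norm x > R \<Longrightarrow> w x = 0"
  shows "continuous_on UNIV (correlation u w)"
proof -
  have "continuous_on UNIV (\<lambda>y. \<Sum>k\<in>UNIV. LINT x|lborel. u x $ k * w (x + y) $ k)"
    using assms
    by (intro continuous_on_sum continuous_on_correlation_real[where R = R] square_integrable_nth) auto
  then show ?thesis by (simp only: flip: correlation_components[OF assms(1,2)])
qed

lemma abs_correlation_le:
  assumes "square_integrable lborel u" "square_integrable lborel w"
  shows "\<bar>correlation u w y\<bar> \<le> L2_norm lborel u * L2_norm lborel w"
  using abs_integral_inner_le[OF assms(1) square_integrable_translate[OF assms(2)]]
  by (simp add: correlation_def L2_norm_translate[OF assms(2)])

text \<open>
  All statements are Fubini's theorem for \<open>f(x) g(z) \<theta>(z - x)\<close>; the left-hand sides arise from the shear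
  \<open>(x, z) \<mapsto> (x, x + z)\<close>, which preserves the measure.
\<close>

lemma
  fixes f g \<theta> :: "'a::euclidean_space \<Rightarrow> real"
  assumes f: "integrable lborel f" and g: "integrable lborel g"
    and \<theta>: "\<theta> \<in> borel_measurable borel" "\<And>x. \<bar>\<theta> x\<bar> \<le> C"
  shows integral_correlation_fst:
      "(LINT z|lborel. (LINT x|lborel. f x * g (x + z)) * \<theta> z)
        = (LINT x|lborel. f x * (LINT z|lborel. g z * \<theta> (z - x)))" (is ?A)
    and integral_correlation_snd:
      "(LINT z|lborel. (LINT x|lborel. f x * g (x + z)) * \<theta> z)
        = (LINT z|lborel. g z * (LINT x|lborel. f x * \<theta> (z - x)))" (is ?B)
    and integrable_correlation: "integrable lborel (\<lambda>z. (LINT x|lborel. f x * g (x + z)) * \<theta> z)" (is ?C)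
    and integrable_correlation_fst: "integrable lborel (\<lambda>x. f x * (LINT z|lborel. g z * \<theta> (z - x)))" (is ?D)
proof -
  have [measurable]: "f \<in> borel_measurable borel" "g \<in> borel_measurable borel" "\<theta> \<in> borel_measurable borel"
    using f g \<theta>(1) by (auto dest: borel_measurable_integrable)
  have C0: "C \<ge> 0" using \<theta>(2)[of 0] by linarith
  define H where "H = (\<lambda>x z. f x * g z * \<theta> (z - x))"
  define K where "K = (\<lambda>x z. f x * g (x + z) * \<theta> z)"
  have fg: "integrable (lborel \<Otimes>\<^sub>M lborel) (\<lambda>(x, z). f x * g z)"
  proof (rule lborel_pair.Fubini_integrable)
    show "integrable lborel (\<lambda>x. LINT z|lborel. norm (case (x, z) of (x, z) \<Rightarrow> f x * g z))"
      using f by (simp add: abs_mult)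
    show "AE x in lborel. integrable lborel (\<lambda>z. case (x, z) of (x, z) \<Rightarrow> f x * g z)"
      using g by simp
  qed measurable
  have H: "integrable (lborel \<Otimes>\<^sub>M lborel) (case_prod H)"
  proof (rule Bochner_Integration.integrable_bound)
    show "integrable (lborel \<Otimes>\<^sub>M lborel) (\<lambda>p. C * (case p of (x, z) \<Rightarrow> f x * g z))"
      using fg by simp
    show "case_prod H \<in> borel_measurable (lborel \<Otimes>\<^sub>M lborel)" unfolding H_def by measurable
    have "\<bar>H x z\<bar> \<le> \<bar>C * (f x * g z)\<bar>" for x z
      unfolding H_def using C0 mult_left_mono[OF \<theta>(2)[of "z - x"], of "\<bar>f x * g z\<bar>"]
      by (simp add: abs_mult mult_ac)
    then show "AE p in lborel \<Otimes>\<^sub>M lborel. norm (case_prod H p) \<le> norm (C * (case p of (x, z) \<Rightarrow> f x * g z))"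
      by (auto intro!: AE_I2)
  qed
  have KH: "K x z = H x (x + z)" for x z by (simp add: K_def H_def)
  have Hm: "H x \<in> borel_measurable borel" for x unfolding H_def by measurable
  have K: "integrable (lborel \<Otimes>\<^sub>M lborel) (case_prod K)"
  proof (rule lborel_pair.Fubini_integrable)
    have "(LINT z|lborel. norm (K x z)) = (LINT z|lborel. norm (H x z))" for x
      unfolding KH using integral_lborel_isometry[of "\<lambda>z. norm (H x z)" 1 x] Hm by simp
    then show "integrable lborel (\<lambda>x. LINT z|lborel. norm (case (x, z) of (x, z) \<Rightarrow> K x z))"
      using lborel_pair.integrable_fst'[OF integrable_norm[OF H]] by simp
    show "AE x in lborel. integrable lborel (\<lambda>z. case (x, z) of (x, z) \<Rightarrow> K x z)"
      using lborel_pair.AE_integrable_fst'[OF H]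
      unfolding KH prod.case using integrable_lborel_isometry[OF Hm, of 1] by simp
    show "case_prod K \<in> borel_measurable (lborel \<Otimes>\<^sub>M lborel)" unfolding K_def by measurable
  qed
  have "(LINT z|lborel. (LINT x|lborel. f x * g (x + z)) * \<theta> z) = (LINT z|lborel. LINT x|lborel. K x z)"
    by (simp add: K_def)
  also have "\<dots> = (LINT x|lborel. LINT z|lborel. K x z)"
    by (rule lborel_pair.Fubini_integral[OF K])
  also have "\<dots> = (LINT x|lborel. LINT z|lborel. H x z)"
    unfolding KH using integral_lborel_isometry[OF Hm, of 1] by simp
  finally have *: "(LINT z|lborel. (LINT x|lborel. f x * g (x + z)) * \<theta> z)
      = (LINT x|lborel. LINT z|lborel. H x z)" .
  also have "\<dots> = (LINT x|lborel. f x * (LINT z|lborel. g z * \<theta> (z - x)))"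
    by (simp add: H_def mult.assoc)
  finally show ?A .
  from * have "(LINT z|lborel. (LINT x|lborel. f x * g (x + z)) * \<theta> z)
      = (LINT z|lborel. LINT x|lborel. H x z)"
    by (simp add: lborel_pair.Fubini_integral[OF H])
  also have "\<dots> = (LINT z|lborel. LINT x|lborel. g z * (f x * \<theta> (z - x)))"
    by (simp only: H_def mult_ac)
  also have "\<dots> = (LINT z|lborel. g z * (LINT x|lborel. f x * \<theta> (z - x)))"
    by simp
  finally show ?B .
  show ?C using lborel_pair.integrable_snd[OF K] by (simp add: K_def)
  show ?D using lborel_pair.integrable_fst'[OF H] by (simp add: H_def mult.assoc)
qed

section \<open>The correlation of a curl-free and a divergence-controlled field\<close>

lemma integral_compact_support:
  fixes h :: "'a::euclidean_space \<Rightarrow> real"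
  assumes "continuous_on UNIV h" "\<And>x. x \<notin> cbox a b \<Longrightarrow> h x = 0"
  shows "integrable lborel h" "(LINT x|lborel. h x) = integral (cbox a b) h"
proof -
  have eq: "(\<lambda>x. indicator (cbox a b) x *\<^sub>R h x) = h" using assms(2) by (auto simp: indicator_def fun_eq_iff)
  have int: "integrable lborel (\<lambda>x. indicator (cbox a b) x *\<^sub>R h x)"
    by (rule borel_integrable_compact) (use assms(1) continuous_on_subset in auto)
  then show "integrable lborel h" by (simp only: eq)
  show "(LINT x|lborel. h x) = integral (cbox a b) h"
    using set_borel_integral_eq_integral(2)[of "cbox a b" h] int
    by (simp only: set_lebesgue_integral_def set_integrable_def eq)
qed

lemma integrable_compact_support:
  fixes h :: "'a::euclidean_space \<Rightarrow> real"
  assumes "continuous_on UNIV h" "\<And>x. norm (x - a) > R \<Longrightarrow> h x = 0"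
  shows "integrable lborel h"
proof -
  obtain p q where "cball a R \<subseteq> cbox p q"
    using bounded_subset_cbox_symmetric[OF bounded_cball[of a R]] by blast
  then have "h x = 0" if "x \<notin> cbox p q" for x
    using that assms(2)[of x] by (auto simp: subset_eq dist_norm norm_minus_commute not_le)
  then show ?thesis by (rule integral_compact_support(1)[OF assms(1)])
qed

lemma mollifierD:
  assumes "mollifier \<delta> \<rho>"
  shows "smooth \<rho>" "\<And>x. 0 \<le> \<rho> x" "\<And>x. norm x > \<delta> \<Longrightarrow> \<rho> x = 0"
    "integrable lborel \<rho>" "(LINT x|lborel. \<rho> x) = 1"
    "test_function UNIV \<rho>"
proof -
  show *: "smooth \<rho>" "\<And>x. 0 \<le> \<rho> x" "\<And>x. norm x > \<delta> \<Longrightarrow> \<rho> x = 0"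
    "integrable lborel \<rho>" "(LINT x|lborel. \<rho> x) = 1"
    using assms by (auto simp: mollifier_def)
  show "test_function UNIV \<rho>"
    by (rule test_functionI[where K = "cball 0 \<delta>"]) (use * in auto)
qed

lemma mollifier_shift:
  assumes "mollifier \<delta> \<rho>"
  shows "integrable lborel (\<lambda>z. \<rho> (z - a))" "(LINT z|lborel. \<rho> (z - a)) = 1"
proof -
  have m: "\<rho> \<in> borel_measurable borel" using mollifierD(1)[OF assms] by (rule borel_measurable_smooth)
  show "integrable lborel (\<lambda>z. \<rho> (z - a))" "(LINT z|lborel. \<rho> (z - a)) = 1"
    using integrable_lborel_isometry[OF m, of 1 "- a"] integral_lborel_isometry[OF m, of 1 "- a"]
      mollifierD(4,5)[OF assms] by simp_all
qed

lemma mollified_close: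
  assumes \<rho>: "mollifier \<delta> \<rho>" and c: "continuous_on UNIV c"
    and e: "\<And>z. norm (z - a) \<le> \<delta> \<Longrightarrow> \<bar>c z - v\<bar> \<le> e"
  shows "\<bar>(LINT z|lborel. c z * \<rho> (z - a)) - v\<bar> \<le> e"
proof -
  have cont: "continuous_on UNIV (\<lambda>z. \<rho> (z - a))"
    by (rule continuous_on_compose2[OF smooth_imp_continuous_on[OF mollifierD(1)[OF \<rho>], of UNIV]])
      (auto intro!: continuous_intros)
  note sh = mollifier_shift[OF \<rho>, of a]
  have int: "integrable lborel (\<lambda>z. c z * \<rho> (z - a))"
    by (rule integrable_compact_support[where a = a and R = \<delta>])
      (use mollifierD(3)[OF \<rho>] in \<open>auto intro!: continuous_intros c cont\<close>)
  have "(LINT z|lborel. c z * \<rho> (z - a)) - v = (LINT z|lborel. (c z - v) * \<rho> (z - a))"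
    using int sh by (simp add: left_diff_distrib)
  also have "\<bar>\<dots>\<bar> \<le> (LINT z|lborel. e * \<rho> (z - a))"
  proof (rule order_trans[OF integral_abs_bound integral_mono])
    have "integrable lborel (\<lambda>z. (c z - v) * \<rho> (z - a))"
      using int sh by (simp add: left_diff_distrib)
    then show "integrable lborel (\<lambda>z. \<bar>(c z - v) * \<rho> (z - a)\<bar>)" by simp
    show "integrable lborel (\<lambda>z. e * \<rho> (z - a))" using sh by simp
    show "\<bar>(c z - v) * \<rho> (z - a)\<bar> \<le> e * \<rho> (z - a)" for z
    proof (cases "norm (z - a) \<le> \<delta>")
      case True
      then show ?thesis
        using mollifierD(2)[OF \<rho>, of "z - a"] e[of z] by (simp add: abs_mult mult_right_mono)
    next
      case False
      then show ?thesis using mollifierD(3)[OF \<rho>, of "z - a"] by simp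
    qed
  qed
  also have "\<dots> = e" using sh by simp
  finally show ?thesis .
qed

text \<open>
  This estimate replaces a compactness theorem for potentials.  Formally, the derivative of the correlation in the
  direction \<open>y\<close> is the sum over \<open>k\<close> and \<open>l\<close> of \<open>\<integral> y\<^sub>l u\<^sub>k(x) (\<partial>\<^sub>l w\<^sub>k)(x + z) dx\<close>.  Integration by parts in \<open>x\<close> and
  the vanishing curl of \<open>u\<close> turn \<open>u\<^sub>k \<partial>\<^sub>l w\<^sub>k\<close> into \<open>u\<^sub>l \<partial>\<^sub>k w\<^sub>k\<close>, and the sum over \<open>k\<close> then gives \<open>(y \<bullet> u) g\<close>, where \<open>g\<close> is
  the divergence of \<open>w\<close>; so no derivative of the fields remains.  Rigorously, the derivatives fall on a mollifier,
  and both conditions are tested with its translates, the one for \<open>u\<close> reflected.  They have support in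
  \<open>\<Omega>\<close> because \<open>r\<close> leaves room for the translation by \<open>a\<close> and the radius \<open>\<delta>\<close> of the mollifier.
\<close>

lemma mollified_correlation_derivative:
  fixes u w :: "real^'n::finite \<Rightarrow> real^'n" and g :: "real^'n \<Rightarrow> real"
  assumes u: "square_integrable lborel u" "\<And>x. norm x > R \<Longrightarrow> u x = 0"
    and w: "square_integrable lborel w" "\<And>x. norm x > R \<Longrightarrow> w x = 0"
    and g: "square_integrable lborel g" "\<And>x. norm x > R \<Longrightarrow> g x = 0"
    and K: "\<And>x. x \<notin> K \<Longrightarrow> w x = 0" "\<And>x. x \<in> K \<Longrightarrow> cball x r \<subseteq> \<Omega>"
    and curl: "\<And>\<theta> k l. test_function \<Omega> \<theta> \<Longrightarrow>
      (LINT x|lborel. u x $ k * partial_deriv l \<theta> x) = (LINT x|lborel. u x $ l * partial_deriv k \<theta> x)"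
    and div: "\<And>\<theta>. test_function UNIV \<theta> \<Longrightarrow>
      (\<Sum>k\<in>UNIV. LINT x|lborel. w x $ k * partial_deriv k \<theta> x) = - (LINT x|lborel. g x * \<theta> x)"
    and \<rho>: "mollifier \<delta> \<rho>" and a: "norm a + \<delta> \<le> r"
  shows "\<bar>LINT z|lborel. correlation u w z * (\<Sum>l\<in>UNIV. y $ l * partial_deriv l \<rho> (z - a))\<bar>
    \<le> norm y * L2_norm lborel u * L2_norm lborel g"
proof -
  note sm = mollifierD(1)[OF \<rho>]
  have ui: "integrable lborel (\<lambda>x. u x $ k)" for k
    by (rule square_integrable_imp_integrable[OF square_integrable_nth[OF u(1)], where R = R]) (simp add: u(2))
  have wi: "integrable lborel (\<lambda>x. w x $ k)" for k
    by (rule square_integrable_imp_integrable[OF square_integrable_nth[OF w(1)], where R = R]) (simp add: w(2))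
  have gi: "integrable lborel g" by (rule square_integrable_imp_integrable[OF g])
  obtain C where C: "\<And>x. \<bar>\<rho> x\<bar> \<le> C" "\<And>x k. \<bar>partial_deriv k \<rho> x\<bar> \<le> C"
    using test_function_bounded[OF mollifierD(6)[OF \<rho>]] by metis
  have pm [measurable]: "\<rho> \<in> borel_measurable borel" "partial_deriv k \<rho> \<in> borel_measurable borel" for k
    by (auto intro: borel_measurable_smooth smooth_partial_deriv sm)
  have m: "(\<lambda>z. partial_deriv k \<rho> (z - a)) \<in> borel_measurable borel" for k by measurable
  have m0: "(\<lambda>z. \<rho> (z - a)) \<in> borel_measurable borel" by measurable
  define P where "P k l z = (LINT x|lborel. u x $ k * partial_deriv l \<rho> (z - x - a))" for k l z
  \<comment> \<open>Vanishing curl, tested with a reflected translate of the mollifier, exchanges the indices.\<close>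
  have swap: "w z $ k * P k l z = w z $ k * P l k z" for k l z
  proof (cases "z \<in> K")
    case True
    let ?\<theta> = "\<lambda>x. \<rho> ((-1) *\<^sub>R x + (z - a))"
    have "test_function \<Omega> ?\<theta>"
    proof (rule test_functionI[where K = "cball (z - a) \<delta>"])
      show "smooth ?\<theta>" by (rule smooth_affine[OF sm])
      have "cball (z - a) \<delta> \<subseteq> cball z r"
        using a by (intro cball_subset_cball_iff[THEN iffD2]) (auto simp: dist_norm)
      then show "cball (z - a) \<delta> \<subseteq> \<Omega>" using K(2)[OF True] by blast
      show "?\<theta> x = 0" if "x \<notin> cball (z - a) \<delta>" for x
        using that by (intro mollifierD(3)[OF \<rho>]) (simp add: dist_norm)
    qed auto
    from curl[OF this, of k l] show ?thesis
      unfolding partial_deriv_affine[OF sm] P_def by (simp add: algebra_simps)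
  qed (simp add: K)
  define c where "c k z = (LINT x|lborel. u x $ k * w (x + z) $ k)" for k z
  have int_c: "integrable lborel (\<lambda>z. c k z * partial_deriv l \<rho> (z - a))" for k l
    unfolding c_def by (rule integrable_correlation[OF ui wi m C(2)])
  have "(LINT z|lborel. correlation u w z * (\<Sum>l\<in>UNIV. y $ l * partial_deriv l \<rho> (z - a)))
      = (LINT z|lborel. (\<Sum>l\<in>UNIV. \<Sum>k\<in>UNIV. y $ l * (c k z * partial_deriv l \<rho> (z - a))))"
    unfolding correlation_components[OF u(1) w(1)] c_def[symmetric]
    by (simp add: sum_distrib_left sum_distrib_right mult_ac)
  also have "\<dots> = (\<Sum>l\<in>UNIV. \<Sum>k\<in>UNIV. y $ l * (LINT z|lborel. c k z * partial_deriv l \<rho> (z - a)))"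
    using int_c by (simp add: Bochner_Integration.integral_sum)
  also have "\<dots> = (\<Sum>l\<in>UNIV. \<Sum>k\<in>UNIV. y $ l * (LINT x|lborel. u x $ l *
      (LINT z|lborel. w z $ k * partial_deriv k \<rho> (z - x - a))))"
  proof (intro sum.cong refl arg_cong[where f = "\<lambda>t. _ * t"])
    fix k l
    have "(LINT z|lborel. c k z * partial_deriv l \<rho> (z - a)) = (LINT z|lborel. w z $ k * P k l z)"
      unfolding c_def P_def by (rule integral_correlation_snd[OF ui wi m C(2)])
    also have "\<dots> = (LINT z|lborel. w z $ k * P l k z)" by (rule Bochner_Integration.integral_cong[OF refl swap])
    also have "\<dots> = (LINT z|lborel. (LINT x|lborel. u x $ l * w (x + z) $ k) * partial_deriv k \<rho> (z - a))"
      unfolding P_def by (rule integral_correlation_snd[OF ui wi m C(2), symmetric])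
    also have "\<dots> = (LINT x|lborel. u x $ l * (LINT z|lborel. w z $ k * partial_deriv k \<rho> (z - x - a)))"
      by (rule integral_correlation_fst[OF ui wi m C(2)])
    finally show "(LINT z|lborel. c k z * partial_deriv l \<rho> (z - a)) =
      (LINT x|lborel. u x $ l * (LINT z|lborel. w z $ k * partial_deriv k \<rho> (z - x - a)))" .
  qed
  also have "\<dots> = (\<Sum>l\<in>UNIV. y $ l * (LINT x|lborel. u x $ l *
      (\<Sum>k\<in>UNIV. LINT z|lborel. w z $ k * partial_deriv k \<rho> (z - x - a))))"
    using integrable_correlation_fst[OF ui wi m C(2)]
    by (simp add: sum_distrib_left Bochner_Integration.integral_sum)
  also have "\<dots> = (\<Sum>l\<in>UNIV. y $ l * (LINT x|lborel. u x $ l * - (LINT z|lborel. g z * \<rho> (z - x - a))))"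
  proof (intro sum.cong refl arg_cong[where f = "\<lambda>t. _ * t"] Bochner_Integration.integral_cong)
    fix x
    have "test_function UNIV (\<lambda>z. \<rho> (1 *\<^sub>R z + (- x - a)))"
      by (rule test_functionI[OF smooth_affine[OF sm], where K = "cball (x + a) \<delta>"])
        (auto intro!: mollifierD(3)[OF \<rho>] simp: dist_norm norm_minus_commute algebra_simps)
    from div[OF this] show "(\<Sum>k\<in>UNIV. LINT z|lborel. w z $ k * partial_deriv k \<rho> (z - x - a))
        = - (LINT z|lborel. g z * \<rho> (z - x - a))"
      unfolding partial_deriv_affine[OF sm] by (simp add: algebra_simps)
  qed
  also have "\<dots> = - (\<Sum>l\<in>UNIV. y $ l * (LINT z|lborel. (LINT x|lborel. u x $ l * g (x + z)) * \<rho> (z - a)))"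
    using integral_correlation_fst[OF ui gi m0 C(1)] by (simp add: sum_negf)
  also have "\<dots> = - (LINT z|lborel. (\<Sum>l\<in>UNIV. y $ l * (LINT x|lborel. u x $ l * g (x + z))) * \<rho> (z - a))"
    using integrable_correlation[OF ui gi m0 C(1)]
    by (simp add: sum_distrib_right mult.assoc Bochner_Integration.integral_sum)
  also have "\<dots> = - (LINT z|lborel. correlation (\<lambda>x. y \<bullet> u x) g z * \<rho> (z - a))"
  proof -
    have "(\<Sum>l\<in>UNIV. y $ l * (LINT x|lborel. u x $ l * g (x + z))) = correlation (\<lambda>x. y \<bullet> u x) g z" for z
    proof -
      have "integrable lborel (\<lambda>x. u x $ l * g (x + z))" for l
        by (intro integrable_mult_square_integrable square_integrable_nth square_integrable_translate u g)
      then show ?thesis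
        by (simp add: correlation_def inner_vec_def sum_distrib_right mult.assoc Bochner_Integration.integral_sum)
    qed
    then show ?thesis by simp
  qed
  finally have eq: "\<bar>LINT z|lborel. correlation u w z * (\<Sum>l\<in>UNIV. y $ l * partial_deriv l \<rho> (z - a))\<bar>
    = \<bar>LINT z|lborel. correlation (\<lambda>x. y \<bullet> u x) g z * \<rho> (z - a)\<bar>" by simp
  have yu: "square_integrable lborel (\<lambda>x. y \<bullet> u x)"
    using square_integrable_inner_const[OF u(1), of y] by (simp add: inner_commute)
  have nyu: "L2_norm lborel (\<lambda>x. y \<bullet> u x) \<le> norm y * L2_norm lborel u"
  proof -
    have "(LINT x|lborel. (norm (y \<bullet> u x))\<^sup>2) \<le> (LINT x|lborel. (norm y)\<^sup>2 * (norm (u x))\<^sup>2)"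
      using square_integrable_integrable[OF yu] square_integrable_integrable[OF u(1)]
      by (intro integral_mono) (auto simp: Cauchy_Schwarz_ineq power2_norm_eq_inner power_mult_distrib
          intro!: power_mono[OF Cauchy_Schwarz_ineq2, of y "u _" 2, simplified])
    then show ?thesis by (simp add: L2_norm_le_iff power_mult_distrib L2_norm_power2)
  qed
  let ?L = "norm y * L2_norm lborel u * L2_norm lborel g"
  have L: "\<bar>correlation (\<lambda>x. y \<bullet> u x) g z\<bar> \<le> ?L" for z
    using abs_correlation_le[OF yu g(1), of z] mult_right_mono[OF nyu, of "L2_norm lborel g"] by simp
  have "\<bar>LINT z|lborel. correlation (\<lambda>x. y \<bullet> u x) g z * \<rho> (z - a)\<bar> \<le> (LINT z|lborel. ?L * \<rho> (z - a))"
  proof (rule order_trans[OF integral_abs_bound integral_mono])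
    have yui: "integrable lborel (\<lambda>x. y \<bullet> u x)"
      by (rule square_integrable_imp_integrable[OF yu, where R = R]) (simp add: u(2))
    have "integrable lborel (\<lambda>z. correlation (\<lambda>x. y \<bullet> u x) g z * \<rho> (z - a))"
      using integrable_correlation[OF yui gi m0 C(1)] by (simp add: correlation_def)
    then show "integrable lborel (\<lambda>z. \<bar>correlation (\<lambda>x. y \<bullet> u x) g z * \<rho> (z - a)\<bar>)" by simp
    show "integrable lborel (\<lambda>z. ?L * \<rho> (z - a))" using mollifier_shift[OF \<rho>] by simp
    show "\<bar>correlation (\<lambda>x. y \<bullet> u x) g z * \<rho> (z - a)\<bar> \<le> ?L * \<rho> (z - a)" for z
      using mollifierD(2)[OF \<rho>, of "z - a"] L[of z] by (simp add: abs_mult mult_right_mono)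
  qed
  also have "\<dots> = ?L" using mollifier_shift[OF \<rho>, of a] by simp
  finally show ?thesis using eq by simp
qed

text \<open>
  Along the segment from \<open>0\<close> to \<open>y\<close> the mollified correlation is differentiable with the derivative just estimated.
  Since the correlation is continuous, the mollifier can be removed at both end points.
\<close>

lemma correlation_lipschitz:
  fixes u w :: "real^'n::finite \<Rightarrow> real^'n" and g :: "real^'n \<Rightarrow> real"
  assumes u: "square_integrable lborel u" "\<And>x. norm x > R \<Longrightarrow> u x = 0"
    and w: "square_integrable lborel w" "\<And>x. norm x > R \<Longrightarrow> w x = 0"
    and g: "square_integrable lborel g" "\<And>x. norm x > R \<Longrightarrow> g x = 0"
    and K: "\<And>x. x \<notin> K \<Longrightarrow> w x = 0" "\<And>x. x \<in> K \<Longrightarrow> cball x r \<subseteq> \<Omega>"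
    and curl: "\<And>\<theta> k l. test_function \<Omega> \<theta> \<Longrightarrow>
      (LINT x|lborel. u x $ k * partial_deriv l \<theta> x) = (LINT x|lborel. u x $ l * partial_deriv k \<theta> x)"
    and div: "\<And>\<theta>. test_function UNIV \<theta> \<Longrightarrow>
      (\<Sum>k\<in>UNIV. LINT x|lborel. w x $ k * partial_deriv k \<theta> x) = - (LINT x|lborel. g x * \<theta> x)"
    and y: "norm y < r"
  shows "\<bar>correlation u w y - correlation u w 0\<bar> \<le> norm y * L2_norm lborel u * L2_norm lborel g"
    (is "_ \<le> ?L")
proof (rule field_le_epsilon)
  fix e :: real assume "e > 0"
  let ?c = "correlation u w"
  have c: "continuous_on UNIV ?c" by (rule continuous_on_correlation[OF u(1) w(1) u(2) w(2)])
  have "\<exists>d>0. \<forall>z. norm (z - x) < d \<longrightarrow> \<bar>?c z - ?c x\<bar> < e / 2" for x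
    using c[unfolded continuous_on_iff, rule_format, of x "e / 2"] \<open>e > 0\<close> by (simp add: dist_norm)
  then obtain d where d: "\<And>x. d x > 0" "\<And>x z. norm (z - x) < d x \<Longrightarrow> \<bar>?c z - ?c x\<bar> < e / 2"
    by metis
  define \<delta> where "\<delta> = min (min (d 0) (d y)) (r - norm y) / 2"
  have \<delta>: "\<delta> > 0" "\<delta> < d 0" "\<delta> < d y" "norm y + \<delta> \<le> r"
    using d(1)[of 0] d(1)[of y] y by (auto simp: \<delta>_def min_def field_simps)
  obtain \<rho> :: "real^'n \<Rightarrow> real" where \<rho>: "mollifier \<delta> \<rho>" using mollifier_exists[OF \<delta>(1)] .
  note sm = mollifierD(1)[OF \<rho>]
  define F where "F s = (LINT z|lborel. ?c z * \<rho> (z - s *\<^sub>R y))" for s :: real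
  define D where "D s z = ?c z * (- (\<Sum>l\<in>UNIV. y $ l * partial_deriv l \<rho> (z - s *\<^sub>R y)))" for s z
  obtain p q :: "real^'n" where "cball 0 r \<subseteq> cbox p q"
    using bounded_subset_cbox_symmetric[OF bounded_cball[of "0::real^'n" r]] by blast
  then have out: "\<delta> < norm (z - s *\<^sub>R y)" if "z \<notin> cbox p q" "s \<in> {0..1}" for z s
  proof -
    have "r < norm z" using that \<open>cball 0 r \<subseteq> cbox p q\<close> by (auto simp: subset_eq not_le)
    moreover have "norm (s *\<^sub>R y) \<le> norm y" using that by (simp add: mult_left_le_one_le)
    moreover have "norm z \<le> norm (z - s *\<^sub>R y) + norm (s *\<^sub>R y)" using norm_triangle_sub[of z "s *\<^sub>R y"] by simp
    ultimately show ?thesis using \<delta>(4) by linarith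
  qed
  have pdz: "partial_deriv l \<rho> x = 0" if "norm x > \<delta>" for l x
  proof -
    have "((\<lambda>x. 0) has_derivative (\<lambda>h. 0)) (at x)" by simp
    then have "(\<rho> has_derivative (\<lambda>h. 0)) (at x)"
    proof (rule has_derivative_transform_within_open[where s = "- cball 0 \<delta>"])
      show "0 = \<rho> x" if "x \<in> - cball 0 \<delta>" for x using that mollifierD(3)[OF \<rho>, of x] by simp
    qed (use that in auto)
    then show ?thesis by (simp add: partial_deriv_eq)
  qed
  have contF: "continuous_on UNIV (\<lambda>z. ?c z * \<rho> (z - s *\<^sub>R y))" for s
    by (intro continuous_intros c continuous_on_compose2[OF smooth_imp_continuous_on[OF sm, of UNIV]]) auto
  have contD: "continuous_on UNIV (D s)" for s
    unfolding D_def
    by (intro continuous_intros c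
        continuous_on_compose2[OF smooth_imp_continuous_on[OF smooth_partial_deriv[OF sm], of UNIV]]) auto
  have F: "F s = integral (cbox p q) (\<lambda>z. ?c z * \<rho> (z - s *\<^sub>R y))" if "s \<in> {0..1}" for s
    unfolding F_def by (rule integral_compact_support(2)[OF contF])
      (use out[OF _ that] mollifierD(3)[OF \<rho>] in auto)
  have D: "(LINT z|lborel. D s z) = integral (cbox p q) (D s)" if "s \<in> {0..1}" for s
    by (rule integral_compact_support(2)[OF contD]) (use out[OF _ that] pdz in \<open>auto simp: D_def\<close>)
  have deriv: "(F has_real_derivative (LINT z|lborel. D s z)) (at s within {0..1})" if s: "s \<in> {0..1}" for s
  proof -
    have "((\<lambda>s. integral (cbox p q) (\<lambda>z. ?c z * \<rho> (z - s *\<^sub>R y))) has_field_derivative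
        integral (cbox p q) (D s)) (at s within {0..1})"
    proof (rule leibniz_rule_field_derivative)
      fix t :: real and z :: "real^'n"
      have "((\<lambda>s. z - s *\<^sub>R y) has_derivative (\<lambda>h. - (h *\<^sub>R y))) (at t)"
        by (auto intro!: derivative_eq_intros)
      from has_derivative_compose[OF this has_derivative_partial_derivs[OF smooth_imp_differentiable[OF sm]]]
      have "((\<lambda>s. \<rho> (z - s *\<^sub>R y)) has_derivative
          (\<lambda>h. (- (\<Sum>l\<in>UNIV. y $ l * partial_deriv l \<rho> (z - t *\<^sub>R y))) * h)) (at t)"
        by (simp add: sum_negf sum_distrib_left mult_ac)
      then have "((\<lambda>s. \<rho> (z - s *\<^sub>R y)) has_real_derivative
          - (\<Sum>l\<in>UNIV. y $ l * partial_deriv l \<rho> (z - t *\<^sub>R y))) (at t within {0..1})"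
        unfolding has_field_derivative_def by (rule has_derivative_at_withinI)
      then show "((\<lambda>s. ?c z * \<rho> (z - s *\<^sub>R y)) has_real_derivative D t z) (at t within {0..1})"
        unfolding D_def by (rule DERIV_cmult)
    next
      show "(\<lambda>z. ?c z * \<rho> (z - t *\<^sub>R y)) integrable_on cbox p q" for t :: real
        by (rule integrable_continuous) (rule continuous_on_subset[OF contF], simp)
      show "continuous_on ({0..1} \<times> cbox p q) (\<lambda>(t, z). D t z)"
        unfolding D_def case_prod_beta
        by (intro continuous_intros continuous_on_compose2[OF c]
            continuous_on_compose2[OF smooth_imp_continuous_on[OF smooth_partial_deriv[OF sm], of UNIV]]) auto
    qed (use s in auto)
    then show ?thesis
      unfolding D[OF s]
      by (rule has_field_derivative_transform_within[OF _ zero_less_one s]) (simp add: F)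
  qed
  have Dle: "\<bar>LINT z|lborel. D s z\<bar> \<le> ?L" if s: "s \<in> {0..1}" for s
  proof -
    have "norm (s *\<^sub>R y) \<le> norm y" using s by (simp add: mult_left_le_one_le)
    then have "norm (s *\<^sub>R y) + \<delta> \<le> r" using \<delta>(4) by linarith
    from mollified_correlation_derivative[where y = y, OF u w g K curl div \<rho> this]
    show ?thesis by (simp add: D_def)
  qed
  have "\<bar>F 1 - F 0\<bar> \<le> ?L"
    using field_differentiable_bound[of "{0..1}" F "\<lambda>s. LINT z|lborel. D s z" ?L 1 0] deriv Dle
    by simp
  moreover have "\<bar>F 1 - ?c y\<bar> \<le> e / 2"
    using mollified_close[OF \<rho> c, of y "?c y" "e / 2"] d(2)[of _ y] \<delta>(3)
    by (simp add: F_def) (smt (verit))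
  moreover have "\<bar>F 0 - ?c 0\<bar> \<le> e / 2"
    using mollified_close[OF \<rho> c, of 0 "?c 0" "e / 2"] d(2)[of _ 0] \<delta>(2)
    by (simp add: F_def) (smt (verit))
  ultimately show "\<bar>?c y - ?c 0\<bar> \<le> ?L + e" by linarith
qed

section \<open>The div-curl lemma\<close>

lemma L2_norm_bound:
  assumes "square_integrable M f" "g \<in> borel_measurable M" "\<And>x. norm (g x) \<le> C * norm (f x)" "C \<ge> 0"
  shows "L2_norm M g \<le> C * L2_norm M f"
proof -
  have "(LINT x|M. (norm (g x))\<^sup>2) \<le> (LINT x|M. C\<^sup>2 * (norm (f x))\<^sup>2)"
  proof (rule integral_mono)
    show "integrable M (\<lambda>x. (norm (g x))\<^sup>2)"
      by (rule square_integrable_integrable[OF square_integrable_bound[OF assms(1-3)]])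
    show "integrable M (\<lambda>x. C\<^sup>2 * (norm (f x))\<^sup>2)" using square_integrable_integrable[OF assms(1)] by simp
    show "(norm (g x))\<^sup>2 \<le> C\<^sup>2 * (norm (f x))\<^sup>2" for x
      using power_mono[OF assms(3) norm_ge_zero, of x 2] by (simp add: power_mult_distrib)
  qed
  then show ?thesis using assms(4) by (simp add: L2_norm_le_iff power_mult_distrib L2_norm_power2)
qed

lemma integrable_mult_bounded:
  fixes f h :: "'a \<Rightarrow> real"
  assumes "integrable M f" "h \<in> borel_measurable M" "\<And>x. \<bar>h x\<bar> \<le> C"
  shows "integrable M (\<lambda>x. f x * h x)"
proof (rule Bochner_Integration.integrable_bound)
  show "integrable M (\<lambda>x. C * \<bar>f x\<bar>)" using assms(1) by simp
  have "\<bar>f x * h x\<bar> \<le> \<bar>C * \<bar>f x\<bar>\<bar>" for x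
  proof -
    have "\<bar>h x\<bar> \<le> \<bar>C\<bar>" using assms(3)[of x] by linarith
    then show ?thesis using mult_left_mono[of "\<bar>h x\<bar>" "\<bar>C\<bar>" "\<bar>f x\<bar>"] by (simp add: abs_mult mult.commute)
  qed
  then show "AE x in M. norm (f x * h x) \<le> norm (C * \<bar>f x\<bar>)" by simp
qed (use assms borel_measurable_integrable in \<open>blast intro: borel_measurable_times\<close>)

text \<open>
  The conditions \<open>curl u = 0\<close> and \<open>div v = 0\<close> in \<open>\<Omega>\<close>, as they read for Borel functions extended by zero, whose
  correlations and convolutions can be formed on the whole space.
\<close>

definition div_curl_pair :: "(real^'n::finite) set \<Rightarrow> (real^'n \<Rightarrow> real^'n) \<Rightarrow> (real^'n \<Rightarrow> real^'n) \<Rightarrow> bool" where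
  "div_curl_pair \<Omega> u v \<longleftrightarrow> square_integrable lborel u \<and> square_integrable lborel v \<and>
     (\<forall>x. x \<notin> \<Omega> \<longrightarrow> u x = 0) \<and> (\<forall>x. x \<notin> \<Omega> \<longrightarrow> v x = 0) \<and>
     (\<forall>\<theta> k l. test_function \<Omega> \<theta> \<longrightarrow>
        (LINT x|lborel. u x $ k * partial_deriv l \<theta> x) = (LINT x|lborel. u x $ l * partial_deriv k \<theta> x)) \<and>
     (\<forall>\<theta>. test_function \<Omega> \<theta> \<longrightarrow> (\<Sum>k\<in>UNIV. LINT x|lborel. v x $ k * partial_deriv k \<theta> x) = 0)"

lemma div_curl_pairD:
  assumes "div_curl_pair \<Omega> u v"
  shows "square_integrable lborel u" "square_integrable lborel v"
    "\<And>x. x \<notin> \<Omega> \<Longrightarrow> u x = 0" "\<And>x. x \<notin> \<Omega> \<Longrightarrow> v x = 0"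
    "\<And>\<theta> k l. test_function \<Omega> \<theta> \<Longrightarrow>
      (LINT x|lborel. u x $ k * partial_deriv l \<theta> x) = (LINT x|lborel. u x $ l * partial_deriv k \<theta> x)"
    "\<And>\<theta>. test_function \<Omega> \<theta> \<Longrightarrow> (\<Sum>k\<in>UNIV. LINT x|lborel. v x $ k * partial_deriv k \<theta> x) = 0"
  using assms unfolding div_curl_pair_def by blast+

lemma borel_measurable_nth [measurable (raw)]:
  fixes f :: "'a \<Rightarrow> real^'n::finite"
  assumes "f \<in> borel_measurable M" shows "(\<lambda>x. f x $ k) \<in> borel_measurable M"
  using borel_measurable_inner[OF assms borel_measurable_const[of "axis k 1"]] by (simp add: inner_axis)

text \<open>
  Averaging the Lipschitz bound over a mollifier compares \<open>\<integral> \<phi> (u \<bullet> v)\<close> with the same integral for the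
  mollified field \<open>\<rho> * u\<close>, uniformly over bounded sets of fields \<open>u\<close> and \<open>v\<close>.
\<close>

lemma div_curl_mollified:
  fixes \<Omega> :: "(real^'n::finite) set" and \<phi> :: "real^'n \<Rightarrow> real"
  assumes \<Omega>: "open \<Omega>" "\<Omega> \<subseteq> cball 0 R" and \<phi>: "test_function \<Omega> \<phi>"
  shows "\<exists>r>0. \<exists>C\<ge>0. \<forall>u v \<epsilon> \<rho>. div_curl_pair \<Omega> u v \<longrightarrow> mollifier \<epsilon> \<rho> \<longrightarrow> 0 < \<epsilon> \<longrightarrow> \<epsilon> < r \<longrightarrow>
    \<bar>(\<Sum>k\<in>UNIV. LINT z|lborel. \<phi> z * v z $ k * (LINT x|lborel. u x $ k * \<rho> (z - x)))
       - (LINT x|lborel. \<phi> x * (u x \<bullet> v x))\<bar> \<le> \<epsilon> * C * (L2_norm lborel u * L2_norm lborel v)"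
proof -
  have sm: "smooth \<phi>" using \<phi> by (simp add: test_function_def)
  obtain K where K: "compact K" "K \<subseteq> \<Omega>" "\<And>x. x \<notin> K \<Longrightarrow> \<phi> x = 0"
    "\<And>x k. x \<notin> K \<Longrightarrow> partial_deriv k \<phi> x = 0"
    using test_function_support[OF \<phi>] by metis
  obtain r where r: "r > 0" "(\<Union>x\<in>K. cball x r) \<subseteq> \<Omega>"
    using compact_subset_open_imp_cball_epsilon_subset[OF K(1) \<Omega>(1) K(2)] by metis
  obtain B where B: "\<And>x. \<bar>\<phi> x\<bar> \<le> B" "\<And>x k. \<bar>partial_deriv k \<phi> x\<bar> \<le> B" "B \<ge> 0"
    using test_function_bounded[OF \<phi>] by metis
  have [measurable]: "\<phi> \<in> borel_measurable borel" "partial_deriv k \<phi> \<in> borel_measurable borel" for k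
    by (auto intro: borel_measurable_smooth smooth_partial_deriv sm)
  show ?thesis
  proof (rule exI[of _ r], rule conjI[OF r(1)], rule exI[of _ "real CARD('n) * B"], intro conjI allI impI)
    fix u v :: "real^'n \<Rightarrow> real^'n" and \<epsilon> and \<rho> :: "real^'n \<Rightarrow> real"
    assume uv: "div_curl_pair \<Omega> u v" and \<rho>: "mollifier \<epsilon> \<rho>" "\<epsilon> > 0" "\<epsilon> < r"
    note u = div_curl_pairD(1)[OF uv] and v = div_curl_pairD(2)[OF uv] and uz = div_curl_pairD(3)[OF uv]
      and vz = div_curl_pairD(4)[OF uv] and curl = div_curl_pairD(5)[OF uv] and div = div_curl_pairD(6)[OF uv]
    have [measurable]: "v \<in> borel_measurable borel" using square_integrable_measurable[OF v] by simp
    have R: "x \<notin> \<Omega>" if "norm x > R" for x using that \<Omega>(2) by auto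
    have vi: "integrable lborel (\<lambda>x. v x $ k)" for k
      by (rule square_integrable_imp_integrable[OF square_integrable_nth[OF v], where R = R]) (simp add: R vz)
    define w where "w x = \<phi> x *\<^sub>R v x" for x
    define g where "g x = (\<Sum>k\<in>UNIV. v x $ k * partial_deriv k \<phi> x)" for x
    have w: "square_integrable lborel w"
      unfolding w_def
      by (rule square_integrable_bound[OF v, where C = B]) (auto intro!: mult_right_mono B)
    have gm: "g \<in> borel_measurable lborel"
      unfolding g_def using square_integrable_measurable[OF square_integrable_nth[OF v]] by measurable
    have gb: "norm (g x) \<le> (real CARD('n) * B) * norm (v x)" for x
    proof -
      have "norm (g x) \<le> (\<Sum>k\<in>(UNIV::'n set). norm (v x) * B)"
        unfolding g_def by (rule order_trans[OF norm_sum sum_mono])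
          (auto simp: abs_mult intro!: mult_mono B component_le_norm_cart)
      then show ?thesis by (simp add: mult_ac)
    qed
    have g: "square_integrable lborel g" by (rule square_integrable_bound[OF v gm gb])
    have gn: "L2_norm lborel g \<le> (real CARD('n) * B) * L2_norm lborel v"
      by (rule L2_norm_bound[OF v gm gb]) (use B in simp)
    have divw: "(\<Sum>k\<in>UNIV. LINT x|lborel. w x $ k * partial_deriv k \<theta> x) = - (LINT x|lborel. g x * \<theta> x)"
      if \<theta>: "test_function UNIV \<theta>" for \<theta>
    proof -
      have sm\<theta>: "smooth \<theta>" using \<theta> by (simp add: test_function_def)
      obtain D where D: "\<And>x. \<bar>\<theta> x\<bar> \<le> D" "\<And>x k. \<bar>partial_deriv k \<theta> x\<bar> \<le> D" "D \<ge> 0"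
        using test_function_bounded[OF \<theta>] by metis
      have [measurable]: "\<theta> \<in> borel_measurable borel" "partial_deriv k \<theta> \<in> borel_measurable borel" for k
        by (auto intro: borel_measurable_smooth smooth_partial_deriv sm\<theta>)
      have i1: "integrable lborel (\<lambda>x. v x $ k * (\<phi> x * partial_deriv k \<theta> x))" for k
        by (rule integrable_mult_bounded[OF vi, where C = "B * D"])
          (auto simp: abs_mult intro!: mult_mono B D)
      have i2: "integrable lborel (\<lambda>x. v x $ k * (partial_deriv k \<phi> x * \<theta> x))" for k
        by (rule integrable_mult_bounded[OF vi, where C = "B * D"])
          (auto simp: abs_mult intro!: mult_mono B D)
      have "test_function \<Omega> (\<lambda>x. \<phi> x * \<theta> x)"
        by (rule test_functionI[OF smooth_mult[OF sm sm\<theta>] K(1,2)]) (simp add: K(3))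
      from div[OF this] have "0 = (\<Sum>k\<in>UNIV. LINT x|lborel.
          v x $ k * (\<phi> x * partial_deriv k \<theta> x) + v x $ k * (partial_deriv k \<phi> x * \<theta> x))"
        by (simp add: partial_deriv_mult smooth_imp_differentiable sm sm\<theta> distrib_left add.commute)
      also have "\<dots> = (\<Sum>k\<in>UNIV. LINT x|lborel. v x $ k * (\<phi> x * partial_deriv k \<theta> x))
          + (\<Sum>k\<in>UNIV. LINT x|lborel. v x $ k * (partial_deriv k \<phi> x * \<theta> x))"
        using i1 i2 by (simp add: sum.distrib)
      also have "(\<Sum>k\<in>UNIV. LINT x|lborel. v x $ k * (partial_deriv k \<phi> x * \<theta> x)) = (LINT x|lborel. g x * \<theta> x)"
        using i2 by (simp add: g_def sum_distrib_right mult.assoc Bochner_Integration.integral_sum)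
      finally show ?thesis by (simp add: w_def mult_ac)
    qed
    let ?c = "correlation u w"
    have uR: "u x = 0" if "norm x > R" for x using R uz that by blast
    have wR: "w x = 0" if "norm x > R" for x using R vz that by (simp add: w_def)
    have gR: "g x = 0" if "norm x > R" for x using R vz that by (simp add: g_def)
    have wK: "w x = 0" if "x \<notin> K" for x using K(3) that by (simp add: w_def)
    have rK: "cball x r \<subseteq> \<Omega>" if "x \<in> K" for x using r(2) that by blast
    have lip: "\<bar>?c y - ?c 0\<bar> \<le> \<epsilon> * (real CARD('n) * B) * (L2_norm lborel u * L2_norm lborel v)"
      if "norm (y - 0) \<le> \<epsilon>" for y
    proof -
      have "norm y < r" using that \<rho>(3) by simp
      from correlation_lipschitz[OF u uR w wR g gR wK rK curl divw this]
      have "\<bar>?c y - ?c 0\<bar> \<le> norm y * L2_norm lborel u * L2_norm lborel g" .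
      also have "\<dots> \<le> \<epsilon> * L2_norm lborel u * ((real CARD('n) * B) * L2_norm lborel v)"
        using that gn \<rho>(2) by (intro mult_mono) auto
      finally show ?thesis by (simp add: mult_ac)
    qed
    have cont: "continuous_on UNIV ?c" by (rule continuous_on_correlation[OF u w uR wR])
    have 1: "\<bar>(LINT z|lborel. ?c z * \<rho> z) - ?c 0\<bar>
        \<le> \<epsilon> * (real CARD('n) * B) * (L2_norm lborel u * L2_norm lborel v)"
      using mollified_close[OF \<rho>(1) cont, of 0, OF lip] by simp
    have ui: "integrable lborel (\<lambda>x. u x $ k)" for k
      by (rule square_integrable_imp_integrable[OF square_integrable_nth[OF u], where R = R]) (simp add: uR)
    have wi: "integrable lborel (\<lambda>x. w x $ k)" for k
      by (rule square_integrable_imp_integrable[OF square_integrable_nth[OF w], where R = R]) (simp add: wR)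
    obtain C where C: "\<And>x. \<bar>\<rho> x\<bar> \<le> C" using test_function_bounded[OF mollifierD(6)[OF \<rho>(1)]] by metis
    have \<rho>m: "\<rho> \<in> borel_measurable borel" by (rule borel_measurable_smooth[OF mollifierD(1)[OF \<rho>(1)]])
    have "(LINT z|lborel. ?c z * \<rho> z) = (\<Sum>k\<in>UNIV. LINT z|lborel. (LINT x|lborel. u x $ k * w (x + z) $ k) * \<rho> z)"
      unfolding correlation_components[OF u w] sum_distrib_right
      by (rule Bochner_Integration.integral_sum) (rule integrable_correlation[OF ui wi \<rho>m C])
    also have "\<dots> = (\<Sum>k\<in>UNIV. LINT z|lborel. w z $ k * (LINT x|lborel. u x $ k * \<rho> (z - x)))"
      by (intro sum.cong refl integral_correlation_snd[OF ui wi \<rho>m C])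
    also have "\<dots> = (\<Sum>k\<in>UNIV. LINT z|lborel. \<phi> z * v z $ k * (LINT x|lborel. u x $ k * \<rho> (z - x)))"
      by (simp add: w_def)
    finally have 2: "(LINT z|lborel. ?c z * \<rho> z)
      = (\<Sum>k\<in>UNIV. LINT z|lborel. \<phi> z * v z $ k * (LINT x|lborel. u x $ k * \<rho> (z - x)))" .
    have 3: "?c 0 = (LINT x|lborel. \<phi> x * (u x \<bullet> v x))" by (simp add: correlation_def w_def)
    show "\<bar>(\<Sum>k\<in>UNIV. LINT z|lborel. \<phi> z * v z $ k * (LINT x|lborel. u x $ k * \<rho> (z - x)))
         - (LINT x|lborel. \<phi> x * (u x \<bullet> v x))\<bar>
        \<le> \<epsilon> * (real CARD('n) * B) * (L2_norm lborel u * L2_norm lborel v)"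
      using 1 unfolding 2 3 .
  qed (use B in auto)
qed

text \<open>
  On a ball, pointwise bounded convergence of \<open>m j\<close> implies convergence in \<open>L\<^sup>2\<close>, and a product of a weakly and a strongly
  convergent sequence converges.
\<close>

lemma integral_weak_strong:
  fixes w m :: "nat \<Rightarrow> 'a::euclidean_space \<Rightarrow> real"
  assumes w: "\<And>j. square_integrable lborel (w j)" "\<And>j. L2_norm lborel (w j) \<le> B"
    and zero: "\<And>j x. norm x > R \<Longrightarrow> w j x = 0" "\<And>x. norm x > R \<Longrightarrow> w' x = 0"
    and weak: "\<And>h. square_integrable lborel h \<Longrightarrow>
      (\<lambda>j. LINT x|lborel. w j x * h x) \<longlonglongrightarrow> (LINT x|lborel. w' x * h x)"
    and m: "\<And>j. m j \<in> borel_measurable borel" "m' \<in> borel_measurable borel"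
    and bound: "\<And>j x. \<bar>m j x\<bar> \<le> C" and lim: "\<And>x. (\<lambda>j. m j x) \<longlonglongrightarrow> m' x"
  shows "(\<lambda>j. LINT x|lborel. w j x * m j x) \<longlonglongrightarrow> (LINT x|lborel. w' x * m' x)"
proof -
  define i where "i = (indicator (cball 0 R) :: 'a \<Rightarrow> real)"
  have [measurable]: "m j \<in> borel_measurable borel" "m' \<in> borel_measurable borel" "i \<in> borel_measurable borel" for j
    using m unfolding i_def by (auto intro: borel_measurable_indicator borel_closed)
  have bound': "\<bar>m' x\<bar> \<le> C" for x
    by (rule tendsto_upperbound[OF tendsto_rabs[OF lim]]) (simp_all add: bound)
  have C0: "C \<ge> 0" using bound[of 0 0] by linarith
  have ii: "integrable lborel i" unfolding i_def by (rule integrable_indicator_bounded) auto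
  have sq: "square_integrable lborel (\<lambda>x. h x * i x)"
    if [measurable]: "h \<in> borel_measurable borel" and h: "\<And>x. \<bar>h x\<bar> \<le> D" for h :: "'a \<Rightarrow> real" and D
    unfolding square_integrable_def
  proof
    show "integrable lborel (\<lambda>x. (norm (h x * i x))\<^sup>2)"
    proof (rule Bochner_Integration.integrable_bound)
      show "integrable lborel (\<lambda>x. D\<^sup>2 * i x)" using ii by simp
      have "(h x)\<^sup>2 \<le> D\<^sup>2" for x using power_mono[OF h abs_ge_zero, of x 2] by simp
      then show "AE x in lborel. norm ((norm (h x * i x))\<^sup>2) \<le> norm (D\<^sup>2 * i x)"
        by (intro AE_I2) (auto simp: i_def indicator_def)
    qed measurable
  qed measurable
  define d where "d j x = (m j x - m' x) * i x" for j x
  have db: "\<bar>m j x - m' x\<bar> \<le> 2 * C" for j x using bound[of j x] bound'[of x] by linarith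
  have d: "square_integrable lborel (d j)" for j
    unfolding d_def by (rule sq[where D = "2 * C"]) (use db in auto)
  have m'i: "square_integrable lborel (\<lambda>x. m' x * i x)" by (rule sq) (use bound' in auto)
  have "(\<lambda>j. LINT x|lborel. (d j x)\<^sup>2) \<longlonglongrightarrow> (LINT x::'a|lborel. (0::real))"
  proof (rule integral_dominated_convergence[where w = "\<lambda>x. (2 * C)\<^sup>2 * i x"])
    show "AE x in lborel. (\<lambda>j. (d j x)\<^sup>2) \<longlonglongrightarrow> 0"
    proof (rule AE_I2)
      fix x
      have "(\<lambda>j. ((m j x - m' x) * i x)\<^sup>2) \<longlonglongrightarrow> ((m' x - m' x) * i x)\<^sup>2"
        by (intro tendsto_intros lim)
      then show "(\<lambda>j. (d j x)\<^sup>2) \<longlonglongrightarrow> 0" by (simp add: d_def)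
    qed
    show "AE x in lborel. norm ((d j x)\<^sup>2) \<le> (2 * C)\<^sup>2 * i x" for j
    proof (rule AE_I2)
      fix x
      have "(m j x - m' x)\<^sup>2 \<le> (2 * C)\<^sup>2" using power_mono[OF db abs_ge_zero, of j x 2] by simp
      then show "norm ((d j x)\<^sup>2) \<le> (2 * C)\<^sup>2 * i x" by (auto simp: d_def i_def indicator_def)
    qed
  qed (use ii in \<open>auto simp: d_def\<close>)
  then have "(\<lambda>j. sqrt (LINT x|lborel. (d j x)\<^sup>2)) \<longlonglongrightarrow> sqrt (LINT x::'a|lborel. (0::real))"
    by (rule tendsto_real_sqrt)
  then have "(\<lambda>j. L2_norm lborel (d j)) \<longlonglongrightarrow> 0" by (simp add: L2_norm_def)
  from tendsto_mult_left[OF this, of B] have lim0: "(\<lambda>j. B * L2_norm lborel (d j)) \<longlonglongrightarrow> 0" by simp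
  have le: "norm (LINT x|lborel. w j x * d j x) \<le> B * L2_norm lborel (d j)" for j
    using abs_integral_inner_le[OF w(1)[of j] d[of j]] mult_right_mono[OF w(2)[of j], of "L2_norm lborel (d j)"]
    by simp
  have "(\<lambda>j. LINT x|lborel. w j x * d j x) \<longlonglongrightarrow> 0"
    by (rule Lim_null_comparison[OF always_eventually lim0]) (use le in blast)
  from tendsto_add[OF this weak[OF m'i]]
  have "(\<lambda>j. (LINT x|lborel. w j x * d j x) + (LINT x|lborel. w j x * (m' x * i x)))
      \<longlonglongrightarrow> (LINT x|lborel. w' x * (m' x * i x))" by simp
  moreover have "(LINT x|lborel. w j x * d j x) + (LINT x|lborel. w j x * (m' x * i x))
      = (LINT x|lborel. w j x * m j x)" for j
  proof -
    have "(LINT x|lborel. w j x * d j x) + (LINT x|lborel. w j x * (m' x * i x))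
        = (LINT x|lborel. w j x * d j x + w j x * (m' x * i x))"
      by (rule Bochner_Integration.integral_add[symmetric])
        (intro integrable_mult_square_integrable w d m'i)+
    also have "\<dots> = (LINT x|lborel. w j x * m j x)"
      by (rule Bochner_Integration.integral_cong)
        (use zero(1)[of _ j] in \<open>auto simp: d_def i_def indicator_def algebra_simps not_le\<close>)
    finally show ?thesis .
  qed
  moreover have "(LINT x|lborel. w' x * (m' x * i x)) = (LINT x|lborel. w' x * m' x)"
    by (rule Bochner_Integration.integral_cong)
      (use zero(2) in \<open>auto simp: i_def indicator_def not_le\<close>)
  ultimately show ?thesis by simp
qed

text \<open>
  For a fixed mollifier \<open>\<rho>\<close> of radius \<open>\<epsilon>\<close>, weak convergence makes the fields \<open>\<rho> * u\<^sub>j\<close> converge pointwise and boundedly, so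
  the integrals of \<open>\<phi> (\<rho> * u\<^sub>j) \<bullet> v\<^sub>j\<close> converge.  Mollification costs \<open>O(\<epsilon>)\<close>, uniformly in \<open>j\<close>; the same
  holds for the limits, because vanishing curl and divergence are preserved under weak convergence.
\<close>

lemma div_curl_lborel:
  fixes \<Omega> :: "(real^'n::finite) set" and u v :: "nat \<Rightarrow> real^'n \<Rightarrow> real^'n"
  assumes \<Omega>: "open \<Omega>" "bounded \<Omega>" and \<phi>: "test_function \<Omega> \<phi>"
    and uv: "\<And>j. div_curl_pair \<Omega> (u j) (v j)"
    and u': "square_integrable lborel u'" "\<And>x. x \<notin> \<Omega> \<Longrightarrow> u' x = 0"
    and v': "square_integrable lborel v'" "\<And>x. x \<notin> \<Omega> \<Longrightarrow> v' x = 0"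
    and B: "\<And>j. L2_norm lborel (u j) \<le> B" "\<And>j. L2_norm lborel (v j) \<le> B"
    and wu: "\<And>h. square_integrable lborel h \<Longrightarrow>
      (\<lambda>j. LINT x|lborel. u j x \<bullet> h x) \<longlonglongrightarrow> (LINT x|lborel. u' x \<bullet> h x)"
    and wv: "\<And>h. square_integrable lborel h \<Longrightarrow>
      (\<lambda>j. LINT x|lborel. v j x \<bullet> h x) \<longlonglongrightarrow> (LINT x|lborel. v' x \<bullet> h x)"
  shows "(\<lambda>j. LINT x|lborel. \<phi> x * (u j x \<bullet> v j x)) \<longlonglongrightarrow> (LINT x|lborel. \<phi> x * (u' x \<bullet> v' x))"
proof -
  note u = div_curl_pairD(1)[OF uv] u'(1) and v = div_curl_pairD(2)[OF uv] v'(1)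
    and u0 = div_curl_pairD(3)[OF uv] u'(2) and v0 = div_curl_pairD(4)[OF uv] v'(2)
    and curl = div_curl_pairD(5)[OF uv] and div = div_curl_pairD(6)[OF uv]
  obtain R where R: "\<Omega> \<subseteq> cball 0 R"
    using \<Omega>(2) unfolding bounded_iff by (auto simp: subset_eq)
  have out: "x \<notin> \<Omega>" if "norm x > R" for x using that R by auto
  have wk: "(\<lambda>j. LINT x|lborel. f j x $ k * h x) \<longlonglongrightarrow> (LINT x|lborel. f' x $ k * h x)"
    if weak: "\<And>h. square_integrable lborel h \<Longrightarrow>
        (\<lambda>j. LINT x|lborel. f j x \<bullet> h x) \<longlonglongrightarrow> (LINT x|lborel. f' x \<bullet> h x)"
      and h: "square_integrable lborel h"
    for f :: "nat \<Rightarrow> real^'n \<Rightarrow> real^'n" and f' and h :: "real^'n \<Rightarrow> real" and k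
  proof -
    have "square_integrable lborel (\<lambda>x. h x *\<^sub>R (axis k 1 :: real^'n))"
      by (rule square_integrable_bound[OF h, where C = 1])
        (use square_integrable_measurable[OF h] in \<open>auto simp: norm_axis_1 intro!: borel_measurable_scaleR\<close>)
    from weak[OF this] show ?thesis by (simp add: inner_axis mult.commute)
  qed
  have pd: "square_integrable lborel (partial_deriv k \<theta>)" if \<theta>: "test_function \<Omega> \<theta>" for k \<theta>
  proof -
    have sm: "smooth (partial_deriv k \<theta>)"
      using \<theta> by (auto simp: test_function_def intro: smooth_partial_deriv)
    obtain K where K: "K \<subseteq> \<Omega>" "\<And>x. x \<notin> K \<Longrightarrow> partial_deriv k \<theta> x = 0"
      using test_function_support[OF \<theta>] by metis
    then have "integrable lborel (\<lambda>x. (partial_deriv k \<theta> x)\<^sup>2)"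
      by (intro integrable_compact_support[where a = 0 and R = R] continuous_intros smooth_imp_continuous_on sm)
        (use out in auto)
    then show ?thesis using borel_measurable_smooth[OF sm] by (simp add: square_integrable_def)
  qed
  have curl': "(LINT x|lborel. u' x $ k * partial_deriv l \<theta> x) = (LINT x|lborel. u' x $ l * partial_deriv k \<theta> x)"
    if \<theta>: "test_function \<Omega> \<theta>" for \<theta> k l
    using wk[OF wu pd[OF \<theta>], of k l] wk[OF wu pd[OF \<theta>], of l k] curl[OF \<theta>, of _ k l]
    by (simp add: LIMSEQ_unique)
  have div': "(\<Sum>k\<in>UNIV. LINT x|lborel. v' x $ k * partial_deriv k \<theta> x) = 0"
    if \<theta>: "test_function \<Omega> \<theta>" for \<theta>
  proof -
    have "(\<lambda>j. \<Sum>k\<in>UNIV. LINT x|lborel. v j x $ k * partial_deriv k \<theta> x)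
        \<longlonglongrightarrow> (\<Sum>k\<in>UNIV. LINT x|lborel. v' x $ k * partial_deriv k \<theta> x)"
      by (intro tendsto_sum wk[OF wv pd[OF \<theta>]])
    then show ?thesis using div[OF \<theta>] by (simp add: LIMSEQ_const_iff)
  qed
  have uv': "div_curl_pair \<Omega> u' v'"
    unfolding div_curl_pair_def using u(2) v(2) u0(2) v0(2) curl' div' by blast
  obtain r C where r: "r > 0" and C: "C \<ge> 0" and close: "\<And>u v \<epsilon> \<rho>. div_curl_pair \<Omega> u v \<Longrightarrow>
      mollifier \<epsilon> \<rho> \<Longrightarrow> 0 < \<epsilon> \<Longrightarrow> \<epsilon> < r \<Longrightarrow>
      \<bar>(\<Sum>k\<in>UNIV. LINT z|lborel. \<phi> z * v z $ k * (LINT x|lborel. u x $ k * \<rho> (z - x)))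
         - (LINT x|lborel. \<phi> x * (u x \<bullet> v x))\<bar> \<le> \<epsilon> * C * (L2_norm lborel u * L2_norm lborel v)"
    using div_curl_mollified[OF \<Omega>(1) R \<phi>] by blast
  have B0: "B \<ge> 0" using B(1)[of 0] L2_norm_nonneg[of lborel "u 0"] by linarith
  define D where "D = C * (B * B) + C * (L2_norm lborel u' * L2_norm lborel v')"
  have D0: "D \<ge> 0" unfolding D_def using C B0 by (intro add_nonneg_nonneg mult_nonneg_nonneg) auto
  show ?thesis
  proof (rule tendstoI)
    fix e :: real assume e: "e > 0"
    define \<epsilon> where "\<epsilon> = min (r / 2) (e / (2 * (D + 1)))"
    have \<epsilon>: "\<epsilon> > 0" "\<epsilon> < r" using r e D0 by (auto simp: \<epsilon>_def)
    \<comment> \<open>\<open>\<epsilon> * D\<close> bounds the two mollification errors; the rest of \<open>e\<close> is for the convergence in \<open>j\<close>.\<close>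
    have \<epsilon>D: "\<epsilon> * D < e / 2 + e / 4"
    proof -
      have "\<epsilon> * D \<le> e / (2 * (D + 1)) * (D + 1)"
        using D0 \<epsilon>(1) e by (intro mult_mono) (auto simp: \<epsilon>_def)
      also have "\<dots> = e / 2"
      proof -
        have "D + 1 \<noteq> 0" using D0 by linarith
        then show ?thesis by (metis divide_divide_eq_left nonzero_eq_divide_eq)
      qed
      finally show ?thesis using e by linarith
    qed
    obtain \<rho> :: "real^'n \<Rightarrow> real" where \<rho>: "mollifier \<epsilon> \<rho>" using mollifier_exists[OF \<epsilon>(1)] .
    have [measurable]: "\<rho> \<in> borel_measurable borel" by (rule borel_measurable_smooth[OF mollifierD(1)[OF \<rho>]])
    have [measurable]: "u j \<in> borel_measurable borel" "u' \<in> borel_measurable borel" for j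
      using square_integrable_measurable[OF u(1)] square_integrable_measurable[OF u(2)] by simp_all
    have \<rho>sq: "square_integrable lborel \<rho>"
    proof -
      have "integrable lborel (\<lambda>x. (\<rho> x)\<^sup>2)"
        by (intro integrable_compact_support[where a = 0 and R = \<epsilon>] continuous_intros
            smooth_imp_continuous_on mollifierD(1)[OF \<rho>]) (use mollifierD(3)[OF \<rho>] in auto)
      then show ?thesis by (simp add: square_integrable_def)
    qed
    have \<rho>z: "square_integrable lborel (\<lambda>x. \<rho> (z - x))" "L2_norm lborel (\<lambda>x. \<rho> (z - x)) = L2_norm lborel \<rho>" for z
      using integrable_lborel_isometry[of "\<lambda>x. (\<rho> x)\<^sup>2" "-1" z]
        integral_lborel_isometry[of "\<lambda>x. (\<rho> x)\<^sup>2" "-1" z] square_integrable_integrable[OF \<rho>sq]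
      by (simp_all add: square_integrable_def L2_norm_def)
    \<comment> \<open>\<open>m f\<close> is the convolution of \<open>\<rho>\<close> with \<open>f\<close>.\<close>
    define m where "m f k z = (LINT x|lborel. f x $ k * \<rho> (z - x))" for f :: "real^'n \<Rightarrow> real^'n" and k z
    define \<Phi> where "\<Phi> f g = (\<Sum>k\<in>UNIV. LINT z|lborel. \<phi> z * g z $ k * m f k z)" for f g :: "real^'n \<Rightarrow> real^'n"
    obtain A where A: "\<And>x. \<bar>\<phi> x\<bar> \<le> A" "A \<ge> 0" using test_function_bounded[OF \<phi>] by metis
    have \<phi>m [measurable]: "\<phi> \<in> borel_measurable borel"
      using \<phi> by (auto simp: test_function_def intro: borel_measurable_smooth)
    have mm: "m f k \<in> borel_measurable borel" if [measurable]: "f \<in> borel_measurable borel" for f k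
      unfolding m_def by measurable
    have \<phi>f: "square_integrable lborel (\<lambda>x. \<phi> x * f x $ k)" "L2_norm lborel (\<lambda>x. \<phi> x * f x $ k) \<le> A * L2_norm lborel f"
      if f: "square_integrable lborel f" for f :: "real^'n \<Rightarrow> real^'n" and k
    proof -
      have meas: "(\<lambda>x. \<phi> x * f x $ k) \<in> borel_measurable lborel"
        using square_integrable_measurable[OF square_integrable_nth[OF f, of k]] by simp
      have le: "norm (\<phi> x * f x $ k) \<le> A * norm (f x)" for x
        by (auto simp: abs_mult intro!: mult_mono A component_le_norm_cart)
      show "square_integrable lborel (\<lambda>x. \<phi> x * f x $ k)" by (rule square_integrable_bound[OF f meas le])
      show "L2_norm lborel (\<lambda>x. \<phi> x * f x $ k) \<le> A * L2_norm lborel f" by (rule L2_norm_bound[OF f meas le A(2)])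
    qed
    have lim: "(\<lambda>j. \<Phi> (u j) (v j)) \<longlonglongrightarrow> \<Phi> u' v'"
      unfolding \<Phi>_def
    proof (rule tendsto_sum, rule integral_weak_strong[where B = "A * B" and R = R and C = "B * L2_norm lborel \<rho>"])
      fix k :: 'n
      show "square_integrable lborel (\<lambda>x. \<phi> x * v j x $ k)" for j by (rule \<phi>f[OF v(1)])
      show "L2_norm lborel (\<lambda>x. \<phi> x * v j x $ k) \<le> A * B" for j
        using \<phi>f(2)[OF v(1)[of j], of k] mult_left_mono[OF B(2)[of j] A(2)] by linarith
      show "\<phi> x * v j x $ k = 0" if "R < norm x" for j x using v0(1) out[OF that] by simp
      show "\<phi> x * v' x $ k = 0" if "R < norm x" for x using v0(2) out[OF that] by simp
      show "(\<lambda>j. LINT x|lborel. \<phi> x * v j x $ k * h x) \<longlonglongrightarrow> (LINT x|lborel. \<phi> x * v' x $ k * h x)"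
        if h: "square_integrable lborel h" for h
      proof -
        have "square_integrable lborel (\<lambda>x. \<phi> x * h x)"
          by (rule square_integrable_bound[OF h, where C = A])
            (use square_integrable_measurable[OF h] A(1) in \<open>auto simp: abs_mult intro!: mult_right_mono\<close>)
        from wk[OF wv this, of k] show ?thesis by (simp add: mult_ac)
      qed
      show "m (u j) k \<in> borel_measurable borel" "m u' k \<in> borel_measurable borel" for j by (auto intro!: mm)
      show "\<bar>m (u j) k z\<bar> \<le> B * L2_norm lborel \<rho>" for j z
      proof -
        have "\<bar>m (u j) k z\<bar> \<le> L2_norm lborel (\<lambda>x. u j x $ k) * L2_norm lborel \<rho>"
          unfolding m_def
          using abs_integral_inner_le[OF square_integrable_nth[OF u(1)[of j], of k] \<rho>z(1)[of z]] \<rho>z(2)[of z] by simp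
        moreover have "L2_norm lborel (\<lambda>x. u j x $ k) \<le> B"
          using L2_norm_bound[OF u(1)[of j], of "\<lambda>x. u j x $ k" 1] B(1)[of j] component_le_norm_cart[of "u j _" k]
          by simp
        ultimately show ?thesis
          using mult_right_mono[of "L2_norm lborel (\<lambda>x. u j x $ k)" B "L2_norm lborel \<rho>"] by simp
      qed
      show "(\<lambda>j. m (u j) k z) \<longlonglongrightarrow> m u' k z" for z
        unfolding m_def by (rule wk[OF wu \<rho>z(1)])
    qed
    have cj: "\<bar>\<Phi> (u j) (v j) - (LINT x|lborel. \<phi> x * (u j x \<bullet> v j x))\<bar> \<le> \<epsilon> * (C * (B * B))" for j
    proof -
      have "\<bar>\<Phi> (u j) (v j) - (LINT x|lborel. \<phi> x * (u j x \<bullet> v j x))\<bar>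
          \<le> \<epsilon> * C * (L2_norm lborel (u j) * L2_norm lborel (v j))"
        unfolding \<Phi>_def m_def by (rule close[OF uv \<rho> \<epsilon>])
      also have "\<dots> \<le> \<epsilon> * C * (B * B)"
        using B0 B C \<epsilon>(1) by (intro mult_left_mono mult_mono) auto
      finally show ?thesis by (simp add: mult.assoc)
    qed
    have c': "\<bar>\<Phi> u' v' - (LINT x|lborel. \<phi> x * (u' x \<bullet> v' x))\<bar> \<le> \<epsilon> * (C * (L2_norm lborel u' * L2_norm lborel v'))"
      using close[OF uv' \<rho> \<epsilon>] unfolding \<Phi>_def m_def by (simp add: mult.assoc)
    have "\<forall>\<^sub>F j in sequentially. dist (\<Phi> (u j) (v j)) (\<Phi> u' v') < e / 4"
      using lim e by (intro tendstoD) auto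
    then show "\<forall>\<^sub>F j in sequentially. dist (LINT x|lborel. \<phi> x * (u j x \<bullet> v j x)) (LINT x|lborel. \<phi> x * (u' x \<bullet> v' x)) < e"
    proof eventually_elim
      case (elim j)
      have "\<epsilon> * (C * (B * B)) + \<epsilon> * (C * (L2_norm lborel u' * L2_norm lborel v')) = \<epsilon> * D"
        by (simp add: D_def distrib_left)
      then show ?case using elim cj[of j] c' \<epsilon>D unfolding dist_real_def by linarith
    qed
  qed
qed

text \<open>
  Lebesgue measure on the product space is not the product of the Lebesgue measures, so Fubini's theorem is applied to
  Borel representatives, extended by zero to the whole space.
\<close>

lemma lebesgue_on_AE_eq_lborel:
  fixes p q :: "'a::euclidean_space \<Rightarrow> real"
  assumes "\<Omega> \<in> sets borel" "q \<in> borel_measurable borel" "\<And>x. x \<notin> \<Omega> \<Longrightarrow> q x = 0"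
    and ae: "AE x in lborel. x \<in> \<Omega> \<longrightarrow> p x = q x"
  shows "(LINT x|lebesgue_on \<Omega>. p x) = (LINT x|lborel. q x)"
    and "integrable (lebesgue_on \<Omega>) p \<longleftrightarrow> integrable lborel q"
proof -
  let ?p = "\<lambda>x. indicator \<Omega> x *\<^sub>R p x"
  have S: "\<Omega> \<inter> space lebesgue \<in> sets lebesgue" using assms(1) by simp
  have q: "q \<in> borel_measurable lebesgue" using assms(2) by (simp add: measurable_completion)
  have "AE x in lborel. q x = ?p x"
    using ae by eventually_elim (use assms(3) in \<open>auto simp: indicator_def\<close>)
  then have eq: "AE x in lebesgue. q x = ?p x" by (rule AE_completion)
  then have p: "?p \<in> borel_measurable lebesgue" by (rule borel_measurable_AE[OF q])
  have "(LINT x|lebesgue. ?p x) = (LINT x|lebesgue. q x)"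
    by (rule integral_cong_AE[OF p q]) (use eq in auto)
  then show "(LINT x|lebesgue_on \<Omega>. p x) = (LINT x|lborel. q x)"
    using assms(2) by (simp add: integral_restrict_space[OF S] integral_completion)
  have "integrable lebesgue ?p \<longleftrightarrow> integrable lebesgue q"
    by (rule integrable_cong_AE[OF p q]) (use eq in auto)
  then show "integrable (lebesgue_on \<Omega>) p \<longleftrightarrow> integrable lborel q"
    using assms(2) by (simp add: integrable_restrict_space[OF S] integrable_completion)
qed

lemma borel_representative:
  fixes f :: "'a::euclidean_space \<Rightarrow> 'b::euclidean_space"
  assumes \<Omega>: "\<Omega> \<in> sets borel" and f: "f \<in> borel_measurable (lebesgue_on \<Omega>)"
  obtains g where "g \<in> borel_measurable borel" "\<And>x. x \<notin> \<Omega> \<Longrightarrow> g x = 0"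
    "AE x in lborel. x \<in> \<Omega> \<longrightarrow> f x = g x"
proof -
  have "(\<lambda>x. indicator \<Omega> x *\<^sub>R f x) \<in> borel_measurable lebesgue"
    using f \<Omega> by (subst (asm) borel_measurable_restrict_space_iff) auto
  then have "(\<lambda>x. (indicator \<Omega> x *\<^sub>R f x) \<bullet> b) \<in> borel_measurable (completion lborel)" for b
    by (intro borel_measurable_inner borel_measurable_const)
  then have "\<exists>g\<in>borel_measurable lborel. AE x in lborel. (indicator \<Omega> x *\<^sub>R f x) \<bullet> b = g x" for b
    by (rule completion_ex_borel_measurable_real)
  then obtain g where g: "\<And>b. g b \<in> borel_measurable lborel"
    "\<And>b. AE x in lborel. (indicator \<Omega> x *\<^sub>R f x) \<bullet> b = g b x" by metis
  show ?thesis
  proof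
    have [measurable]: "g b \<in> borel_measurable borel" "\<Omega> \<in> sets borel" for b using g(1)[of b] \<Omega> by simp_all
    show "(\<lambda>x. \<Sum>b\<in>Basis. (indicator \<Omega> x * g b x) *\<^sub>R b) \<in> borel_measurable borel" by measurable
    have "AE x in lborel. \<forall>b\<in>Basis. (indicator \<Omega> x *\<^sub>R f x) \<bullet> b = g b x"
      using g(2) by (intro AE_finite_allI) auto
    then show "AE x in lborel. x \<in> \<Omega> \<longrightarrow> f x = (\<Sum>b\<in>Basis. (indicator \<Omega> x * g b x) *\<^sub>R b)"
    proof eventually_elim
      case (elim x)
      show ?case
      proof
        assume "x \<in> \<Omega>"
        then have "(\<Sum>b\<in>Basis. (indicator \<Omega> x * g b x) *\<^sub>R b) = (\<Sum>b\<in>Basis. (f x \<bullet> b) *\<^sub>R b)"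
          using elim by (intro sum.cong) auto
        then show "f x = (\<Sum>b\<in>Basis. (indicator \<Omega> x * g b x) *\<^sub>R b)" by (simp add: euclidean_representation)
      qed
    qed
  qed simp
qed

lemma square_integrable_representative:
  fixes f :: "'a::euclidean_space \<Rightarrow> 'b::euclidean_space"
  assumes \<Omega>: "\<Omega> \<in> sets borel" and f: "in_L2 \<Omega> f"
  obtains g where "square_integrable lborel g" "\<And>x. x \<notin> \<Omega> \<Longrightarrow> g x = 0"
    "AE x in lborel. x \<in> \<Omega> \<longrightarrow> f x = g x" "L2_norm lborel g = L2_norm (lebesgue_on \<Omega>) f"
proof -
  obtain g where g: "g \<in> borel_measurable borel" "\<And>x. x \<notin> \<Omega> \<Longrightarrow> g x = 0"
    "AE x in lborel. x \<in> \<Omega> \<longrightarrow> f x = g x"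
    using borel_representative[OF \<Omega>] f unfolding in_L2_def by metis
  have ae: "AE x in lborel. x \<in> \<Omega> \<longrightarrow> (norm (f x))\<^sup>2 = (norm (g x))\<^sup>2"
    using g(3) by eventually_elim auto
  have m: "(\<lambda>x. (norm (g x))\<^sup>2) \<in> borel_measurable borel" using g(1) by measurable
  have z: "(norm (g x))\<^sup>2 = 0" if "x \<notin> \<Omega>" for x using g(2)[OF that] by simp
  show ?thesis
    by (rule that[OF _ g(2,3)])
      (use lebesgue_on_AE_eq_lborel[OF \<Omega> m z ae] f g(1) in \<open>auto simp: square_integrable_def in_L2_def L2_norm_def\<close>)
qed

lemma weakly_tendsto_L2_bounded:
  fixes F :: "nat \<Rightarrow> 'a::euclidean_space \<Rightarrow> 'b::euclidean_space"
  assumes "weakly_tendsto_L2 \<Omega> F f"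
  obtains B where "\<And>j. L2_norm (lebesgue_on \<Omega>) (F j) \<le> B"
proof -
  have "\<exists>B. \<forall>j. L2_norm (lebesgue_on \<Omega>) (F j) \<le> B"
  proof (rule L2_uniform_boundedness)
    show "square_integrable (lebesgue_on \<Omega>) (F j)" for j
      using assms by (simp add: weakly_tendsto_L2_def in_L2_def square_integrable_def)
    fix g :: "'a \<Rightarrow> 'b" assume "square_integrable (lebesgue_on \<Omega>) g"
    then have "convergent (\<lambda>j. LINT x|lebesgue_on \<Omega>. F j x \<bullet> g x)"
      using assms unfolding weakly_tendsto_L2_def in_L2_def square_integrable_def convergent_def by blast
    then have "bounded (range (\<lambda>j. LINT x|lebesgue_on \<Omega>. F j x \<bullet> g x))"
      unfolding convergent_def using convergent_imp_bounded by blast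
    then show "\<exists>B. \<forall>j. \<bar>LINT x|lebesgue_on \<Omega>. F j x \<bullet> g x\<bar> \<le> B"
      unfolding bounded_iff real_norm_def by blast
  qed
  then show ?thesis using that by blast
qed

theorem div_curl_lemma:
  fixes \<Omega> :: "(real^'n::finite) set" and U V :: "nat \<Rightarrow> real^'n \<Rightarrow> real^'n"
  assumes \<Omega>: "open \<Omega>" "bounded \<Omega>" and \<phi>: "test_function \<Omega> \<phi>"
    and wU: "weakly_tendsto_L2 \<Omega> U U'" and wV: "weakly_tendsto_L2 \<Omega> V V'"
    and curl: "\<And>j. curl_free \<Omega> (U j)" and div: "\<And>j. div_free \<Omega> (V j)"
  shows "(\<lambda>j. LINT x|lebesgue_on \<Omega>. \<phi> x * (U j x \<bullet> V j x))
    \<longlonglongrightarrow> (LINT x|lebesgue_on \<Omega>. \<phi> x * (U' x \<bullet> V' x))"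
proof -
  have \<Omega>b: "\<Omega> \<in> sets borel" using \<Omega>(1) by simp
  have rep: "\<exists>g. square_integrable lborel g \<and> (\<forall>x. x \<notin> \<Omega> \<longrightarrow> g x = 0) \<and>
      (AE x in lborel. x \<in> \<Omega> \<longrightarrow> f x = g x) \<and> L2_norm lborel g = L2_norm (lebesgue_on \<Omega>) f"
    if "in_L2 \<Omega> f" for f :: "real^'n \<Rightarrow> real^'n"
    by (rule square_integrable_representative[OF \<Omega>b that]) blast
  have U2: "in_L2 \<Omega> (U j)" "in_L2 \<Omega> U'" and V2: "in_L2 \<Omega> (V j)" "in_L2 \<Omega> V'" for j
    using wU wV by (auto simp: weakly_tendsto_L2_def)
  have "\<exists>u. \<forall>j. square_integrable lborel (u j) \<and> (\<forall>x. x \<notin> \<Omega> \<longrightarrow> u j x = 0) \<and>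
      (AE x in lborel. x \<in> \<Omega> \<longrightarrow> F j x = u j x) \<and> L2_norm lborel (u j) = L2_norm (lebesgue_on \<Omega>) (F j)"
    if "\<And>j. in_L2 \<Omega> (F j)" for F :: "nat \<Rightarrow> real^'n \<Rightarrow> real^'n"
    by (rule choice) (use rep that in blast)
  note seq = this
  obtain u where u: "\<And>j. square_integrable lborel (u j)" "\<And>j x. x \<notin> \<Omega> \<Longrightarrow> u j x = 0"
    "\<And>j. AE x in lborel. x \<in> \<Omega> \<longrightarrow> U j x = u j x"
    "\<And>j. L2_norm lborel (u j) = L2_norm (lebesgue_on \<Omega>) (U j)" using seq[of U, OF U2(1)] by blast
  obtain v where v: "\<And>j. square_integrable lborel (v j)" "\<And>j x. x \<notin> \<Omega> \<Longrightarrow> v j x = 0"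
    "\<And>j. AE x in lborel. x \<in> \<Omega> \<longrightarrow> V j x = v j x"
    "\<And>j. L2_norm lborel (v j) = L2_norm (lebesgue_on \<Omega>) (V j)" using seq[of V, OF V2(1)] by blast
  obtain u' where u': "square_integrable lborel u'" "\<And>x. x \<notin> \<Omega> \<Longrightarrow> u' x = 0"
    "AE x in lborel. x \<in> \<Omega> \<longrightarrow> U' x = u' x" using rep[OF U2(2)] by blast
  obtain v' where v': "square_integrable lborel v'" "\<And>x. x \<notin> \<Omega> \<Longrightarrow> v' x = 0"
    "AE x in lborel. x \<in> \<Omega> \<longrightarrow> V' x = v' x" using rep[OF V2(2)] by blast
  have m [measurable]: "u j \<in> borel_measurable borel" "v j \<in> borel_measurable borel"
    "u' \<in> borel_measurable borel" "v' \<in> borel_measurable borel" for j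
    using square_integrable_measurable[OF u(1)] square_integrable_measurable[OF v(1)]
      square_integrable_measurable[OF u'(1)] square_integrable_measurable[OF v'(1)] by simp_all
  obtain B1 B2 where "\<And>j. L2_norm (lebesgue_on \<Omega>) (U j) \<le> B1" "\<And>j. L2_norm (lebesgue_on \<Omega>) (V j) \<le> B2"
    using weakly_tendsto_L2_bounded[OF wU] weakly_tendsto_L2_bounded[OF wV] by metis
  then have B: "L2_norm lborel (u j) \<le> max B1 B2" "L2_norm lborel (v j) \<le> max B1 B2" for j
    unfolding u(4) v(4) by (auto intro: le_max_iff_disj[THEN iffD2])
  have conv: "(LINT x|lebesgue_on \<Omega>. F x \<bullet> h x) = (LINT x|lborel. f x \<bullet> h x)"
    if [measurable]: "f \<in> borel_measurable borel" "h \<in> borel_measurable borel" and z: "\<And>x. x \<notin> \<Omega> \<Longrightarrow> f x = 0"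
      and ae: "AE x in lborel. x \<in> \<Omega> \<longrightarrow> F x = f x" for F f h :: "real^'n \<Rightarrow> real^'n"
  proof (rule lebesgue_on_AE_eq_lborel(1)[OF \<Omega>b])
    show "AE x in lborel. x \<in> \<Omega> \<longrightarrow> F x \<bullet> h x = f x \<bullet> h x" using ae by eventually_elim auto
  qed (use z in auto)
  have L2h: "in_L2 \<Omega> h" if h: "square_integrable lborel h" for h :: "real^'n \<Rightarrow> real^'n"
    unfolding in_L2_def
  proof
    have [measurable]: "h \<in> borel_measurable borel" using square_integrable_measurable[OF h] by simp
    show "h \<in> borel_measurable (lebesgue_on \<Omega>)" by (intro measurable_restrict_space1 measurable_completion) simp
    have "integrable lborel (\<lambda>x. indicator \<Omega> x *\<^sub>R (norm (h x))\<^sup>2)"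
      using square_integrable_integrable[OF h] \<Omega>b by (intro integrable_mult_indicator) auto
    moreover have "integrable (lebesgue_on \<Omega>) (\<lambda>x. (norm (h x))\<^sup>2)
        \<longleftrightarrow> integrable lborel (\<lambda>x. indicator \<Omega> x *\<^sub>R (norm (h x))\<^sup>2)"
      by (rule lebesgue_on_AE_eq_lborel(2)[OF \<Omega>b]) (use \<Omega>b in auto)
    ultimately show "integrable (lebesgue_on \<Omega>) (\<lambda>x. (norm (h x))\<^sup>2)" by simp
  qed
  have partial: "distr_partial \<Omega> k (\<lambda>x. F x $ l) \<theta> = - (LINT x|lborel. f x $ l * partial_deriv k \<theta> x)"
    if [measurable]: "f \<in> borel_measurable borel" and z: "\<And>x. x \<notin> \<Omega> \<Longrightarrow> f x = 0"
      and ae: "AE x in lborel. x \<in> \<Omega> \<longrightarrow> F x = f x" and \<theta>: "test_function \<Omega> \<theta>"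
    for F f :: "real^'n \<Rightarrow> real^'n" and \<theta> k l
  proof -
    have [measurable]: "partial_deriv k \<theta> \<in> borel_measurable borel"
      using \<theta> by (auto simp: test_function_def intro: borel_measurable_smooth smooth_partial_deriv)
    have "(LINT x|lebesgue_on \<Omega>. F x $ l * partial_deriv k \<theta> x) = (LINT x|lborel. f x $ l * partial_deriv k \<theta> x)"
    proof (rule lebesgue_on_AE_eq_lborel(1)[OF \<Omega>b])
      show "AE x in lborel. x \<in> \<Omega> \<longrightarrow> F x $ l * partial_deriv k \<theta> x = f x $ l * partial_deriv k \<theta> x"
        using ae by eventually_elim auto
    qed (use z in auto)
    then show ?thesis by (simp add: distr_partial_def)
  qed
  have \<phi>m [measurable]: "\<phi> \<in> borel_measurable borel"
    using \<phi> by (auto simp: test_function_def intro: borel_measurable_smooth)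
  have prod: "(LINT x|lebesgue_on \<Omega>. \<phi> x * (F x \<bullet> G x)) = (LINT x|lborel. \<phi> x * (f x \<bullet> g x))"
    if [measurable]: "f \<in> borel_measurable borel" "g \<in> borel_measurable borel" and z: "\<And>x. x \<notin> \<Omega> \<Longrightarrow> f x = 0"
      and ae: "AE x in lborel. x \<in> \<Omega> \<longrightarrow> F x = f x" "AE x in lborel. x \<in> \<Omega> \<longrightarrow> G x = g x"
    for F f G g :: "real^'n \<Rightarrow> real^'n"
  proof (rule lebesgue_on_AE_eq_lborel(1)[OF \<Omega>b])
    show "AE x in lborel. x \<in> \<Omega> \<longrightarrow> \<phi> x * (F x \<bullet> G x) = \<phi> x * (f x \<bullet> g x)"
      using ae by eventually_elim auto
  qed (use z in auto)
  have uv: "div_curl_pair \<Omega> (u j) (v j)" for j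
    unfolding div_curl_pair_def
  proof (intro conjI allI impI)
    fix \<theta> k l assume \<theta>: "test_function \<Omega> \<theta>"
    show "(LINT x|lborel. u j x $ k * partial_deriv l \<theta> x) = (LINT x|lborel. u j x $ l * partial_deriv k \<theta> x)"
      using curl[of j, unfolded curl_free_def, rule_format, OF \<theta>, of l k]
      by (simp add: partial[OF m(1) u(2) u(3) \<theta>])
    show "(\<Sum>k\<in>UNIV. LINT x|lborel. v j x $ k * partial_deriv k \<theta> x) = 0"
      using div[of j, unfolded div_free_def, rule_format, OF \<theta>]
      by (simp add: partial[OF m(2) v(2) v(3) \<theta>] sum_negf)
  qed (use u v in auto)
  have "(\<lambda>j. LINT x|lborel. \<phi> x * (u j x \<bullet> v j x)) \<longlonglongrightarrow> (LINT x|lborel. \<phi> x * (u' x \<bullet> v' x))"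
  proof (rule div_curl_lborel[OF \<Omega> \<phi> uv u'(1,2) v'(1,2) B])
    fix h :: "real^'n \<Rightarrow> real^'n" assume h: "square_integrable lborel h"
    have hm: "h \<in> borel_measurable borel" using square_integrable_measurable[OF h] by simp
    show "(\<lambda>j. LINT x|lborel. u j x \<bullet> h x) \<longlonglongrightarrow> (LINT x|lborel. u' x \<bullet> h x)"
    proof -
      have "(\<lambda>j. LINT x|lebesgue_on \<Omega>. U j x \<bullet> h x) \<longlonglongrightarrow> (LINT x|lebesgue_on \<Omega>. U' x \<bullet> h x)"
        using wU L2h[OF h] unfolding weakly_tendsto_L2_def by blast
      then show ?thesis by (simp add: conv[OF m(1) hm u(2) u(3)] conv[OF m(3) hm u'(2) u'(3)])
    qed
    show "(\<lambda>j. LINT x|lborel. v j x \<bullet> h x) \<longlonglongrightarrow> (LINT x|lborel. v' x \<bullet> h x)"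
    proof -
      have "(\<lambda>j. LINT x|lebesgue_on \<Omega>. V j x \<bullet> h x) \<longlonglongrightarrow> (LINT x|lebesgue_on \<Omega>. V' x \<bullet> h x)"
        using wV L2h[OF h] unfolding weakly_tendsto_L2_def by blast
      then show ?thesis by (simp add: conv[OF m(2) hm v(2) v(3)] conv[OF m(4) hm v'(2) v'(3)])
    qed
  qed
  then show ?thesis
    by (simp add: prod[OF m(1) m(2) u(2) u(3) v(3)] prod[OF m(3) m(4) u'(2) u'(3) v'(3)])
qed

section \<open>The lower bound\<close>

lemma in_L2_iff_square_integrable: "in_L2 \<Omega> f \<longleftrightarrow> square_integrable (lebesgue_on \<Omega>) f"
  by (simp add: in_L2_def square_integrable_def)

lemma
  fixes F :: "nat \<Rightarrow> 'a::euclidean_space \<Rightarrow> 'b::euclidean_space" and G :: "nat \<Rightarrow> 'a \<Rightarrow> 'c::euclidean_space"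
  assumes w: "weakly_tendsto_L2 \<Omega> (\<lambda>j x. (F j x, G j x)) (\<lambda>x. (f x, g x))"
  shows weakly_tendsto_L2_fst: "weakly_tendsto_L2 \<Omega> F f"
    and weakly_tendsto_L2_snd: "weakly_tendsto_L2 \<Omega> G g"
proof -
  have comp: "in_L2 \<Omega> p \<and> in_L2 \<Omega> q" if "in_L2 \<Omega> (\<lambda>x. (p x, q x))" for p :: "'a \<Rightarrow> 'b" and q :: "'a \<Rightarrow> 'c"
  proof -
    note pq = that[unfolded in_L2_iff_square_integrable]
    note m = square_integrable_measurable[OF pq]
    have "p \<in> borel_measurable (lebesgue_on \<Omega>)"
      using measurable_compose[OF m borel_measurable_continuous_onI[OF continuous_on_fst[OF continuous_on_id]]] by simp
    moreover have "q \<in> borel_measurable (lebesgue_on \<Omega>)"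
      using measurable_compose[OF m borel_measurable_continuous_onI[OF continuous_on_snd[OF continuous_on_id]]] by simp
    ultimately show ?thesis
      unfolding in_L2_iff_square_integrable
      using square_integrable_bound[OF pq, of p 1] square_integrable_bound[OF pq, of q 1]
        norm_fst_le[of "p _" "q _"] norm_snd_le[of "q _" "p _"] by simp
  qed
  have lift: "in_L2 \<Omega> (\<lambda>x. (h x, 0 :: 'c))" if "in_L2 \<Omega> h" for h :: "'a \<Rightarrow> 'b"
    using that by (simp add: in_L2_def norm_Pair borel_measurable_Pair)
  have lift': "in_L2 \<Omega> (\<lambda>x. (0 :: 'b, h x))" if "in_L2 \<Omega> h" for h :: "'a \<Rightarrow> 'c"
    using that by (simp add: in_L2_def norm_Pair borel_measurable_Pair)
  have lim: "(\<lambda>j. LINT x|lebesgue_on \<Omega>. (F j x, G j x) \<bullet> h x) \<longlonglongrightarrow> (LINT x|lebesgue_on \<Omega>. (f x, g x) \<bullet> h x)"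
    if "in_L2 \<Omega> h" for h using w that unfolding weakly_tendsto_L2_def by blast
  show "weakly_tendsto_L2 \<Omega> F f"
    using w comp lim[OF lift] unfolding weakly_tendsto_L2_def by (simp add: inner_Pair) blast
  show "weakly_tendsto_L2 \<Omega> G g"
    using w comp lim[OF lift'] unfolding weakly_tendsto_L2_def by (simp add: inner_Pair) blast
qed

text \<open>
  The right-hand side is convex in \<open>u\<close>, and the left-hand side is its tangent at \<open>c b w\<close>.  Because of \<open>a b\<^sup>3 = 1\<close> the
  coefficient of \<open>u\<close> does not depend on \<open>a\<close>, so that the term linear in \<open>u\<close> passes to weak limits even if \<open>a\<close> oscillates.  For
  \<open>c = 0\<close> the bound is \<open>0 \<le> a |u|\<^sup>4\<close>.
\<close>

lemma quartic_tangent_bound: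
  fixes u w :: "'a::real_inner"
  assumes "a \<ge> 0" "b \<ge> 0" "c \<ge> 0" "c = 0 \<or> a * b ^ 3 = 1"
  shows "4 * c ^ 3 * (norm w)\<^sup>2 * (u \<bullet> w) - 3 * c ^ 4 * norm w ^ 4 * b \<le> a * norm u ^ 4"
proof (cases "c = 0")
  case False
  define p where "p = norm u"
  define q where "q = c * b * norm w"
  have pq: "p \<ge> 0" "q \<ge> 0" using assms by (auto simp: p_def q_def)
  have ab: "a * b ^ 3 = 1" using assms False by blast
  have "0 \<le> (p - q)\<^sup>2 * ((p + q)\<^sup>2 + 2 * q\<^sup>2)" by simp
  also have "\<dots> = p ^ 4 - 4 * q ^ 3 * p + 3 * q ^ 4"
    by (simp add: power2_eq_square power3_eq_cube power4_eq_xxxx algebra_simps)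
  finally have "a * (4 * q ^ 3 * p - 3 * q ^ 4) \<le> a * p ^ 4" using assms(1) by (intro mult_left_mono) auto
  moreover have "a * (4 * q ^ 3 * p - 3 * q ^ 4)
      = (a * b ^ 3) * (4 * c ^ 3 * norm w ^ 3 * p - 3 * c ^ 4 * norm w ^ 4 * b)"
    by (simp add: q_def power3_eq_cube power4_eq_xxxx algebra_simps)
  ultimately have "4 * c ^ 3 * norm w ^ 3 * p - 3 * c ^ 4 * norm w ^ 4 * b \<le> a * norm u ^ 4"
    by (simp add: ab p_def)
  moreover have "4 * c ^ 3 * (norm w)\<^sup>2 * (u \<bullet> w) \<le> 4 * c ^ 3 * norm w ^ 3 * p"
  proof -
    have "4 * c ^ 3 * (norm w)\<^sup>2 * (u \<bullet> w) \<le> 4 * c ^ 3 * (norm w)\<^sup>2 * (norm u * norm w)"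
      using assms(3) by (intro mult_left_mono norm_cauchy_schwarz) auto
    then show ?thesis by (simp add: p_def power2_eq_square power3_eq_cube mult_ac)
  qed
  ultimately show ?thesis by linarith
qed (use assms in simp)

text \<open>
  For \<open>\<alpha>\<^sub>0 > 0\<close>, \<open>\<beta>\<^sub>i\<close> is \<open>\<alpha>\<^sub>i\<close> to the power \<open>-1/3\<close> and \<open>c\<close> is the reciprocal of \<open>t \<beta>\<^sub>1 + (1 - t) \<beta>\<^sub>0\<close>, the choice that
  maximises the lower bound \<open>4 c\<^sup>3 - 3 c\<^sup>4 (t \<beta>\<^sub>1 + (1 - t) \<beta>\<^sub>0)\<close>.  For \<open>\<alpha>\<^sub>0 = 0\<close> there is no \<open>\<beta>\<^sub>0\<close>, and \<open>c = 0\<close> is the value that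
  fits the formula for \<open>c\<^sup>3\<close>.
\<close>

lemma dual_coefficients:
  fixes \<alpha>\<^sub>0 \<alpha>\<^sub>1 t :: real
  assumes "\<alpha>\<^sub>1 > \<alpha>\<^sub>0" "\<alpha>\<^sub>0 \<ge> 0" "t \<in> {0..1}"
  obtains c \<beta>\<^sub>0 \<beta>\<^sub>1 where "c \<ge> 0" "\<beta>\<^sub>0 \<ge> 0" "\<beta>\<^sub>1 \<ge> 0"
    "c = 0 \<or> \<alpha>\<^sub>0 * \<beta>\<^sub>0 ^ 3 = 1" "c = 0 \<or> \<alpha>\<^sub>1 * \<beta>\<^sub>1 ^ 3 = 1"
    "c ^ 4 * (t * \<beta>\<^sub>1 + (1 - t) * \<beta>\<^sub>0) = c ^ 3"
    "c ^ 3 = \<alpha>\<^sub>1 * \<alpha>\<^sub>0 / ((1 - t) * \<alpha>\<^sub>1 powr (1/3) + t * \<alpha>\<^sub>0 powr (1/3)) ^ 3"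
proof (cases "\<alpha>\<^sub>0 = 0")
  case True
  show ?thesis by (rule that[of 0 0 0]) (use True in auto)
next
  case False
  define s0 where "s0 = \<alpha>\<^sub>0 powr (1/3)"
  define s1 where "s1 = \<alpha>\<^sub>1 powr (1/3)"
  have s: "s0 > 0" "s1 > 0" "s0 ^ 3 = \<alpha>\<^sub>0" "s1 ^ 3 = \<alpha>\<^sub>1"
    using assms False by (auto simp: s0_def s1_def powr_power)
  define d where "d = (1 - t) * s1 + t * s0"
  have d: "d > 0"
  proof (cases "t = 0")
    case False
    then have "t * s0 > 0" using assms(3) s by simp
    moreover have "(1 - t) * s1 \<ge> 0" using assms(3) s by simp
    ultimately show ?thesis by (simp add: d_def)
  qed (use s in \<open>simp add: d_def\<close>)
  have e: "t * (1 / s1) + (1 - t) * (1 / s0) = d / (s0 * s1)"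
    using s by (simp add: d_def field_simps)
  show ?thesis
  proof (rule that[of "s0 * s1 / d" "1 / s0" "1 / s1"])
    show "(s0 * s1 / d) ^ 4 * (t * (1 / s1) + (1 - t) * (1 / s0)) = (s0 * s1 / d) ^ 3"
      unfolding e using s d by (simp add: power4_eq_xxxx power3_eq_cube field_simps)
    show "(s0 * s1 / d) ^ 3 = \<alpha>\<^sub>1 * \<alpha>\<^sub>0 / ((1 - t) * \<alpha>\<^sub>1 powr (1/3) + t * \<alpha>\<^sub>0 powr (1/3)) ^ 3"
      using s by (simp add: d_def power_divide power_mult_distrib mult.commute flip: s0_def s1_def)
    show "s0 * s1 / d = 0 \<or> \<alpha>\<^sub>0 * (1 / s0) ^ 3 = 1" "s0 * s1 / d = 0 \<or> \<alpha>\<^sub>1 * (1 / s1) ^ 3 = 1"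
      using s by (auto simp: power_divide simp flip: s(3,4))
  qed (use s d in auto)
qed

theorem theorem1:
  fixes \<Omega> :: "(real^'n::finite) set"
    and \<alpha>\<^sub>0 \<alpha>\<^sub>1 t \<gamma> :: real
    and U V :: "real^'n"
    and Uj Vj :: "nat \<Rightarrow> real^'n \<Rightarrow> real^'n"
    and chi :: "nat \<Rightarrow> real^'n \<Rightarrow> real"
  assumes "bounded_lipschitz_domain \<Omega>"
    and "\<alpha>\<^sub>1 > \<alpha>\<^sub>0" and "\<alpha>\<^sub>0 \<ge> 0" and "t \<in> {0..1}"
    and "weakly_tendsto_L2 \<Omega> (\<lambda>j x. (Uj j x, Vj j x)) (\<lambda>x. (U, V))"
    and "\<And>j. chi j \<in> borel_measurable (lebesgue_on \<Omega>)"
    and "\<And>j x. x \<in> \<Omega> \<Longrightarrow> chi j x \<in> {0, 1}"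
    and "\<And>j. curl_free \<Omega> (Uj j)" and "\<And>j. div_free \<Omega> (Vj j)"
    and "\<And>j. AE x in lebesgue_on \<Omega>.
           Vj j x = ((chi j x * \<alpha>\<^sub>1 + (1 - chi j x) * \<alpha>\<^sub>0) * (norm (Uj j x))\<^sup>2) *\<^sub>R Uj j x"
    and "\<And>j. measure lebesgue {x \<in> \<Omega>. chi j x = 1} = t * measure lebesgue \<Omega>"
    and "\<gamma> = \<alpha>\<^sub>1 * \<alpha>\<^sub>0 / ((1 - t) * \<alpha>\<^sub>1 powr (1/3) + t * \<alpha>\<^sub>0 powr (1/3)) ^ 3"
  shows "\<gamma> * norm U ^ 4 \<le> V \<bullet> U"
proof -
  have \<Omega>: "open \<Omega>" "bounded \<Omega>" "\<Omega> \<noteq> {}"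
    using assms(1) by (auto simp: bounded_lipschitz_domain_def)
  have \<Omega>s: "\<Omega> \<in> sets lebesgue" "\<Omega> \<in> lmeasurable"
    using \<Omega> by (auto intro: lmeasurable_open)
  interpret finite_measure "lebesgue_on \<Omega>"
    by (rule finite_measure_lebesgue_on[OF \<Omega>s(2)])
  define \<mu> where "\<mu> = measure lebesgue \<Omega>"
  have \<mu>: "\<mu> > 0"
  proof -
    have "\<not> negligible \<Omega>" by (rule open_not_negligible[OF \<Omega>(1,3)])
    then have "\<mu> \<noteq> 0" unfolding \<mu>_def using negligible_iff_measure[of \<Omega>] \<Omega>s(2) by blast
    then show ?thesis by (simp add: \<mu>_def zero_less_measure_iff)
  qed
  obtain c \<beta>\<^sub>0 \<beta>\<^sub>1 where c: "c \<ge> 0" and \<beta>: "\<beta>\<^sub>0 \<ge> 0" "\<beta>\<^sub>1 \<ge> 0"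
    "c = 0 \<or> \<alpha>\<^sub>0 * \<beta>\<^sub>0 ^ 3 = 1" "c = 0 \<or> \<alpha>\<^sub>1 * \<beta>\<^sub>1 ^ 3 = 1"
    and c4: "c ^ 4 * (t * \<beta>\<^sub>1 + (1 - t) * \<beta>\<^sub>0) = c ^ 3" and c3: "c ^ 3 = \<gamma>"
    by (rule dual_coefficients[OF assms(2-4)]) (use assms(12) in blast)
  obtain \<phi> where \<phi>: "\<And>m. test_function \<Omega> (\<phi> m)" "\<And>m x. 0 \<le> \<phi> m x" "\<And>m x. \<phi> m x \<le> 1"
    "\<And>x. x \<in> \<Omega> \<Longrightarrow> (\<lambda>m::nat. \<phi> m x) \<longlonglongrightarrow> 1"
    using test_functions_exhaust[OF \<Omega>(1)] by metis
  have [measurable]: "\<phi> m \<in> borel_measurable (lebesgue_on \<Omega>)" for m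
  proof -
    have "\<phi> m \<in> borel_measurable borel"
      using \<phi>(1)[of m] by (auto simp: test_function_def intro: borel_measurable_smooth)
    then show ?thesis by (intro measurable_restrict_space1 measurable_completion) simp
  qed
  define I where "I m = (LINT x|lebesgue_on \<Omega>. \<phi> m x)" for m
  have \<phi>i: "integrable (lebesgue_on \<Omega>) (\<phi> m)" for m
    by (rule integrable_const_bound[where B = 1]) (use \<phi>(2,3) in \<open>auto intro!: AE_I2\<close>)
  have I: "I \<longlonglongrightarrow> \<mu>"
  proof -
    have "I \<longlonglongrightarrow> (LINT x|lebesgue_on \<Omega>. 1)"
      unfolding I_def
    proof (rule integral_dominated_convergence[where w = "\<lambda>x. 1"])
      show "AE x in lebesgue_on \<Omega>. (\<lambda>m. \<phi> m x) \<longlonglongrightarrow> 1" using \<phi>(4) by (intro AE_I2) simp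
      show "AE x in lebesgue_on \<Omega>. norm (\<phi> m x) \<le> 1" for m using \<phi>(2,3)[of m] by (intro AE_I2) simp
    qed auto
    then show ?thesis by (simp add: \<mu>_def measure_restrict_space \<Omega>s)
  qed
  note wU = weakly_tendsto_L2_fst[OF assms(5)] and wV = weakly_tendsto_L2_snd[OF assms(5)]
  have Uj: "square_integrable (lebesgue_on \<Omega>) (Uj j)" and Vj: "square_integrable (lebesgue_on \<Omega>) (Vj j)" for j
    using wU wV by (auto simp: weakly_tendsto_L2_def in_L2_iff_square_integrable)
  define b where "b j x = chi j x * \<beta>\<^sub>1 + (1 - chi j x) * \<beta>\<^sub>0" for j x
  have chi_i: "integrable (lebesgue_on \<Omega>) (chi j)" for j
  proof (rule integrable_const_bound[where B = 1, OF AE_I2 assms(6)])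
    show "norm (chi j x) \<le> 1" if "x \<in> space (lebesgue_on \<Omega>)" for x
      using assms(7)[of x j] that by auto
  qed
  have int_chi: "(LINT x|lebesgue_on \<Omega>. chi j x) = t * \<mu>" for j
  proof -
    define A where "A = {x \<in> \<Omega>. chi j x = 1}"
    have "chi j -` {1} \<inter> space (lebesgue_on \<Omega>) \<in> sets (lebesgue_on \<Omega>)"
      using assms(6) by (rule measurable_sets) simp
    moreover have "chi j -` {1} \<inter> space (lebesgue_on \<Omega>) = A" by (auto simp: A_def)
    ultimately have A: "A \<in> sets (lebesgue_on \<Omega>)" by (simp only:)
    have sub: "A \<subseteq> \<Omega>" by (auto simp: A_def)
    have "(LINT x|lebesgue_on \<Omega>. chi j x) = (LINT x|lebesgue_on \<Omega>. indicator A x)"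
    proof (rule Bochner_Integration.integral_cong[OF refl])
      show "chi j x = indicator A x" if "x \<in> space (lebesgue_on \<Omega>)" for x
        using assms(7)[of x j] that by (auto simp: indicator_def A_def)
    qed
    also have "\<dots> = measure (lebesgue_on \<Omega>) A" using sub by (simp add: Int_absorb2)
    also have "\<dots> = measure lebesgue A" using sub \<Omega>s by (intro measure_restrict_space) auto
    also have "\<dots> = t * \<mu>" by (simp only: A_def assms(11) \<mu>_def)
    finally show ?thesis .
  qed
  have bi: "integrable (lebesgue_on \<Omega>) (b j)" for j
    unfolding b_def using chi_i[of j] by simp
  have int_b: "(LINT x|lebesgue_on \<Omega>. b j x) = \<mu> * (t * \<beta>\<^sub>1 + (1 - t) * \<beta>\<^sub>0)" for j
  proof -
    have "(LINT x|lebesgue_on \<Omega>. b j x) = (LINT x|lebesgue_on \<Omega>. chi j x * (\<beta>\<^sub>1 - \<beta>\<^sub>0) + \<beta>\<^sub>0)"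
      by (simp add: b_def algebra_simps)
    also have "\<dots> = t * \<mu> * (\<beta>\<^sub>1 - \<beta>\<^sub>0) + \<beta>\<^sub>0 * \<mu>"
      using chi_i[of j] by (simp add: int_chi \<mu>_def measure_restrict_space \<Omega>s)
    finally show ?thesis by (simp add: algebra_simps)
  qed
  \<comment> \<open>The cut-off is kept in the linear term, which passes to the limit, but is bounded by \<open>1\<close> in the term with \<open>b j\<close>, as only its
    integral over all of \<open>\<Omega>\<close> is known.\<close>
  have key: "4 * c ^ 3 * (norm U)\<^sup>2 * ((norm U)\<^sup>2 * I m) - 3 * c ^ 3 * norm U ^ 4 * \<mu> \<le> (U \<bullet> V) * I m" for m
  proof -
    have bd: "integrable (lebesgue_on \<Omega>) (\<lambda>x. \<phi> m x * f x)" if "integrable (lebesgue_on \<Omega>) f" for f :: "real^'n \<Rightarrow> real"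
      using integrable_mult_bounded[OF that, of "\<phi> m" 1] \<phi>(2,3)[of m] by (simp add: mult.commute)
    have cU: "square_integrable (lebesgue_on \<Omega>) (\<lambda>x. U)" by (simp add: square_integrable_def)
    have i1: "integrable (lebesgue_on \<Omega>) (\<lambda>x. \<phi> m x * (Uj j x \<bullet> Vj j x))" for j
      by (rule bd[OF integrable_inner_square_integrable[OF Uj Vj]])
    have i2: "integrable (lebesgue_on \<Omega>) (\<lambda>x. \<phi> m x * (Uj j x \<bullet> U))" for j
      by (rule bd[OF integrable_inner_square_integrable[OF Uj cU]])
    have le: "4 * c ^ 3 * (norm U)\<^sup>2 * (LINT x|lebesgue_on \<Omega>. \<phi> m x * (Uj j x \<bullet> U)) - 3 * c ^ 3 * norm U ^ 4 * \<mu>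
        \<le> (LINT x|lebesgue_on \<Omega>. \<phi> m x * (Uj j x \<bullet> Vj j x))" for j
    proof -
      have "(LINT x|lebesgue_on \<Omega>. 4 * c ^ 3 * (norm U)\<^sup>2 * (\<phi> m x * (Uj j x \<bullet> U)) - 3 * c ^ 4 * norm U ^ 4 * b j x)
          \<le> (LINT x|lebesgue_on \<Omega>. \<phi> m x * (Uj j x \<bullet> Vj j x))"
      proof (rule integral_mono_AE)
        show "AE x in lebesgue_on \<Omega>. 4 * c ^ 3 * (norm U)\<^sup>2 * (\<phi> m x * (Uj j x \<bullet> U)) - 3 * c ^ 4 * norm U ^ 4 * b j x
            \<le> \<phi> m x * (Uj j x \<bullet> Vj j x)"
          using assms(10)[of j] AE_space
        proof eventually_elim
          case (elim x)
          let ?a = "chi j x * \<alpha>\<^sub>1 + (1 - chi j x) * \<alpha>\<^sub>0"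
          have x: "chi j x = 0 \<or> chi j x = 1" using elim(2) assms(7)[of x j] by auto
          have ab: "?a \<ge> 0" "b j x \<ge> 0" "c = 0 \<or> ?a * b j x ^ 3 = 1"
            using x assms(2,3) \<beta> by (auto simp: b_def)
          have "Uj j x \<bullet> Vj j x = ?a * norm (Uj j x) ^ 4"
            by (subst elim(1)) (simp add: power4_eq_xxxx power2_eq_square flip: power2_norm_eq_inner)
          then have "4 * c ^ 3 * (norm U)\<^sup>2 * (Uj j x \<bullet> U) - 3 * c ^ 4 * norm U ^ 4 * b j x \<le> Uj j x \<bullet> Vj j x"
            using quartic_tangent_bound[OF ab(1,2) c ab(3), of U "Uj j x"] by simp
          from mult_left_mono[OF this \<phi>(2)[of m x]]
          have "4 * c ^ 3 * (norm U)\<^sup>2 * (\<phi> m x * (Uj j x \<bullet> U)) - \<phi> m x * (3 * c ^ 4 * norm U ^ 4 * b j x)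
              \<le> \<phi> m x * (Uj j x \<bullet> Vj j x)" by (simp add: right_diff_distrib mult_ac)
          moreover have "\<phi> m x * (3 * c ^ 4 * norm U ^ 4 * b j x) \<le> 3 * c ^ 4 * norm U ^ 4 * b j x"
            using \<phi>(2,3)[of m x] c ab(2) by (intro mult_left_le_one_le) auto
          ultimately show ?case by linarith
        qed
      qed (use i1 i2 bi in auto)
      moreover have "(LINT x|lebesgue_on \<Omega>. 4 * c ^ 3 * (norm U)\<^sup>2 * (\<phi> m x * (Uj j x \<bullet> U)) - 3 * c ^ 4 * norm U ^ 4 * b j x)
          = 4 * c ^ 3 * (norm U)\<^sup>2 * (LINT x|lebesgue_on \<Omega>. \<phi> m x * (Uj j x \<bullet> U))
            - 3 * norm U ^ 4 * \<mu> * (c ^ 4 * (t * \<beta>\<^sub>1 + (1 - t) * \<beta>\<^sub>0))"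
        using i2[of j] bi[of j] by (simp add: int_b)
      ultimately show ?thesis unfolding c4 by (simp add: mult_ac)
    qed
    have l1: "(\<lambda>j. LINT x|lebesgue_on \<Omega>. \<phi> m x * (Uj j x \<bullet> Vj j x)) \<longlonglongrightarrow> (U \<bullet> V) * I m"
      using div_curl_lemma[OF \<Omega>(1,2) \<phi>(1)[of m] wU wV assms(8,9)] by (simp add: I_def mult.commute)
    have "in_L2 \<Omega> (\<lambda>x. \<phi> m x *\<^sub>R U)"
      unfolding in_L2_iff_square_integrable
      by (rule square_integrable_bound[OF cU, where C = 1]) (use \<phi>(2,3)[of m] in \<open>auto intro!: mult_left_le_one_le\<close>)
    then have "(\<lambda>j. LINT x|lebesgue_on \<Omega>. Uj j x \<bullet> (\<phi> m x *\<^sub>R U)) \<longlonglongrightarrow> (LINT x|lebesgue_on \<Omega>. U \<bullet> (\<phi> m x *\<^sub>R U))"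
      using wU unfolding weakly_tendsto_L2_def by blast
    then have l2: "(\<lambda>j. LINT x|lebesgue_on \<Omega>. \<phi> m x * (Uj j x \<bullet> U)) \<longlonglongrightarrow> (norm U)\<^sup>2 * I m"
      by (simp add: I_def mult.commute power2_norm_eq_inner)
    show ?thesis
      by (rule LIMSEQ_le[OF tendsto_diff[OF tendsto_mult_left[OF l2] tendsto_const] l1]) (use le in blast)
  qed
  have "4 * c ^ 3 * (norm U)\<^sup>2 * ((norm U)\<^sup>2 * \<mu>) - 3 * c ^ 3 * norm U ^ 4 * \<mu> \<le> (U \<bullet> V) * \<mu>"
    by (rule LIMSEQ_le[OF tendsto_diff[OF tendsto_mult_left[OF tendsto_mult_left[OF I]] tendsto_const]
          tendsto_mult_left[OF I]]) (use key in blast)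
  then have "(c ^ 3 * norm U ^ 4) * \<mu> \<le> (U \<bullet> V) * \<mu>"
    by (simp add: power2_eq_square power4_eq_xxxx mult_ac)
  then show ?thesis using \<mu> by (simp add: c3 inner_commute)
qed

end
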